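(* Let $\Sigma\subset\mathbb{H}$ be a smooth embedded surface in the Heisenberg group $\mathbb{H}$. Assume that all characteristic points of $\Sigma$ are isolated and mildly degenerate. Then the horizontal mean curvature $\mathcal{H}$ of $\Sigma$ satisfies $$\mathcal{H}\in L^1_{\mathrm{loc}}(\Sigma,\sigma_{\mathrm{R}}),$$ where $\sigma_{\mathrm{R}}$ denotes the Riemannian induced measure on $\Sigma$.
   Context: The Heisenberg group $\mathbb{H}$ is $\mathbb{R}^3$ with the distribution $\mathcal{D}=\ker\left(dz-\frac12(x\,dy-y\,dx)\right)$ and the metric $g$ on $\mathcal{D}$ for which $X=\partial_x-\frac y2\partial_z$, $Y=\partial_y+\frac x2\partial_z$ is an orthonormal frame. It is equipped with the Lebesgue measure $\mu$. Horizontal gradient: $\nabla f=(Xf)X+(Yf)Y$, with norm $\|\nabla f\|=\left((Xf)^2+(Yf)^2\right)^{1/2}$. The divergence $\mathrm{div}_\mu$ is with respect to Lebesgue measure. A local defining function for $\Sigma$ near $p\in\Sigma$ is a $C^\infty$ function $u$ on a neighborhood $U$ of $p$ with $\Sigma\cap U=\{u=0\}$ and $du\neq0$ on $\Sigma\cap U$. Characteristic points: $p\in\Sigma$ is characteristic if $\mathcal{D}_p\subseteq T_p\Sigma$, equivalently $Xu(p)=Yu(p)=0$. The set of characteristic points is $C(\Sigma)$ (closed, zero measure in $\Sigma$); $p$ is isolated if it is an isolated point of $C(\Sigma)$. Horizontal Hessian at $p\in C(\Sigma)$: the bilinear form on $\mathcal{D}_p$ given by $\mathrm{Hess}_{\mathrm{H}}(u)|_p(V,W)=\sum_{i,j=1}^2V^iW^jX_iX_ju(p)$,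 where $X_1=X$, $X_2=Y$, $V=\sum_i V^iX_i$, $W=\sum_j W^jX_j$. The point $p\in C(\Sigma)$ is degenerate if the determinant of the matrix $(X_iX_ju(p))_{i,j}$ is $0$ (independent of the choice of $u$). The frame $N,T$: if $p\in C(\Sigma)$ is degenerate, the matrix has rank exactly one, and there is a unit vector $N_p\in\mathcal{D}_p$, unique up to sign, in the kernel of the Hessian, meaning $\mathrm{Hess}_{\mathrm{H}}(u)|_p(N_p,V)=0$ for all $V\in\mathcal{D}_p$. Write $N_p=aX_p+bY_p$ with $a^2+b^2=1$ and extend it to the left-invariant vector field $N=aX+bY$ ($a,b$ constant); set $T=-bX+aY$. Critical curve of $p$: $\mathcal{C}=\{q\in\Sigma : N(q)\in T_q\Sigma\}$. In a neighborhood of $p$ it is a smooth curve in $\Sigma$ through $p$. Mildly degenerate: a degenerate characteristic point $p$ is mildly degenerate if, for a regular parametrization $\gamma:(-\varepsilon,\varepsilon)\to\mathcal{C}$ of $\mathcal{C}$ near $p$ with $\gamma(0)=p$ and a local defining function $u$ near $p$, the function $s\mapsto Tu(\gamma(s))$ has a zero of finite order at $s=0$ (i.e. some derivative at $0$ is non-zero). This does not depend on the choices of $u$ and $\gamma$. Horizontal mean curvature: for $p\in\Sigma\setminus C(\Sigma)$, $\mathcal{H}(p)=-\mathrm{div}_\mu\left(\frac{\nabla u}{\|\nabla u\|}\right)\big|_p$ with $u$ a local defining function for $\Sigma$ near $p$; up to sign it does not depend on $u$. Riemannian induced measure: choose any Riemannian metric on $\mathbb{R}^3$ extending $g$, and let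 $n$ be the corresponding unit normal to $\Sigma$; $\sigma_{\mathrm{R}}$ is the measure on $\Sigma$ with density $|i_n\mu|$. The choice of extension plays no role in the integrability statement. $f\in L^1_{\mathrm{loc}}(\Sigma,\sigma_{\mathrm{R}})$ means that every point of $\Sigma$ has a neighborhood in $\Sigma$ on which $|f|$ is $\sigma_{\mathrm{R}}$-integrable. *)

theory Defs
  imports "HOL-Analysis.Analysis"
begin

text \<open>
  \<open>C\<^sup>\<infinity>\<close> maps. Both predicates are meant for open \<open>S\<close>: derivatives are full derivatives at
  the points of \<open>S\<close>, and differentiability of order \<open>Suc k\<close> asks that all directional
  derivatives be of class \<open>C\<^sup>k\<close>, which in finite dimension is the usual notion.
\<close>

primrec Ck_on :: "nat \<Rightarrow> ('a::euclidean_space \<Rightarrow> 'b::euclidean_space) \<Rightarrow> 'a set \<Rightarrow> bool" where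
  "Ck_on 0 f S \<longleftrightarrow> continuous_on S f"
| "Ck_on (Suc k) f S \<longleftrightarrow>
     (\<forall>x\<in>S. f differentiable (at x)) \<and> (\<forall>v. Ck_on k (\<lambda>x. frechet_derivative f (at x) v) S)"

definition smooth_on :: "('a::euclidean_space \<Rightarrow> 'b::euclidean_space) \<Rightarrow> 'a set \<Rightarrow> bool" where
  "smooth_on f S \<longleftrightarrow> (\<forall>k. Ck_on k f S)"


section \<open>The Heisenberg group\<close>

definition distribution :: "real^3 \<Rightarrow> (real^3) set" where
  "distribution p = {v. v$3 - (p$1 * v$2 - p$2 * v$1) / 2 = 0}"

definition X_field :: "real^3 \<Rightarrow> real^3" where
  "X_field p = vector [1, 0, - (p$2) / 2]"

definition Y_field :: "real^3 \<Rightarrow> real^3" where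
  "Y_field p = vector [0, 1, p$1 / 2]"

definition frame :: "2 \<Rightarrow> real^3 \<Rightarrow> real^3" where
  "frame i = (if i = 1 then X_field else Y_field)"

lemma distribution_eq: "distribution p = {a *\<^sub>R X_field p + b *\<^sub>R Y_field p | a b. True}"
proof -
  have "v = v$1 *\<^sub>R X_field p + v$2 *\<^sub>R Y_field p" if "v \<in> distribution p" for v
    using that by (auto simp: distribution_def X_field_def Y_field_def vec_eq_iff forall_3 vector_3
        algebra_simps diff_divide_distrib)
  moreover have "a *\<^sub>R X_field p + b *\<^sub>R Y_field p \<in> distribution p" for a b
    by (simp add: distribution_def X_field_def Y_field_def vector_3 algebra_simps diff_divide_distrib)
  ultimately show ?thesis by blast
qed

text \<open>The derivative \<open>Vf\<close> of a function along a vector field.\<close>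

definition lie_deriv :: "(real^3 \<Rightarrow> real^3) \<Rightarrow> (real^3 \<Rightarrow> real) \<Rightarrow> real^3 \<Rightarrow> real" where
  "lie_deriv V f p = frechet_derivative f (at p) (V p)"

definition horizontal_gradient :: "(real^3 \<Rightarrow> real) \<Rightarrow> real^3 \<Rightarrow> real^3" where
  "horizontal_gradient f p =
     lie_deriv X_field f p *\<^sub>R X_field p + lie_deriv Y_field f p *\<^sub>R Y_field p"

definition horizontal_gradient_norm :: "(real^3 \<Rightarrow> real) \<Rightarrow> real^3 \<Rightarrow> real" where
  "horizontal_gradient_norm f p = sqrt ((lie_deriv X_field f p)\<^sup>2 + (lie_deriv Y_field f p)\<^sup>2)"

text \<open>Divergence with respect to Lebesgue measure, in the standard coordinates of \<open>\<real>\<^sup>3\<close>.\<close>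

definition divergence :: "(real^3 \<Rightarrow> real^3) \<Rightarrow> real^3 \<Rightarrow> real" where
  "divergence V p = (\<Sum>i\<in>UNIV. frechet_derivative V (at p) (axis i 1) $ i)"


section \<open>Surfaces and characteristic points\<close>

definition local_defining_function ::
  "(real^3) set \<Rightarrow> real^3 \<Rightarrow> (real^3) set \<Rightarrow> (real^3 \<Rightarrow> real) \<Rightarrow> bool" where
  "local_defining_function S p U u \<longleftrightarrow>
     open U \<and> p \<in> U \<and> smooth_on u U \<and> S \<inter> U = {q \<in> U. u q = 0} \<and>
     (\<forall>q \<in> S \<inter> U. frechet_derivative u (at q) \<noteq> (\<lambda>_. 0))"

text \<open>Embedded surfaces have no boundary, but need not be closed, connected or orientable.\<close>

definition smooth_embedded_surface :: "(real^3) set \<Rightarrow> bool" where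
  "smooth_embedded_surface S \<longleftrightarrow> (\<forall>p\<in>S. \<exists>U u. local_defining_function S p U u)"

text \<open>
  In this definition and in those below, the choice of the local defining function is
  immaterial: two of them near the same point differ by a non-vanishing smooth factor.
\<close>

definition tangent_plane :: "(real^3) set \<Rightarrow> real^3 \<Rightarrow> (real^3) set" where
  "tangent_plane S p =
     {v. \<exists>U u. local_defining_function S p U u \<and> frechet_derivative u (at p) v = 0}"

definition characteristic_set :: "(real^3) set \<Rightarrow> (real^3) set" where
  "characteristic_set S = {p \<in> S. distribution p \<subseteq> tangent_plane S p}"

text \<open>The matrix \<open>(X\<^sub>i X\<^sub>j u(p))\<close>; it is not symmetric, as \<open>X\<close> and \<open>Y\<close> do not commute.\<close>

definition hessian_matrix :: "(real^3 \<Rightarrow> real) \<Rightarrow> real^3 \<Rightarrow> real^2^2" where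
  "hessian_matrix u p = (\<chi> i j. lie_deriv (frame i) (lie_deriv (frame j) u) p)"

text \<open>
  The horizontal Hessian as a bilinear form on the plane \<open>distribution p\<close>: the components of a
  horizontal vector in the frame \<open>X, Y\<close> are its first two coordinates.
\<close>

definition frame_component :: "real^3 \<Rightarrow> 2 \<Rightarrow> real" where
  "frame_component V i = (if i = 1 then V$1 else V$2)"

lemma frame_component:
  assumes "V \<in> distribution p"
  shows "V = (\<Sum>i\<in>UNIV. frame_component V i *\<^sub>R frame i p)"
  using assms by (auto simp: sum_2 frame_component_def frame_def distribution_def X_field_def
      Y_field_def vec_eq_iff forall_3 vector_3 algebra_simps diff_divide_distrib)

definition horizontal_hessian :: "(real^3 \<Rightarrow> real) \<Rightarrow> real^3 \<Rightarrow> real^3 \<Rightarrow> real^3 \<Rightarrow> real" where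
  "horizontal_hessian u p V W =
     (\<Sum>i\<in>UNIV. \<Sum>j\<in>UNIV. frame_component V i * frame_component W j * hessian_matrix u p $ i $ j)"

definition degenerate :: "(real^3) set \<Rightarrow> real^3 \<Rightarrow> bool" where
  "degenerate S p \<longleftrightarrow> p \<in> characteristic_set S \<and>
     (\<exists>U u. local_defining_function S p U u \<and> det (hessian_matrix u p) = 0)"

text \<open>The left-invariant fields \<open>N = aX + bY\<close> and \<open>T = -bX + aY\<close>.\<close>

definition N_field :: "real \<Rightarrow> real \<Rightarrow> real^3 \<Rightarrow> real^3" where
  "N_field a b q = a *\<^sub>R X_field q + b *\<^sub>R Y_field q"

definition T_field :: "real \<Rightarrow> real \<Rightarrow> real^3 \<Rightarrow> real^3" where
  "T_field a b q = - b *\<^sub>R X_field q + a *\<^sub>R Y_field q"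

text \<open>
  \<open>a, b\<close> are the components of a unit vector \<open>N\<^sub>p\<close> in the kernel of the horizontal Hessian,
  in its first argument.
\<close>

definition hessian_kernel_direction ::
  "(real^3) set \<Rightarrow> real^3 \<Rightarrow> real \<Rightarrow> real \<Rightarrow> bool" where
  "hessian_kernel_direction S p a b \<longleftrightarrow> a\<^sup>2 + b\<^sup>2 = 1 \<and>
     (\<exists>U u. local_defining_function S p U u \<and>
        (\<forall>V \<in> distribution p. horizontal_hessian u p (N_field a b p) V = 0))"

definition critical_curve :: "(real^3) set \<Rightarrow> real \<Rightarrow> real \<Rightarrow> (real^3) set" where
  "critical_curve S a b = {q \<in> S. N_field a b q \<in> tangent_plane S q}"

definition regular_parametrization_near ::
  "(real^3) set \<Rightarrow> real^3 \<Rightarrow> real \<Rightarrow> (real \<Rightarrow> real^3) \<Rightarrow> bool" where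
  "regular_parametrization_near C p \<epsilon> \<gamma> \<longleftrightarrow>
     \<epsilon> > 0 \<and> \<gamma> 0 = p \<and> smooth_on \<gamma> {-\<epsilon><..<\<epsilon>} \<and> inj_on \<gamma> {-\<epsilon><..<\<epsilon>} \<and>
     (\<forall>s \<in> {-\<epsilon><..<\<epsilon>}. vector_derivative \<gamma> (at s) \<noteq> 0) \<and>
     (\<exists>W. open W \<and> p \<in> W \<and> \<gamma> ` {-\<epsilon><..<\<epsilon>} = C \<inter> W)"

definition mildly_degenerate :: "(real^3) set \<Rightarrow> real^3 \<Rightarrow> bool" where
  "mildly_degenerate S p \<longleftrightarrow> degenerate S p \<and>
     (\<exists>a b \<epsilon> \<gamma> U u. hessian_kernel_direction S p a b \<and>
        regular_parametrization_near (critical_curve S a b) p \<epsilon> \<gamma> \<and>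
        local_defining_function S p U u \<and>
        (\<exists>k. (deriv ^^ k) (\<lambda>s. lie_deriv (T_field a b) u (\<gamma> s)) 0 \<noteq> 0))"


section \<open>Horizontal mean curvature\<close>

text \<open>
  The horizontal mean curvature is determined up to sign, off the characteristic set. The
  predicate says that \<open>H\<close> is some determination of it: the sign may be chosen separately at each
  point, and nothing is said about the values on the characteristic set.
\<close>

definition is_horizontal_mean_curvature :: "(real^3) set \<Rightarrow> (real^3 \<Rightarrow> real) \<Rightarrow> bool" where
  "is_horizontal_mean_curvature S H \<longleftrightarrow>
     (\<forall>p \<in> S - characteristic_set S. \<exists>U u. local_defining_function S p U u \<and>
        H p = - divergence (\<lambda>q. (1 / horizontal_gradient_norm u q) *\<^sub>R horizontal_gradient u q) p)"


section \<open>The Riemannian induced measure\<close>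

definition riemannian_metric :: "(real^3 \<Rightarrow> real^3 \<Rightarrow> real^3 \<Rightarrow> real) \<Rightarrow> bool" where
  "riemannian_metric G \<longleftrightarrow>
     (\<forall>v w. smooth_on (\<lambda>p. G p v w) UNIV) \<and>
     (\<forall>p. bilinear (G p) \<and> (\<forall>v w. G p v w = G p w v) \<and> (\<forall>v. v \<noteq> 0 \<longrightarrow> G p v v > 0))"

text \<open>The sub-Riemannian metric on the distribution is the one making \<open>X, Y\<close> orthonormal.\<close>

definition extends_heisenberg_metric :: "(real^3 \<Rightarrow> real^3 \<Rightarrow> real^3 \<Rightarrow> real) \<Rightarrow> bool" where
  "extends_heisenberg_metric G \<longleftrightarrow>
     (\<forall>p. G p (X_field p) (X_field p) = 1 \<and> G p (Y_field p) (Y_field p) = 1 \<and>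
          G p (X_field p) (Y_field p) = 0)"

text \<open>
  A unit normal is chosen at each point, without any continuity, as \<open>S\<close> need not be orientable;
  only the absolute value of the density below matters.
\<close>

definition unit_normal ::
  "(real^3 \<Rightarrow> real^3 \<Rightarrow> real^3 \<Rightarrow> real) \<Rightarrow> (real^3) set \<Rightarrow> (real^3 \<Rightarrow> real^3) \<Rightarrow> bool" where
  "unit_normal G S n \<longleftrightarrow>
     (\<forall>p\<in>S. G p (n p) (n p) = 1 \<and> (\<forall>v \<in> tangent_plane S p. G p (n p) v = 0))"

definition local_parametrization ::
  "(real^3) set \<Rightarrow> (real^2) set \<Rightarrow> (real^2 \<Rightarrow> real^3) \<Rightarrow> bool" where
  "local_parametrization S V \<phi> \<longleftrightarrow>
     open V \<and> smooth_on \<phi> V \<and> (\<forall>v\<in>V. inj (frechet_derivative \<phi> (at v))) \<and>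
     openin (top_of_set S) (\<phi> ` V) \<and> (\<exists>\<psi>. homeomorphism V (\<phi> ` V) \<phi> \<psi>)"

text \<open>
  \<open>M\<close> is the Borel measure on \<open>S\<close> with density \<open>|i\<^sub>n \<mu>|\<close>, where \<open>i\<^sub>n \<mu> (v, w) = det (n, v, w)\<close>: in every
  local parametrization \<open>\<phi>\<close> it is given by integrating \<open>|det (n, \<partial>\<^sub>1\<phi>, \<partial>\<^sub>2\<phi>)|\<close>. Since \<open>S\<close> is covered
  by countably many parametrized patches, there is exactly one such measure.
\<close>

definition is_induced_measure ::
  "(real^3 \<Rightarrow> real^3 \<Rightarrow> real^3 \<Rightarrow> real) \<Rightarrow> (real^3) set \<Rightarrow> (real^3) measure \<Rightarrow> bool" where
  "is_induced_measure G S M \<longleftrightarrow>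
     space M = S \<and> sets M = sets (restrict_space borel S) \<and>
     (\<exists>n. unit_normal G S n \<and>
       (\<forall>V \<phi>. local_parametrization S V \<phi> \<longrightarrow>
         (\<forall>A \<in> sets borel. A \<subseteq> V \<longrightarrow>
           emeasure M (\<phi> ` A) =
             (\<integral>\<^sup>+ v \<in> A. ennreal \<bar>det (vector [n (\<phi> v),
                 frechet_derivative \<phi> (at v) (axis 1 1),
                 frechet_derivative \<phi> (at v) (axis 2 1)] :: real^3^3)\<bar> \<partial>lborel))))"

text \<open>Local integrability on \<open>S\<close>; only \<open>|f|\<close> enters, so that a function given up to sign is allowed.\<close>

definition locally_L1 :: "(real^3) set \<Rightarrow> (real^3) measure \<Rightarrow> (real^3 \<Rightarrow> real) \<Rightarrow> bool" where
  "locally_L1 S M f \<longleftrightarrow>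
     (\<forall>p\<in>S. \<exists>W. openin (top_of_set S) W \<and> p \<in> W \<and> set_integrable M W (\<lambda>q. \<bar>f q\<bar>))"

end

theory Submission
  imports Defs
begin

text \<open>
  Write \<open>A = Xu\<close>, \<open>B = Yu\<close>, \<open>h = \<parallel>\<nabla>u\<parallel>\<close> and \<open>J = -BX + AY\<close>. Since the unit vector \<open>\<nabla>u / h\<close> can only
  rotate, its divergence is \<open>(A JB - B JA) / h\<^sup>3\<close>, a derivative along the surface because \<open>J\<close> is tangent
  to it. Hence \<open>|H|\<close> does not depend on \<open>u\<close>, and \<open>|H| \<le> L / h\<close> locally.

  Near a mildly degenerate point the surface is a graph with coordinates \<open>(s, t)\<close> in the directions
  \<open>N\<close>, \<open>T\<close>. There \<open>TNu \<noteq> 0\<close>, since \<open>NTu = 0\<close> and \<open>[N, T]u\<close> is a multiple of \<open>\<partial>\<^sub>zu \<noteq> 0\<close>; so \<open>|Nu|\<close> is at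
  least a multiple of the distance \<open>|t - g(s)|\<close> to the critical curve \<open>t = g(s)\<close>. On this curve \<open>|Tu|\<close>
  is at least a multiple of \<open>|s|\<^sup>k\<close>. Therefore \<open>h \<ge> c (|t - g(s)| + |s|\<^sup>k)\<close>, whose inverse is integrable.
\<close>

section \<open>Calculus of smooth functions\<close>

text \<open>Defining functions are the recurring obstacle: the kernel direction, the finite order
  condition and the value of \<open>H\<close> at each point may all come with different ones. They
  are compared only at points of \<open>S\<close>, where their differentials are proportional, with
  a factor about whose dependence on the point nothing is known. Whatever has to be differentiated
  is therefore phrased as a function vanishing on \<open>S\<close>, whose derivative kills tangent
  vectors.

  Near a mildly degenerate point \<open>1 / |t - g(s)|\<close> alone is not integrable in
  \<open>t\<close>; the finite order of \<open>Tu\<close> along the curve supplies the missing term.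
  Its order may be arbitrary, because the exponents of the final estimate are tuned to it. The
  number \<open>g(s)\<close> is found separately for each \<open>s\<close>, as the second coordinate
  of some point of the given parametrized curve above \<open>s\<close>.

  On the measure side an upper estimate suffices: on a compact piece of a chart the induced measure
  is at most a constant times Lebesgue measure.\<close>

lemma Ck_on_Suc_has_derivative:
  assumes "Ck_on (Suc k) f S" "x \<in> S"
  shows "(f has_derivative frechet_derivative f (at x)) (at x)"
  using assms by (simp add: frechet_derivative_works)

lemma smooth_on_has_derivative:
  assumes "smooth_on f S" "x \<in> S"
  shows "(f has_derivative frechet_derivative f (at x)) (at x)"
  using assms Ck_on_Suc_has_derivative unfolding smooth_on_def by blast

lemma smooth_on_continuous_on:
  assumes "smooth_on f S"
  shows "continuous_on S f"
  using assms Ck_on.simps(1) unfolding smooth_on_def by blast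

lemma smooth_on_frechet_derivative:
  assumes "smooth_on f S"
  shows "smooth_on (\<lambda>x. frechet_derivative f (at x) v) S"
  using assms Ck_on.simps(2) unfolding smooth_on_def by blast

section \<open>Closure properties of the classes \<open>Ck_on\<close>\<close>

lemma Ck_on_cong:
  assumes "open S" "\<And>x. x \<in> S \<Longrightarrow> f x = g x" "Ck_on k f S"
  shows "Ck_on k g S"
  using assms
proof (induction k arbitrary: f g)
  case 0
  then show ?case by (simp cong: continuous_on_cong)
next
  case (Suc k)
  have "frechet_derivative f (at x) = frechet_derivative g (at x)" if "x \<in> S" for x
    using Suc.prems that frechet_derivative_transform_within_open
    by (metis Ck_on.simps(2))
  moreover have "g differentiable at x" if "x \<in> S" for x
    using Suc.prems that
    unfolding Ck_on.simps(2) differentiable_def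
    by (blast intro: has_derivative_transform_within_open[OF _ Suc.prems(1) that])
  ultimately show ?case
    using Suc.prems(3) Suc.IH[OF Suc.prems(1), of "\<lambda>x. frechet_derivative f (at x) _" "\<lambda>x. frechet_derivative g (at x) _"]
    unfolding Ck_on.simps(2) by simp
qed

text \<open>\<open>Ck_on\<close> speaks of \<open>frechet_derivative\<close>, a choice operator. The
  derivative at a point is unique, so any explicit formula for it can take its place; most
  inductions on the class below go through this rule.\<close>

lemma Ck_on_SucI:
  assumes "open S" "\<And>x. x \<in> S \<Longrightarrow> (f has_derivative f' x) (at x)"
    and "\<And>v. Ck_on k (\<lambda>x. f' x v) S"
  shows "Ck_on (Suc k) f S"
proof -
  have "frechet_derivative f (at x) = f' x" if "x \<in> S" for x
    using assms(2)[OF that] frechet_derivative_at by metis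
  then have "Ck_on k (\<lambda>x. frechet_derivative f (at x) v) S" for v
    by (intro Ck_on_cong[OF assms(1) _ assms(3)[of v]]) simp
  then show ?thesis
    using assms(2) by (auto simp: differentiable_def)
qed

lemma Ck_on_subset:
  assumes "Ck_on k f S" "T \<subseteq> S"
  shows "Ck_on k f T"
  using assms by (induction k arbitrary: f) (auto intro: continuous_on_subset)

lemma Ck_on_SucD:
  assumes "Ck_on (Suc k) f S"
  shows "Ck_on k f S"
  using assms
proof (induction k arbitrary: f)
  case 0
  then show ?case
    by (auto intro!: continuous_at_imp_continuous_on differentiable_imp_continuous_within)
qed (metis Ck_on.simps(2))

lemma Ck_on_const: "Ck_on k (\<lambda>x. c) S"
  by (induction k arbitrary: c) auto

lemma Ck_on_bounded_linear:
  assumes "open S" "bounded_linear f"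
  shows "Ck_on k f S"
proof (cases k)
  case 0
  then show ?thesis using assms linear_continuous_on by auto
next
  case (Suc m)
  have "Ck_on (Suc m) f S"
    by (rule Ck_on_SucI[where f' = "\<lambda>_. f"])
      (use assms in \<open>auto intro: Ck_on_const bounded_linear_imp_has_derivative\<close>)
  then show ?thesis using Suc by simp
qed

lemma Ck_on_compose_bounded_linear:
  assumes "open S" "bounded_linear h" "Ck_on k f S"
  shows "Ck_on k (\<lambda>x. h (f x)) S"
  using assms(3)
proof (induction k arbitrary: f)
  case 0
  then show ?case
    using assms(2) bounded_linear.continuous_on by auto
next
  case (Suc k)
  show ?case
  proof (rule Ck_on_SucI[OF assms(1)])
    show "((\<lambda>x. h (f x)) has_derivative (\<lambda>v. h (frechet_derivative f (at x) v))) (at x)"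
      if "x \<in> S" for x
      using bounded_linear.has_derivative[OF assms(2) Ck_on_Suc_has_derivative[OF Suc.prems that]] .
    show "Ck_on k (\<lambda>x. h (frechet_derivative f (at x) v)) S" for v
      using Suc by simp
  qed
qed

lemma Ck_on_add:
  assumes "open S" "Ck_on k f S" "Ck_on k g S"
  shows "Ck_on k (\<lambda>x. f x + g x) S"
  using assms(2,3)
proof (induction k arbitrary: f g)
  case 0
  then show ?case by (simp add: continuous_on_add)
next
  case (Suc k)
  show ?case
  proof (rule Ck_on_SucI[OF assms(1)])
    show "((\<lambda>x. f x + g x) has_derivative
        (\<lambda>v. frechet_derivative f (at x) v + frechet_derivative g (at x) v)) (at x)"
      if "x \<in> S" for x
      using has_derivative_add Ck_on_Suc_has_derivative Suc.prems that by blast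
    show "Ck_on k (\<lambda>x. frechet_derivative f (at x) v + frechet_derivative g (at x) v) S" for v
      using Suc by simp
  qed
qed

lemma Ck_on_sum:
  assumes "open S" "\<And>i. i \<in> I \<Longrightarrow> Ck_on k (f i) S"
  shows "Ck_on k (\<lambda>x. \<Sum>i\<in>I. f i x) S"
  using assms(2)
proof (induction I rule: infinite_finite_induct)
  case (insert i I)
  then show ?case by (auto intro!: Ck_on_add[OF assms(1)])
qed (auto simp: Ck_on_const)

lemma Ck_on_bounded_bilinear:
  assumes "open S" "bounded_bilinear h" "Ck_on k f S" "Ck_on k g S"
  shows "Ck_on k (\<lambda>x. h (f x) (g x)) S"
  using assms(3,4)
proof (induction k arbitrary: f g)
  case 0
  then show ?case using bounded_bilinear.continuous_on[OF assms(2)] by auto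
next
  case (Suc k)
  show ?case
  proof (rule Ck_on_SucI[OF assms(1)])
    show "((\<lambda>x. h (f x) (g x)) has_derivative
        (\<lambda>v. h (f x) (frechet_derivative g (at x) v) + h (frechet_derivative f (at x) v) (g x))) (at x)"
      if "x \<in> S" for x
      by (rule bounded_bilinear.FDERIV[OF assms(2)])
        (use Ck_on_Suc_has_derivative Suc.prems that in blast)+
    \<comment> \<open>In each summand of the product rule one factor is a derivative, of class
      \<open>k\<close>, while the other is an undifferentiated function of class
      \<open>k + 1\<close>, which has to be lowered to \<open>k\<close> before the induction
      hypothesis applies.\<close>
    show "Ck_on k (\<lambda>x. h (f x) (frechet_derivative g (at x) v) +
        h (frechet_derivative f (at x) v) (g x)) S" for v
      using Suc.prems Suc.prems[THEN Ck_on_SucD] by (intro Ck_on_add[OF assms(1)] Suc.IH) auto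
  qed
qed

lemma linear_eq_sum_Basis:
  fixes L :: "'a::euclidean_space \<Rightarrow> 'b::real_vector"
  assumes "linear L"
  shows "L v = (\<Sum>b\<in>Basis. (v \<bullet> b) *\<^sub>R L b)"
  using linear_sum[OF assms, of "\<lambda>b. (v \<bullet> b) *\<^sub>R b" Basis]
  by (simp add: euclidean_representation linear_scale[OF assms])

text \<open>In the chain rule both the base point \<open>g x\<close> and the direction
  \<open>Dg x v\<close> vary with \<open>x\<close>, while \<open>Ck_on\<close> controls derivatives
  in fixed directions only. Expanding the direction in the basis gives a finite sum of products, to
  which the bilinear rule and the induction hypothesis apply.\<close>

lemma Ck_on_compose:
  assumes "open S" "open T" "g ` S \<subseteq> T" "Ck_on k f T" "Ck_on k g S"
  shows "Ck_on k (\<lambda>x. f (g x)) S"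
  using assms(4,5)
proof (induction k arbitrary: f)
  case 0
  then show ?case using assms(3) continuous_on_compose2 by auto
next
  case (Suc k)
  let ?Df = "\<lambda>y. frechet_derivative f (at y)" and ?Dg = "\<lambda>x. frechet_derivative g (at x)"
  show ?case
  proof (rule Ck_on_SucI[OF assms(1)])
    fix x assume "x \<in> S"
    then have f: "(f has_derivative ?Df (g x)) (at (g x))" and g: "(g has_derivative ?Dg x) (at x)"
      using Suc.prems assms(3) by (auto intro!: Ck_on_Suc_has_derivative simp del: Ck_on.simps)
    have "((\<lambda>x. f (g x)) has_derivative (\<lambda>v. ?Df (g x) (?Dg x v))) (at x)"
      using diff_chain_at[OF g f] by (simp add: o_def)
    moreover have "?Df (g x) (?Dg x v) = (\<Sum>b\<in>Basis. (?Dg x v \<bullet> b) *\<^sub>R ?Df (g x) b)" for v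
      using linear_eq_sum_Basis has_derivative_linear[OF f] by blast
    ultimately show "((\<lambda>x. f (g x)) has_derivative
        (\<lambda>v. \<Sum>b\<in>Basis. (?Dg x v \<bullet> b) *\<^sub>R ?Df (g x) b)) (at x)"
      by simp
  next
    show "Ck_on k (\<lambda>x. \<Sum>b\<in>Basis. (?Dg x v \<bullet> b) *\<^sub>R ?Df (g x) b) S" for v
    proof (intro Ck_on_sum Ck_on_bounded_bilinear[OF _ bounded_bilinear_scaleR] assms(1))
      fix b :: 'b assume "b \<in> Basis"
      show "Ck_on k (\<lambda>x. ?Dg x v \<bullet> b) S"
        using Suc.prems
        by (intro Ck_on_compose_bounded_linear[OF assms(1) bounded_linear_inner_left]) simp
      show "Ck_on k (\<lambda>x. ?Df (g x) b) S"
        using Suc.IH Suc.prems(1) Ck_on_SucD[OF Suc.prems(2)] by auto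
    qed
  qed
qed

lemma Ck_on_inverse: "Ck_on k (inverse :: real \<Rightarrow> real) (- {0})"
proof (induction k)
  case 0
  then show ?case by (auto intro!: continuous_intros)
next
  case (Suc k)
  have o: "open (- {0::real})" by auto
  show ?case
  proof (rule Ck_on_SucI[OF o])
    show "(inverse has_derivative (\<lambda>v. - (inverse x * v * inverse x))) (at x)" if "x \<in> - {0}" for x :: real
      using that has_derivative_inverse' by auto
    have "Ck_on k (\<lambda>x::real. inverse x * inverse x) (- {0})"
      using Ck_on_bounded_bilinear[OF o bounded_bilinear_mult Suc Suc] .
    from Ck_on_compose_bounded_linear[OF o bounded_linear_mult_right this]
    have "Ck_on k (\<lambda>x. (- v) * (inverse x * inverse x)) (- {0})" for v :: real .
    then show "Ck_on k (\<lambda>x. - (inverse x * v * inverse x)) (- {0})" for v :: real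
      by (simp add: mult_ac)
  qed
qed

lemma smooth_on_cong:
  assumes "open S" "\<And>x. x \<in> S \<Longrightarrow> f x = g x" "smooth_on f S"
  shows "smooth_on g S"
  using assms unfolding smooth_on_def by (blast intro: Ck_on_cong[of S f g])

lemma smooth_on_subset: "smooth_on f S \<Longrightarrow> T \<subseteq> S \<Longrightarrow> smooth_on f T"
  by (auto simp: smooth_on_def intro: Ck_on_subset)

lemma smooth_on_const: "smooth_on (\<lambda>x. c) S"
  by (simp add: smooth_on_def Ck_on_const)

lemma smooth_on_bounded_linear: "open S \<Longrightarrow> bounded_linear f \<Longrightarrow> smooth_on f S"
  by (simp add: smooth_on_def Ck_on_bounded_linear)

lemma smooth_on_add: "open S \<Longrightarrow> smooth_on f S \<Longrightarrow> smooth_on g S \<Longrightarrow> smooth_on (\<lambda>x. f x + g x) S"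
  by (simp add: smooth_on_def Ck_on_add)

lemma smooth_on_scaleR:
  "open S \<Longrightarrow> smooth_on f S \<Longrightarrow> smooth_on g S \<Longrightarrow> smooth_on (\<lambda>x. f x *\<^sub>R g x) S"
  by (simp add: smooth_on_def Ck_on_bounded_bilinear[OF _ bounded_bilinear_scaleR])

lemma smooth_on_mult:
  fixes f g :: "'a::euclidean_space \<Rightarrow> real"
  shows "open S \<Longrightarrow> smooth_on f S \<Longrightarrow> smooth_on g S \<Longrightarrow> smooth_on (\<lambda>x. f x * g x) S"
  using smooth_on_scaleR[of S f g] by simp

lemma smooth_on_sum:
  "open S \<Longrightarrow> (\<And>i. i \<in> I \<Longrightarrow> smooth_on (f i) S) \<Longrightarrow> smooth_on (\<lambda>x. \<Sum>i\<in>I. f i x) S"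
  by (simp add: smooth_on_def Ck_on_sum)

lemma smooth_on_compose:
  "open S \<Longrightarrow> open T \<Longrightarrow> g ` S \<subseteq> T \<Longrightarrow> smooth_on f T \<Longrightarrow> smooth_on g S \<Longrightarrow> smooth_on (\<lambda>x. f (g x)) S"
  unfolding smooth_on_def by (blast intro: Ck_on_compose[of S T g])

lemma smooth_on_cmult:
  fixes f :: "'a::euclidean_space \<Rightarrow> real"
  shows "open S \<Longrightarrow> smooth_on f S \<Longrightarrow> smooth_on (\<lambda>x. c * f x) S"
  by (intro smooth_on_mult smooth_on_const)

section \<open>Symmetry of second derivatives\<close>

lemma has_real_derivative_along_line:
  fixes f :: "'a::euclidean_space \<Rightarrow> real" and x v w :: 'a
  assumes "(f has_derivative D) (at (x + s *\<^sub>R v + t *\<^sub>R w))"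
  shows "((\<lambda>s. f (x + s *\<^sub>R v + t *\<^sub>R w)) has_real_derivative D v) (at s)"
proof -
  have "((\<lambda>s. x + s *\<^sub>R v + t *\<^sub>R w) has_derivative (\<lambda>h. h *\<^sub>R v)) (at s)"
    by (auto intro!: derivative_eq_intros)
  from diff_chain_at[OF this assms] 
  have "((\<lambda>s. f (x + s *\<^sub>R v + t *\<^sub>R w)) has_derivative (\<lambda>h. D (h *\<^sub>R v))) (at s)"
    by (simp add: o_def)
  moreover have "D (h *\<^sub>R v) = D v * h" for h
    using has_derivative_linear[OF assms] by (simp add: linear_scale)
  ultimately show ?thesis by (simp add: has_field_derivative_def)
qed

text \<open>Schwarz: the second difference over a parallelogram of size \<open>h\<close> equals, by two
  applications of the mean value theorem, \<open>h\<^sup>2\<close> times a mixed derivative at a nearby point.\<close>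

lemma second_difference_mvt:
  fixes f :: "'a::euclidean_space \<Rightarrow> real"
  assumes "smooth_on f (ball x r)" "0 < h" "h * (norm v + norm w) < r"
  shows "\<exists>s t. 0 < s \<and> s < h \<and> 0 < t \<and> t < h \<and>
    f (x + h *\<^sub>R v + h *\<^sub>R w) - f (x + h *\<^sub>R v) - f (x + h *\<^sub>R w) + f x =
      h * h * frechet_derivative (\<lambda>y. frechet_derivative f (at y) v) (at (x + s *\<^sub>R v + t *\<^sub>R w)) w"
proof -
  have inb: "x + s *\<^sub>R v + t *\<^sub>R w \<in> ball x r" if "0 \<le> s" "s \<le> h" "0 \<le> t" "t \<le> h" for s t
  proof -
    have "norm (s *\<^sub>R v + t *\<^sub>R w) \<le> s * norm v + t * norm w"
      using norm_triangle_ineq[of "s *\<^sub>R v" "t *\<^sub>R w"] that by simp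
    also have "\<dots> \<le> h * norm v + h * norm w"
      using that by (intro add_mono mult_right_mono) auto
    finally have "norm (s *\<^sub>R v + t *\<^sub>R w) < r" using assms(3) by (simp add: algebra_simps)
    moreover have "dist x (x + s *\<^sub>R v + t *\<^sub>R w) = norm (s *\<^sub>R v + t *\<^sub>R w)"
      using norm_minus_cancel[of "s *\<^sub>R v + t *\<^sub>R w"] by (simp add: dist_norm add.assoc)
    ultimately show ?thesis by simp
  qed
  define Dv where "Dv = (\<lambda>y. frechet_derivative f (at y) v)"
  have Dv: "smooth_on Dv (ball x r)"
    unfolding Dv_def by (rule smooth_on_frechet_derivative[OF assms(1)])
  define g where "g s = f (x + s *\<^sub>R v + h *\<^sub>R w) - f (x + s *\<^sub>R v)" for s
  have g: "(g has_real_derivative Dv (x + s *\<^sub>R v + h *\<^sub>R w) - Dv (x + s *\<^sub>R v)) (at s)"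
    if "0 \<le> s" "s \<le> h" for s
    using has_real_derivative_along_line[of f _ x s v h w] has_real_derivative_along_line[of f _ x s v 0 w]
      smooth_on_has_derivative[OF assms(1)] inb[of s h] inb[of s 0] that \<open>0 < h\<close>
    unfolding g_def Dv_def by (auto intro!: DERIV_diff)
  obtain s where s: "0 < s" "s < h"
    and gs: "g h - g 0 = (h - 0) * (Dv (x + s *\<^sub>R v + h *\<^sub>R w) - Dv (x + s *\<^sub>R v))"
    using MVT2[OF \<open>0 < h\<close>, of g "\<lambda>s. Dv (x + s *\<^sub>R v + h *\<^sub>R w) - Dv (x + s *\<^sub>R v)"] g by auto
  have k: "((\<lambda>t. Dv (x + s *\<^sub>R v + t *\<^sub>R w)) has_real_derivative
      frechet_derivative Dv (at (x + s *\<^sub>R v + t *\<^sub>R w)) w) (at t)" if "0 \<le> t" "t \<le> h" for t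
    using has_real_derivative_along_line[of Dv _ x t w s v]
      smooth_on_has_derivative[OF Dv] inb[of s t] that s by (auto simp: algebra_simps)
  obtain t where t: "0 < t" "t < h"
    and "Dv (x + s *\<^sub>R v + h *\<^sub>R w) - Dv (x + s *\<^sub>R v + 0 *\<^sub>R w) =
      (h - 0) * frechet_derivative Dv (at (x + s *\<^sub>R v + t *\<^sub>R w)) w"
    using MVT2[OF \<open>0 < h\<close>, of "\<lambda>t. Dv (x + s *\<^sub>R v + t *\<^sub>R w)"
      "\<lambda>t. frechet_derivative Dv (at (x + s *\<^sub>R v + t *\<^sub>R w)) w"] k by blast
  then have "f (x + h *\<^sub>R v + h *\<^sub>R w) - f (x + h *\<^sub>R v) - f (x + h *\<^sub>R w) + f x =
      h * h * frechet_derivative Dv (at (x + s *\<^sub>R v + t *\<^sub>R w)) w"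
    using gs by (simp add: g_def)
  then show ?thesis using s t unfolding Dv_def by blast
qed

text \<open>The second difference does not change when \<open>v\<close> and \<open>w\<close> are
  swapped, so one mixed derivative at some point near \<open>x\<close> equals the other one at
  another such point. Both are continuous, and the parallelogram may be shrunk to
  \<open>x\<close>.\<close>

lemma second_derivative_symmetric:
  fixes f :: "'a::euclidean_space \<Rightarrow> real"
  assumes "smooth_on f S" "open S" "x \<in> S"
  shows "frechet_derivative (\<lambda>y. frechet_derivative f (at y) v) (at x) w =
    frechet_derivative (\<lambda>y. frechet_derivative f (at y) w) (at x) v"
proof -
  define D where "D v w = (\<lambda>z. frechet_derivative (\<lambda>y. frechet_derivative f (at y) v) (at z) w)" for v w
  obtain r where r: "r > 0" "ball x r \<subseteq> S"
    using assms open_contains_ball by blast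
  have f: "smooth_on f (ball x r)" using assms(1) r smooth_on_subset by blast
  have cont: "isCont (D v w) x" for v w
    using assms smooth_on_continuous_on[OF smooth_on_frechet_derivative[OF smooth_on_frechet_derivative[OF assms(1)]]]
    by (simp add: D_def continuous_on_eq_continuous_at)
  have le: "\<bar>D v w x - D w v x\<bar> \<le> e" if "e > 0" for e
  proof -
    have ex: "\<exists>d>0. \<forall>y. dist y x < d \<longrightarrow> dist (D v w y) (D v w x) < e / 2" for v w
      using cont[of v w] half_gt_zero[OF that] unfolding continuous_at_eps_delta by blast
    obtain d1 where d1: "d1 > 0" "\<And>y. dist y x < d1 \<Longrightarrow> dist (D v w y) (D v w x) < e / 2"
      using ex[of v w] by blast
    obtain d2 where d2: "d2 > 0" "\<And>y. dist y x < d2 \<Longrightarrow> dist (D w v y) (D w v x) < e / 2"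
      using ex[of w v] by blast
    define m where "m = min r (min d1 d2)"
    \<comment> \<open>The parallelogram of size \<open>h\<close> stays within distance
      \<open>m\<close> of \<open>x\<close>, where \<open>f\<close> is smooth and each mixed
      derivative varies by less than \<open>e / 2\<close>. The summand 1 keeps the denominator
      positive when \<open>v\<close> and \<open>w\<close> vanish.\<close>
    define h where "h = m / (norm v + norm w + 1)"
    have m: "m > 0" using r d1 d2 by (simp add: m_def)
    have n: "norm v + norm w + 1 > 0" by (simp add: add_nonneg_pos)
    have h: "h > 0" using m n by (simp add: h_def)
    have "h * (norm v + norm w) < h * (norm v + norm w + 1)" using h by (simp add: algebra_simps)
    then have hm: "h * (norm v + norm w) < m" using n by (simp add: h_def)
    have near: "dist (x + s *\<^sub>R a + t *\<^sub>R b) x < m"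
      if "0 < s" "s < h" "0 < t" "t < h" "norm a + norm b = norm v + norm w" for s t a b
    proof -
      have "norm (s *\<^sub>R a + t *\<^sub>R b) \<le> s * norm a + t * norm b"
        using norm_triangle_ineq[of "s *\<^sub>R a" "t *\<^sub>R b"] that by simp
      also have "\<dots> \<le> h * norm a + h * norm b"
        using that by (intro add_mono mult_right_mono) auto
      also have "\<dots> = h * (norm v + norm w)"
        unfolding that(5)[symmetric] by (rule distrib_left[symmetric])
      finally have "norm (s *\<^sub>R a + t *\<^sub>R b) < m" using hm by linarith
      moreover have "dist (x + s *\<^sub>R a + t *\<^sub>R b) x = norm (s *\<^sub>R a + t *\<^sub>R b)"
        by (simp add: dist_norm add.assoc)
      ultimately show ?thesis by simp
    qed
    obtain s t where st: "0 < s" "s < h" "0 < t" "t < h"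
      "f (x + h *\<^sub>R v + h *\<^sub>R w) - f (x + h *\<^sub>R v) - f (x + h *\<^sub>R w) + f x = h * h * D v w (x + s *\<^sub>R v + t *\<^sub>R w)"
      using second_difference_mvt[OF f h, of v w] hm unfolding D_def m_def min_less_iff_conj by blast
    obtain s' t' where st': "0 < s'" "s' < h" "0 < t'" "t' < h"
      "f (x + h *\<^sub>R w + h *\<^sub>R v) - f (x + h *\<^sub>R w) - f (x + h *\<^sub>R v) + f x = h * h * D w v (x + s' *\<^sub>R w + t' *\<^sub>R v)"
      using second_difference_mvt[OF f h, of w v] hm add.commute[of "norm w" "norm v"]
      unfolding D_def m_def min_less_iff_conj by metis
    have "h * h * D v w (x + s *\<^sub>R v + t *\<^sub>R w) = h * h * D w v (x + s' *\<^sub>R w + t' *\<^sub>R v)"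
      unfolding st(5)[symmetric] st'(5)[symmetric] by (simp add: add.commute add.left_commute)
    then have "D v w (x + s *\<^sub>R v + t *\<^sub>R w) = D w v (x + s' *\<^sub>R w + t' *\<^sub>R v)"
      using h by simp
    moreover have "dist (D v w (x + s *\<^sub>R v + t *\<^sub>R w)) (D v w x) < e / 2"
      using near[OF st(1-4) refl] by (intro d1(2)) (simp add: m_def)
    moreover have "dist (D w v (x + s' *\<^sub>R w + t' *\<^sub>R v)) (D w v x) < e / 2"
      using near[OF st'(1-4) add.commute] by (intro d2(2)) (simp add: m_def)
    ultimately show ?thesis by (simp add: dist_real_def abs_real_def split: if_splits)
  qed
  have "\<bar>D v w x - D w v x\<bar> \<le> 0"
    by (rule field_le_epsilon) (use le in auto)
  then show ?thesis by (simp add: D_def)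
qed

section \<open>Surfaces as graphs\<close>

text \<open>Adapted axes for a graph: \<open>w1\<close> and \<open>w2\<close> carry the parameters,
  \<open>e\<close> is the direction of the height. The last clause is the expansion of a vector in
  the form in which it is used.\<close>

definition orthonormal_triple :: "real^3 \<Rightarrow> real^3 \<Rightarrow> real^3 \<Rightarrow> bool" where
  "orthonormal_triple w1 w2 e \<longleftrightarrow>
     w1 \<bullet> w1 = 1 \<and> w2 \<bullet> w2 = 1 \<and> e \<bullet> e = 1 \<and> w1 \<bullet> w2 = 0 \<and> w1 \<bullet> e = 0 \<and> w2 \<bullet> e = 0 \<and>
     (\<forall>q. (q \<bullet> w1) *\<^sub>R w1 + (q \<bullet> w2) *\<^sub>R w2 + (q \<bullet> e) *\<^sub>R e = q)"

lemma local_defining_function_has_derivative: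
  assumes "local_defining_function S p U u" "q \<in> U"
  shows "(u has_derivative frechet_derivative u (at q)) (at q)"
  using assms smooth_on_has_derivative unfolding local_defining_function_def by blast

lemma local_defining_function_linear:
  assumes "local_defining_function S p U u" "q \<in> U"
  shows "linear (frechet_derivative u (at q))"
  using local_defining_function_has_derivative[OF assms] has_derivative_linear by blast

lemma local_defining_function_move:
  assumes "local_defining_function S p U u" "q \<in> U"
  shows "local_defining_function S q U u"
  using assms unfolding local_defining_function_def by blast

text \<open>The inverse function theorem is applied to the map \<open>F\<close> with coordinates
  \<open>w1\<close>, \<open>w2\<close> and \<open>u\<close>; the local inverse, restricted to the
  plane \<open>u = 0\<close>, is the chart. This gives a differentiable chart, and smoothness is
  then bootstrapped from an equation expressing the derivative of \<phi> through \<phi>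
  itself.\<close>

lemma local_graph:
  assumes tri: "orthonormal_triple w1 w2 e"
    and u: "local_defining_function S p U u" "p \<in> S"
    and e: "frechet_derivative u (at p) e \<noteq> 0"
  obtains V \<phi> where "local_parametrization S V \<phi>" "0 \<in> V" "\<phi> 0 = p" "\<phi> ` V \<subseteq> S \<inter> U"
    "\<And>v. v \<in> V \<Longrightarrow> (\<phi> v - p) \<bullet> w1 = v$1" "\<And>v. v \<in> V \<Longrightarrow> (\<phi> v - p) \<bullet> w2 = v$2"
    "\<And>v k. v \<in> V \<Longrightarrow> frechet_derivative \<phi> (at v) k \<bullet> w1 = k$1"
    "\<And>v k. v \<in> V \<Longrightarrow> frechet_derivative \<phi> (at v) k \<bullet> w2 = k$2"
    "\<And>v k. v \<in> V \<Longrightarrow> frechet_derivative u (at (\<phi> v)) (frechet_derivative \<phi> (at v) k) = 0"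
    "\<And>v. v \<in> V \<Longrightarrow> frechet_derivative u (at (\<phi> v)) e \<noteq> 0"
proof -
  have on: "w1 \<bullet> w1 = 1" "w2 \<bullet> w2 = 1" "e \<bullet> e = 1" "w1 \<bullet> w2 = 0" "w1 \<bullet> e = 0" "w2 \<bullet> e = 0"
    "w2 \<bullet> w1 = 0" "e \<bullet> w1 = 0" "e \<bullet> w2 = 0"
    and rep: "(q \<bullet> w1) *\<^sub>R w1 + (q \<bullet> w2) *\<^sub>R w2 + (q \<bullet> e) *\<^sub>R e = q" for q
    using tri unfolding orthonormal_triple_def inner_commute[of w2 w1] inner_commute[of e w1]
      inner_commute[of e w2] by blast+
  have U: "open U" "p \<in> U" and smooth: "smooth_on u U" and SU: "S \<inter> U = {q \<in> U. u q = 0}"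
    using u unfolding local_defining_function_def by auto
  define du where "du q = frechet_derivative u (at q)" for q
  have du: "(u has_derivative du q) (at q)" and lin: "linear (du q)" if "q \<in> U" for q
    using local_defining_function_has_derivative[OF u(1) that]
      local_defining_function_linear[OF u(1) that] by (auto simp: du_def)
  define F where "F q = ((q - p) \<bullet> w1) *\<^sub>R w1 + ((q - p) \<bullet> w2) *\<^sub>R w2 + u q *\<^sub>R e" for q
  define DF where "DF q h = (h \<bullet> w1) *\<^sub>R w1 + (h \<bullet> w2) *\<^sub>R w2 + du q h *\<^sub>R e" for q h
  have F: "(F has_derivative DF q) (at q)" if "q \<in> U" for q
    unfolding F_def DF_def by (auto intro!: derivative_eq_intros du[OF that])
  have DF_inner: "DF q h \<bullet> w1 = h \<bullet> w1" "DF q h \<bullet> w2 = h \<bullet> w2" "DF q h \<bullet> e = du q h" for q h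
    unfolding DF_def using on by (simp_all add: inner_add_left)
  have F_inner: "F q \<bullet> w1 = (q - p) \<bullet> w1" "F q \<bullet> w2 = (q - p) \<bullet> w2" "F q \<bullet> e = u q" for q
    unfolding F_def using on by (simp_all add: inner_add_left)
  define \<iota> :: "real^2 \<Rightarrow> real^3" where "\<iota> v = v$1 *\<^sub>R w1 + v$2 *\<^sub>R w2" for v
  have \<iota>: "(\<iota> has_derivative \<iota>) (at v)" "continuous_on A \<iota>" for v A
    unfolding \<iota>_def
    by (auto intro!: derivative_eq_intros continuous_intros
        bounded_linear.has_derivative[OF bounded_linear_vec_nth has_derivative_ident])
  have \<iota>_inner: "\<iota> v \<bullet> w1 = v$1" "\<iota> v \<bullet> w2 = v$2" "\<iota> v \<bullet> e = 0" for v
    unfolding \<iota>_def using on by (simp_all add: inner_add_left)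
  define \<psi> :: "real^3 \<Rightarrow> real^2" where
    "\<psi> q = (\<chi> i. if i = 1 then (q - p) \<bullet> w1 else (q - p) \<bullet> w2)" for q
  have \<psi>_comp: "\<psi> q $ 1 = (q - p) \<bullet> w1" "\<psi> q $ 2 = (q - p) \<bullet> w2" for q
    by (simp_all add: \<psi>_def)
  have cont_\<psi>: "continuous_on A \<psi>" for A
  proof -
    have "continuous_on A (\<lambda>q. if i = 1 then (q - p) \<bullet> w1 else (q - p) \<bullet> w2)" for i :: 2
      by (cases "i = 1") (auto intro!: continuous_intros)
    then show ?thesis unfolding \<psi>_def by (intro continuous_on_vec_lambda)
  qed
  have DF_bl: "bounded_linear (DF q)" if "q \<in> U" for q
    using F[OF that] has_derivative_bounded_linear by blast
  have cont_DF: "continuous_on U (\<lambda>q. Blinfun (DF q))"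
  proof (rule continuous_on_blinfun_componentwise)
    fix i :: "real^3"
    have "continuous_on U (\<lambda>q. du q i)"
      using smooth_on_continuous_on[OF smooth_on_frechet_derivative[OF smooth]] by (simp add: du_def)
    then have "continuous_on U (\<lambda>q. DF q i)"
      unfolding DF_def by (intro continuous_intros)
    then show "continuous_on U (\<lambda>q. blinfun_apply (Blinfun (DF q)) i)"
      by (rule continuous_on_cong[THEN iffD1, rotated 2, of U _ U, OF _ refl])
        (simp add: bounded_linear_Blinfun_apply[OF DF_bl])
  qed
  have eU: "du p e \<noteq> 0" using e by (simp add: du_def)
  have "inj (DF p)"
  proof (rule linear_injective_0[THEN iffD2])
    show "linear (DF p)" using DF_bl[OF U(2)] bounded_linear.linear by blast
    show "\<forall>h. DF p h = 0 \<longrightarrow> h = 0"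
    proof (intro allI impI)
      fix h assume "DF p h = 0"
      then have h: "h \<bullet> w1 = 0" "h \<bullet> w2 = 0" "du p h = 0"
        using DF_inner[of p h] by auto
      then have h': "h = (h \<bullet> e) *\<^sub>R e" using rep[of h] by simp
      then have "du p h = (h \<bullet> e) * du p e"
        using linear_scale[OF lin[OF U(2)]] by (metis real_scaleR_def)
      then show "h = 0" using h h' eU by auto
    qed
  qed
  then obtain I where I: "linear I" "I \<circ> DF p = id"
    using linear_injective_left_inverse DF_bl[OF U(2)] bounded_linear.linear by blast
  have inv: "Blinfun I o\<^sub>L Blinfun (DF p) = id_blinfun"
    using I DF_bl[OF U(2)]
    by (intro blinfun_eqI) (simp add: bounded_linear_Blinfun_apply linear_linear pointfree_idE)
  obtain U' V' g g' where U': "open U'" "U' \<subseteq> U" "p \<in> U'" "open V'" "F p \<in> V'"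
    and hom: "homeomorphism U' V' F g"
    and g: "\<And>y. y \<in> V' \<Longrightarrow> (g has_derivative (g' y)) (at y)"
    and g': "\<And>y. y \<in> V' \<Longrightarrow> g' y = Hilbert_Choice.inv (blinfun_apply (Blinfun (DF (g y))))"
    and bij: "\<And>y. y \<in> V' \<Longrightarrow> bij (blinfun_apply (Blinfun (DF (g y))))"
    by (rule inverse_function_theorem[of U F "\<lambda>q. Blinfun (DF q)" p "Blinfun I"])
      (use U F DF_bl cont_DF inv in \<open>auto simp: bounded_linear_Blinfun_apply\<close>)
  have gU: "g y \<in> U'" "F (g y) = y" if "y \<in> V'" for y
    using hom that unfolding homeomorphism_def by auto
  have gF: "F q \<in> V'" "g (F q) = q" if "q \<in> U'" for q
    using hom that unfolding homeomorphism_def by auto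
  have g'_inner: "g' y k \<bullet> w1 = k \<bullet> w1" "g' y k \<bullet> w2 = k \<bullet> w2" "du (g y) (g' y k) = k \<bullet> e"
    if y: "y \<in> V'" for y k
  proof -
    have "blinfun_apply (Blinfun (DF (g y))) = DF (g y)"
      using gU(1)[OF y] U'(2) DF_bl bounded_linear_Blinfun_apply by blast
    then have "DF (g y) (g' y k) = k"
      using g'[OF y] bij[OF y] by (simp add: bij_is_surj surj_f_inv_f)
    then show "g' y k \<bullet> w1 = k \<bullet> w1" "g' y k \<bullet> w2 = k \<bullet> w2" "du (g y) (g' y k) = k \<bullet> e"
      using DF_inner[of "g y" "g' y k"] by auto
  qed
  define V where "V = \<iota> -` V'"
  define \<phi> where "\<phi> v = g (\<iota> v)" for v
  have V: "open V" unfolding V_def using U'(4) \<iota>(2) by (simp add: open_vimage)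
  have \<phi>U: "\<phi> v \<in> U'" "F (\<phi> v) = \<iota> v" if "v \<in> V" for v
    using gU that by (auto simp: V_def \<phi>_def)
  have D\<phi>: "(\<phi> has_derivative (\<lambda>k. g' (\<iota> v) (\<iota> k))) (at v)" if "v \<in> V" for v
    using diff_chain_at[OF \<iota>(1) g, of v] that by (simp add: V_def \<phi>_def[abs_def] o_def)
  have D\<phi>_eq: "frechet_derivative \<phi> (at v) k = g' (\<iota> v) (\<iota> k)" if "v \<in> V" for v k
    using frechet_derivative_at[OF D\<phi>[OF that]] by metis
  have D\<phi>_inner: "frechet_derivative \<phi> (at v) k \<bullet> w1 = k$1"
    "frechet_derivative \<phi> (at v) k \<bullet> w2 = k$2"
    "du (\<phi> v) (frechet_derivative \<phi> (at v) k) = 0" if "v \<in> V" for v k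
    using g'_inner[of "\<iota> v" "\<iota> k"] that by (auto simp: V_def D\<phi>_eq \<iota>_inner \<phi>_def)
  have ene: "du (\<phi> v) e \<noteq> 0" if "v \<in> V" for v
  proof
    assume "du (\<phi> v) e = 0"
    then have "DF (\<phi> v) e = DF (\<phi> v) 0"
      using on linear_0[OF lin[of "\<phi> v"]] \<phi>U(1)[OF that] U'(2) by (auto simp: DF_def)
    moreover have "inj (DF (\<phi> v))"
      using bij[of "\<iota> v"] that \<phi>U(1)[OF that] U'(2) bounded_linear_Blinfun_apply[OF DF_bl[of "\<phi> v"]]
      by (auto simp: V_def \<phi>_def bij_is_inj subset_iff)
    ultimately have "e = 0" by (simp add: inj_eq)
    then show False using on(3) by simp
  qed
  have coords: "(\<phi> v - p) \<bullet> w1 = v$1" "(\<phi> v - p) \<bullet> w2 = v$2" "u (\<phi> v) = 0" if "v \<in> V" for v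
    using F_inner[of "\<phi> v"] \<phi>U(2)[OF that] \<iota>_inner[of v] by auto
  then have \<psi>\<phi>: "\<psi> (\<phi> v) = v" if "v \<in> V" for v
    using that by (simp add: vec_eq_iff forall_2 \<psi>_comp)
  have F\<psi>: "F q = \<iota> (\<psi> q)" if "u q = 0" for q
    using that by (simp add: F_def \<iota>_def \<psi>_comp)
  have image: "\<phi> ` V = S \<inter> U'"
  proof (intro equalityI subsetI)
    fix q assume "q \<in> \<phi> ` V"
    then show "q \<in> S \<inter> U'" using \<phi>U(1) coords(3) SU U'(2) by blast
  next
    fix q assume q: "q \<in> S \<inter> U'"
    then have "u q = 0" using SU U'(2) by blast
    then have "\<psi> q \<in> V" "\<phi> (\<psi> q) = q"
      using gF[of q] q by (auto simp: V_def \<phi>_def F\<psi>[symmetric])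
    then show "q \<in> \<phi> ` V" by (metis imageI)
  qed
  have "\<phi> differentiable at v" if "v \<in> V" for v
    using D\<phi>[OF that] differentiable_def by blast
  then have cont_\<phi>: "continuous_on V \<phi>"
    by (simp add: continuous_at_imp_continuous_on differentiable_imp_continuous_within)
  define U1 where "U1 = {q \<in> U. du q e \<noteq> 0}"
  have sdu: "smooth_on (\<lambda>q. du q k) U" for k
    unfolding du_def by (rule smooth_on_frechet_derivative[OF smooth])
  have U1: "open U1"
    unfolding U1_def
    using continuous_open_preimage[OF smooth_on_continuous_on[OF sdu[of e]] U(1), of "- {0}"]
    by (simp add: vimage_def Int_def open_Compl)
  \<comment> \<open>\<open>R k q\<close> is the vector with horizontal part \<open>\<iota> k\<close>
    whose \<open>e\<close>-component is solved from \<open>du q h = 0\<close>. It depends smoothly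
    on \<open>q\<close> in \<open>U1\<close>, where the denominator does not vanish.\<close>
  define R where "R k q = \<iota> k + (- du q (\<iota> k) * inverse (du q e)) *\<^sub>R e" for k q
  have R: "smooth_on (R k) U1" for k
    unfolding R_def
  proof (intro smooth_on_add smooth_on_scaleR smooth_on_mult smooth_on_const U1)
    have "smooth_on (\<lambda>q. -1 * du q (\<iota> k)) U1"
      by (intro smooth_on_cmult U1 smooth_on_subset[OF sdu]) (auto simp: U1_def)
    then show "smooth_on (\<lambda>q. - du q (\<iota> k)) U1" by simp
    show "smooth_on (\<lambda>q. inverse (du q e)) U1"
    proof (rule smooth_on_compose[OF U1, of "- {0}" "\<lambda>q. du q e" inverse])
      show "smooth_on (\<lambda>q. du q e) U1" by (rule smooth_on_subset[OF sdu]) (auto simp: U1_def)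
      show "smooth_on inverse (- {0::real})" by (simp add: smooth_on_def Ck_on_inverse)
    qed (auto simp: U1_def)
  qed
  have \<phi>U1: "\<phi> ` V \<subseteq> U1" using \<phi>U(1) U'(2) ene by (auto simp: U1_def)
  have D\<phi>_R: "frechet_derivative \<phi> (at v) k = R k (\<phi> v)" if "v \<in> V" for v k
  proof -
    let ?h = "frechet_derivative \<phi> (at v) k"
    have h: "?h = \<iota> k + (?h \<bullet> e) *\<^sub>R e"
      using rep[of ?h] D\<phi>_inner[OF that, of k] by (simp add: \<iota>_def)
    have l: "linear (du (\<phi> v))" using lin \<phi>U(1)[OF that] U'(2) by blast
    have "0 = du (\<phi> v) (\<iota> k + (?h \<bullet> e) *\<^sub>R e)"
      using D\<phi>_inner(3)[OF that, of k] h by simp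
    also have "\<dots> = du (\<phi> v) (\<iota> k) + (?h \<bullet> e) * du (\<phi> v) e"
      using linear_add[OF l] linear_scale[OF l] by simp
    finally have "?h \<bullet> e = - du (\<phi> v) (\<iota> k) * inverse (du (\<phi> v) e)"
      using ene[OF that] by (simp add: field_simps)
    then show ?thesis using h by (simp add: R_def)
  qed
  \<comment> \<open>The bootstrap: by \<open>D\<phi>_R\<close> a directional derivative of \<phi> is
    \<open>R h\<close> composed with \<phi>, so it inherits every class already reached by \<phi>,
    which raises the class of \<phi> by one. Continuity starts the induction.\<close>
  have "Ck_on k \<phi> V" for k
  proof (induction k)
    case (Suc k)
    show ?case
    proof (rule Ck_on_SucI[OF V])
      show "(\<phi> has_derivative (\<lambda>h. R h (\<phi> v))) (at v)" if "v \<in> V" for v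
        using D\<phi>[OF that] D\<phi>_R[OF that] D\<phi>_eq[OF that] by simp
      show "Ck_on k (\<lambda>v. R h (\<phi> v)) V" for h
        by (rule Ck_on_compose[OF V U1 \<phi>U1 _ Suc]) (use R in \<open>auto simp: smooth_on_def\<close>)
    qed
  qed (simp add: cont_\<phi>)
  then have sm: "smooth_on \<phi> V" by (simp add: smooth_on_def)
  have "local_parametrization S V \<phi>"
    unfolding local_parametrization_def
  proof (intro conjI ballI exI[of _ \<psi>])
    show "inj (frechet_derivative \<phi> (at v))" if "v \<in> V" for v
    proof (rule injI)
      fix x y assume eq: "frechet_derivative \<phi> (at v) x = frechet_derivative \<phi> (at v) y"
      have "x$1 = y$1" "x$2 = y$2"
        using D\<phi>_inner(1,2)[OF that, of x] D\<phi>_inner(1,2)[OF that, of y] unfolding eq by simp_all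
      then show "x = y" by (simp add: vec_eq_iff forall_2)
    qed
    show "openin (top_of_set S) (\<phi> ` V)"
      unfolding image using U'(1) by (rule openin_open_Int)
    show "homeomorphism V (\<phi> ` V) \<phi> \<psi>"
      unfolding homeomorphism_def using \<psi>\<phi> cont_\<phi> cont_\<psi> by (auto simp: image_image)
  qed (use V sm in auto)
  moreover have "F p = 0" using SU u(2) U(2) by (auto simp: F_def)
  then have "0 \<in> V" "\<phi> 0 = p"
    using U'(5) gF(2)[OF U'(3)] by (auto simp: V_def \<phi>_def \<iota>_def)
  moreover have "\<phi> ` V \<subseteq> S \<inter> U" using image U'(2) by blast
  ultimately show ?thesis
    using that coords(1,2) D\<phi>_inner ene unfolding du_def by blast
qed

text \<open>The first two vectors are the projections of \<open>N\<close> and \<open>T\<close> to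
  the xy-plane, so the parameters of the resulting chart are coordinates in these directions. The
  vertical axis is transversal to the surface at a characteristic point.\<close>

lemma orthonormal_triple_rotated:
  assumes "a\<^sup>2 + b\<^sup>2 = 1"
  shows "orthonormal_triple (vector [a, b, 0]) (vector [- b, a, 0]) (axis 3 1)"
proof -
  have ab: "a * a + b * b = 1" using assms by (simp add: power2_eq_square)
  have "(q$1 * a + q$2 * b) * a + (q$2 * a - q$1 * b) * (- b) = q$1"
    "(q$1 * a + q$2 * b) * b + (q$2 * a - q$1 * b) * a = q$2" for q :: "real^3"
    using ab by algebra+
  then show ?thesis using ab
    by (simp add: orthonormal_triple_def inner_vec_def sum_3 vector_3 axis_def vec_eq_iff forall_3 algebra_simps)
qed

lemma orthonormal_triple_axes:
  "orthonormal_triple (axis 1 1) (axis 2 1) (axis 3 1)"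
  "orthonormal_triple (axis 3 1) (axis 1 1) (axis 2 1)"
  "orthonormal_triple (axis 2 1) (axis 3 1) (axis 1 1)"
  by (simp_all add: orthonormal_triple_def inner_vec_def sum_3 vector_3 axis_def vec_eq_iff forall_3)

text \<open>A non-zero differential is non-zero on some coordinate axis, and a cyclic permutation of
  the axes moves this one into the third place.\<close>

lemma transversal_triple_exists:
  assumes "local_defining_function S p U u" "p \<in> S"
  obtains w1 w2 e where "orthonormal_triple w1 w2 e" "frechet_derivative u (at p) e \<noteq> 0"
proof -
  let ?D = "frechet_derivative u (at p)"
  have p: "p \<in> U" and D: "?D \<noteq> (\<lambda>_. 0)" using assms unfolding local_defining_function_def by auto
  have lin: "linear ?D" using local_defining_function_linear[OF assms(1) p] .
  have "\<exists>i. ?D (axis i 1) \<noteq> 0"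
  proof (rule ccontr)
    assume "\<nexists>i. ?D (axis i 1) \<noteq> 0"
    then have "?D b = 0" if "b \<in> Basis" for b using that by (auto simp: Basis_vec_def)
    then have "?D h = 0" for h using linear_eq_sum_Basis[OF lin, of h] by simp
    then show False using D by auto
  qed
  then obtain i where i: "?D (axis i 1) \<noteq> 0" by blast
  have "i = 1 \<or> i = 2 \<or> i = 3" by (rule exhaust_3)
  then show ?thesis using i orthonormal_triple_axes that by metis
qed

section \<open>Tangent vectors and the comparison of defining functions\<close>

lemma kernel_eq_graph_derivative:
  fixes L :: "real^3 \<Rightarrow> real"
  assumes "orthonormal_triple w1 w2 e" "linear L" "L e \<noteq> 0"
    and "L h = 0" "L h' = 0" "h \<bullet> w1 = h' \<bullet> w1" "h \<bullet> w2 = h' \<bullet> w2"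
  shows "h = h'"
proof -
  let ?d = "h - h'"
  have "?d = (?d \<bullet> e) *\<^sub>R e"
  proof -
    have "(?d \<bullet> w1) *\<^sub>R w1 + (?d \<bullet> w2) *\<^sub>R w2 + (?d \<bullet> e) *\<^sub>R e = ?d"
      using assms(1) unfolding orthonormal_triple_def by blast
    then show ?thesis using assms(6,7) by (simp add: inner_diff_left)
  qed
  then have "L ?d = (?d \<bullet> e) * L e" using linear_scale[OF assms(2)] by (metis real_scaleR_def)
  then have "?d \<bullet> e = 0" using assms(3-5) linear_diff[OF assms(2)] by simp
  then show ?thesis using \<open>?d = (?d \<bullet> e) *\<^sub>R e\<close> by simp
qed

text \<open>A tangent vector is the image of a parameter vector under the derivative of a graph
  chart \<phi>, and \<open>E \<circ> \<phi>\<close> vanishes near 0. This is how identities that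
  hold only on \<open>S\<close> are differentiated.\<close>

lemma derivative_zero_on_tangent_plane:
  fixes E :: "real^3 \<Rightarrow> real"
  assumes u: "local_defining_function S p U u" "p \<in> S"
    and E: "(E has_derivative E') (at p)"
    and W: "open W" "p \<in> W" "\<And>q. q \<in> S \<inter> W \<Longrightarrow> E q = 0"
    and h: "frechet_derivative u (at p) h = 0"
  shows "E' h = 0"
proof -
  obtain w1 w2 e where tri: "orthonormal_triple w1 w2 e" and e: "frechet_derivative u (at p) e \<noteq> 0"
    using transversal_triple_exists[OF u] .
  obtain V \<phi> where \<phi>: "local_parametrization S V \<phi>" "0 \<in> V" "\<phi> 0 = p" "\<phi> ` V \<subseteq> S \<inter> U"
    and D: "\<And>v k. v \<in> V \<Longrightarrow> frechet_derivative \<phi> (at v) k \<bullet> w1 = k$1"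
    "\<And>v k. v \<in> V \<Longrightarrow> frechet_derivative \<phi> (at v) k \<bullet> w2 = k$2"
    "\<And>v k. v \<in> V \<Longrightarrow> frechet_derivative u (at (\<phi> v)) (frechet_derivative \<phi> (at v) k) = 0"
    using local_graph[OF tri u e] by metis
  define k :: "real^2" where "k = vector [h \<bullet> w1, h \<bullet> w2]"
  define D\<phi> where "D\<phi> = frechet_derivative \<phi> (at 0)"
  have "open V" and sm: "smooth_on \<phi> V" using \<phi>(1) unfolding local_parametrization_def by auto
  have D\<phi>: "(\<phi> has_derivative D\<phi>) (at 0)"
    unfolding D\<phi>_def using smooth_on_has_derivative[OF sm \<phi>(2)] .
  have p: "p \<in> U" using u unfolding local_defining_function_def by auto
  have hk: "h = D\<phi> k"
    using D[OF \<phi>(2), of k] h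
    by (intro kernel_eq_graph_derivative[OF tri local_defining_function_linear[OF u(1) p] e])
      (auto simp: D\<phi>_def \<phi>(3) k_def vector_2)
  have "open (V \<inter> \<phi> -` W)"
    using continuous_open_preimage[OF smooth_on_continuous_on[OF sm] \<open>open V\<close> W(1)] .
  then have "((\<lambda>_. 0) has_derivative E' \<circ> D\<phi>) (at 0)"
  proof (rule has_derivative_transform_within_open[rotated])
    show "(E \<circ> \<phi> has_derivative E' \<circ> D\<phi>) (at 0)"
      using diff_chain_at[OF D\<phi>] E \<phi>(3) by simp
    show "0 \<in> V \<inter> \<phi> -` W" using \<phi>(2,3) W(2) by simp
    show "(E \<circ> \<phi>) v = 0" if "v \<in> V \<inter> \<phi> -` W" for v
      using that W(3) \<phi>(4) by auto
  qed
  then have "E' \<circ> D\<phi> = (\<lambda>_. 0)"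
    by (rule has_derivative_unique[OF _ has_derivative_const])
  then show ?thesis using hk by (metis comp_apply)
qed

text \<open>By the preceding lemma the differential of \<open>v\<close> vanishes on the kernel of
  the differential of \<open>u\<close>, and linear forms in this relation are proportional. The
  factor is obtained at the single point \<open>p\<close>, not as a function.\<close>

lemma local_defining_function_proportional:
  assumes u: "local_defining_function S p U u" and v: "local_defining_function S p U' v" and p: "p \<in> S"
  obtains c where "c \<noteq> 0" "\<And>h. frechet_derivative v (at p) h = c * frechet_derivative u (at p) h"
proof -
  let ?Du = "frechet_derivative u (at p)" and ?Dv = "frechet_derivative v (at p)"
  have U: "p \<in> U" "p \<in> U'" "open U'" using u v unfolding local_defining_function_def by auto
  note Dv = local_defining_function_has_derivative[OF v U(2)]
  have v0: "v q = 0" if "q \<in> S \<inter> U'" for q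
    using v that unfolding local_defining_function_def by blast
  have ker: "?Dv h = 0" if "?Du h = 0" for h
    using derivative_zero_on_tangent_plane[OF u p Dv U(3,2) v0 that] .
  obtain w1 w2 e where e: "?Du e \<noteq> 0"
    using transversal_triple_exists[OF u p] by blast
  have eq: "?Dv h = ?Dv e / ?Du e * ?Du h" for h
  proof -
    have l: "linear ?Du" "linear ?Dv"
      using local_defining_function_linear u v U by blast+
    have "?Du (h - (?Du h / ?Du e) *\<^sub>R e) = 0"
      using e by (simp add: linear_diff[OF l(1)] linear_scale[OF l(1)])
    then have "?Dv (h - (?Du h / ?Du e) *\<^sub>R e) = 0" by (rule ker)
    then show ?thesis by (simp add: linear_diff[OF l(2)] linear_scale[OF l(2)])
  qed
  have "?Dv \<noteq> (\<lambda>_. 0)" using v p U unfolding local_defining_function_def by blast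
  then have "?Dv e / ?Du e \<noteq> 0"
    using eq by (metis mult_zero_left)
  then show ?thesis using that eq by blast
qed

lemma tangent_plane_eq:
  assumes u: "local_defining_function S p U u" and p: "p \<in> S"
  shows "tangent_plane S p = {h. frechet_derivative u (at p) h = 0}"
proof (intro equalityI subsetI)
  fix h assume "h \<in> tangent_plane S p"
  then obtain U' u' where u': "local_defining_function S p U' u'"
    and h: "frechet_derivative u' (at p) h = 0"
    unfolding tangent_plane_def by blast
  obtain c where "c \<noteq> 0" "\<And>h. frechet_derivative u (at p) h = c * frechet_derivative u' (at p) h"
    using local_defining_function_proportional[OF u' u p] by blast
  then show "h \<in> {h. frechet_derivative u (at p) h = 0}" using h by simp
qed (use u in \<open>auto simp: tangent_plane_def\<close>)

lemma characteristic_set_iff: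
  assumes u: "local_defining_function S p U u" and p: "p \<in> S"
  shows "p \<in> characteristic_set S \<longleftrightarrow> lie_deriv X_field u p = 0 \<and> lie_deriv Y_field u p = 0"
proof -
  have U: "p \<in> U" using u unfolding local_defining_function_def by auto
  note l = local_defining_function_linear[OF u U]
  show ?thesis
  proof
    assume "p \<in> characteristic_set S"
    then have "distribution p \<subseteq> {h. frechet_derivative u (at p) h = 0}"
      by (simp add: characteristic_set_def tangent_plane_eq[OF u p])
    moreover have "X_field p \<in> distribution p" "Y_field p \<in> distribution p"
      by (simp_all add: distribution_def X_field_def Y_field_def vector_3)
    ultimately show "lie_deriv X_field u p = 0 \<and> lie_deriv Y_field u p = 0"
      unfolding lie_deriv_def by blast
  next
    assume "lie_deriv X_field u p = 0 \<and> lie_deriv Y_field u p = 0"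
    then show "p \<in> characteristic_set S"
      using p unfolding distribution_eq lie_deriv_def characteristic_set_def mem_Collect_eq
        tangent_plane_eq[OF u p] by (auto simp: linear_add[OF l] linear_scale[OF l])
  qed
qed

section \<open>The horizontal mean curvature\<close>

lemma X_field_nth: "X_field p $ 1 = 1" "X_field p $ 2 = 0" "X_field p $ 3 = - (p$2) / 2"
  and Y_field_nth: "Y_field p $ 1 = 0" "Y_field p $ 2 = 1" "Y_field p $ 3 = p$1 / 2"
  by (simp_all add: X_field_def Y_field_def vector_3)

lemma X_field_eq: "X_field p = axis 1 1 - (p$2 / 2) *\<^sub>R axis 3 1"
  and Y_field_eq: "Y_field p = axis 2 1 + (p$1 / 2) *\<^sub>R axis 3 1"
  by (simp_all add: vec_eq_iff forall_3 X_field_nth Y_field_nth axis_def)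

lemma has_derivative_vec_nth: "((\<lambda>q. q $ i) has_derivative (\<lambda>k. k $ i)) F"
  by (rule bounded_linear_imp_has_derivative[OF bounded_linear_vec_nth])

lemma X_field_has_derivative: "(X_field has_derivative (\<lambda>k. - (k$2 / 2) *\<^sub>R axis 3 1)) (at p)"
  and Y_field_has_derivative: "(Y_field has_derivative (\<lambda>k. (k$1 / 2) *\<^sub>R axis 3 1)) (at p)"
  unfolding X_field_eq[abs_def] Y_field_eq[abs_def]
  by (auto intro!: derivative_eq_intros has_derivative_vec_nth)

lemma smooth_on_X_field: "open U \<Longrightarrow> smooth_on X_field U"
  and smooth_on_Y_field: "open U \<Longrightarrow> smooth_on Y_field U"
proof -
  assume U: "open U"
  have l: "bounded_linear (\<lambda>p::real^3. - (p$2 / 2) *\<^sub>R axis 3 1 :: real^3)"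
    "bounded_linear (\<lambda>p::real^3. (p$1 / 2) *\<^sub>R axis 3 1 :: real^3)"
    using X_field_has_derivative Y_field_has_derivative has_derivative_bounded_linear by blast+
  show "smooth_on X_field U"
    by (rule smooth_on_cong[OF U _ smooth_on_add[OF U smooth_on_const smooth_on_bounded_linear[OF U l(1)]]])
      (simp add: X_field_eq)
  show "smooth_on Y_field U"
    by (rule smooth_on_cong[OF U _ smooth_on_add[OF U smooth_on_const smooth_on_bounded_linear[OF U l(2)]]])
      (simp add: Y_field_eq)
qed

lemma smooth_on_derivative_along:
  fixes u :: "'a::euclidean_space \<Rightarrow> real"
  assumes "open U" "smooth_on u U" "smooth_on V U"
  shows "smooth_on (\<lambda>q. frechet_derivative u (at q) (V q)) U"
proof (rule smooth_on_cong[OF assms(1)])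
  show "(\<Sum>b\<in>Basis. (V q \<bullet> b) * frechet_derivative u (at q) b) = frechet_derivative u (at q) (V q)"
    if "q \<in> U" for q
    using linear_eq_sum_Basis[OF has_derivative_linear[OF smooth_on_has_derivative[OF assms(2) that]], of "V q"]
    by simp
  show "smooth_on (\<lambda>q. \<Sum>b\<in>Basis. (V q \<bullet> b) * frechet_derivative u (at q) b) U"
  proof (intro smooth_on_sum smooth_on_mult assms(1) smooth_on_frechet_derivative assms(2))
    show "smooth_on (\<lambda>q. V q \<bullet> b) U" for b
      using assms(3) unfolding smooth_on_def
      by (blast intro: Ck_on_compose_bounded_linear[OF assms(1) bounded_linear_inner_left])
  qed
qed

lemma smooth_on_lie_deriv:
  assumes "open U" "smooth_on u U" "smooth_on V U"
  shows "smooth_on (lie_deriv V u) U"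
  using smooth_on_derivative_along[OF assms] by (simp add: lie_deriv_def[abs_def])

text \<open>The horizontal direction tangent to the level sets of \<open>u\<close>, scaled by \<open>\<parallel>\<nabla>u\<parallel>\<close>.\<close>

definition level_direction :: "(real^3 \<Rightarrow> real) \<Rightarrow> real^3 \<Rightarrow> real^3" where
  "level_direction u p =
     - lie_deriv Y_field u p *\<^sub>R X_field p + lie_deriv X_field u p *\<^sub>R Y_field p"

text \<open>Where \<open>(Xu, Yu)\<close> is non-zero and has length h and angle \<theta>, this is
  h^2 times the derivative of \<theta> along \<open>level_direction u\<close>. Written without the
  angle, it stays continuous across characteristic points.\<close>

definition curvature_numerator :: "(real^3 \<Rightarrow> real) \<Rightarrow> real^3 \<Rightarrow> real" where
  "curvature_numerator u p =
     lie_deriv X_field u p * lie_deriv (level_direction u) (lie_deriv Y_field u) p -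
     lie_deriv Y_field u p * lie_deriv (level_direction u) (lie_deriv X_field u) p"

context
  fixes U :: "(real^3) set" and u :: "real^3 \<Rightarrow> real"
  assumes U: "open U" and u: "smooth_on u U"
begin

lemma smooth_on_lie_deriv_X: "smooth_on (lie_deriv X_field u) U"
  and smooth_on_lie_deriv_Y: "smooth_on (lie_deriv Y_field u) U"
  by (intro smooth_on_lie_deriv U u smooth_on_X_field smooth_on_Y_field)+

lemma smooth_on_level_direction: "smooth_on (level_direction u) U"
proof -
  have "smooth_on (\<lambda>p. (-1 * lie_deriv Y_field u p) *\<^sub>R X_field p + lie_deriv X_field u p *\<^sub>R Y_field p) U"
    by (intro smooth_on_add smooth_on_scaleR smooth_on_cmult U smooth_on_X_field smooth_on_Y_field
        smooth_on_lie_deriv_X smooth_on_lie_deriv_Y)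
  then show ?thesis by (simp add: level_direction_def[abs_def])
qed

lemma continuous_on_curvature_numerator: "continuous_on U (curvature_numerator u)"
proof -
  note smooth = smooth_on_lie_deriv_X smooth_on_lie_deriv_Y
  note cont = smooth[THEN smooth_on_continuous_on]
    smooth[THEN smooth_on_lie_deriv[OF U _ smooth_on_level_direction], THEN smooth_on_continuous_on]
  show ?thesis
    unfolding curvature_numerator_def[abs_def]
    by (rule continuous_on_diff[OF continuous_on_mult[OF cont(1,4)] continuous_on_mult[OF cont(2,3)]])
qed

lemma lie_deriv_level_direction:
  assumes f: "smooth_on f U" and p: "p \<in> U"
  shows "lie_deriv (level_direction u) f p =
    - lie_deriv Y_field u p * lie_deriv X_field f p + lie_deriv X_field u p * lie_deriv Y_field f p"
proof -
  have l: "linear (frechet_derivative f (at p))"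
    using has_derivative_linear[OF smooth_on_has_derivative[OF f p]] .
  show ?thesis
    by (simp add: lie_deriv_def[of "level_direction u"] level_direction_def linear_add[OF l] linear_diff[OF l]
        linear_scale[OF l] linear_neg[OF l] flip: lie_deriv_def)
qed

text \<open>Both frame fields are divergence free, so the divergence of \<open>f X + g Y\<close> is
  \<open>Xf + Yg\<close>. The quotient rule then produces the numerator once \<open>h * h\<close> is
  replaced by \<open>A * A + B * B\<close>.\<close>

lemma divergence_unit_gradient:
  assumes p: "p \<in> U" and h: "horizontal_gradient_norm u p \<noteq> 0"
  shows "divergence (\<lambda>q. (1 / horizontal_gradient_norm u q) *\<^sub>R horizontal_gradient u q) p =
    curvature_numerator u p / horizontal_gradient_norm u p ^ 3"
proof -
  define A B where "A = lie_deriv X_field u" and "B = lie_deriv Y_field u"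
  define DA DB where "DA = frechet_derivative A (at p)" and "DB = frechet_derivative B (at p)"
  have A: "(A has_derivative DA) (at p)" and B: "(B has_derivative DB) (at p)"
    unfolding DA_def DB_def A_def B_def
    using smooth_on_has_derivative p smooth_on_lie_deriv_X smooth_on_lie_deriv_Y by blast+
  note lA = has_derivative_linear[OF A] and lB = has_derivative_linear[OF B]
  define h where "h = horizontal_gradient_norm u p"
  have hn: "horizontal_gradient_norm u = (\<lambda>q. sqrt ((A q)\<^sup>2 + (B q)\<^sup>2))"
    by (simp add: fun_eq_iff horizontal_gradient_norm_def A_def B_def)
  have hp: "h > 0" using h unfolding h_def horizontal_gradient_norm_def
    by (simp add: less_le)
  have h2: "h * h = A p * A p + B p * B p"
    by (simp add: h_def hn flip: power2_eq_square)
  have pos: "(A p)\<^sup>2 + (B p)\<^sup>2 > 0" using hp h2 by (simp add: power2_eq_square) (metis mult_pos_pos)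
  have ih: "((\<lambda>q. 1 / horizontal_gradient_norm u q) has_derivative
      (\<lambda>k. - (A p * DA k + B p * DB k) / h^3)) (at p)"
  proof -
    have s: "sqrt ((A p)\<^sup>2 + (B p)\<^sup>2) = h" by (simp add: h_def hn)
    have 1: "((\<lambda>q. (A q)\<^sup>2 + (B q)\<^sup>2) has_derivative (\<lambda>k. 2 * (A p * DA k + B p * DB k))) (at p)"
      by (auto intro!: derivative_eq_intros A B simp: algebra_simps)
    have 2: "((\<lambda>q. sqrt ((A q)\<^sup>2 + (B q)\<^sup>2)) has_derivative (\<lambda>k. (A p * DA k + B p * DB k) / h)) (at p)"
      by (rule has_derivative_eq_rhs[OF has_derivative_real_sqrt[OF pos 1]])
        (use hp in \<open>simp add: s fun_eq_iff field_simps\<close>)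
    have "((\<lambda>q. inverse (sqrt ((A q)\<^sup>2 + (B q)\<^sup>2))) has_derivative
        (\<lambda>k. - (inverse h * ((A p * DA k + B p * DB k) / h) * inverse h))) (at p)"
      using Deriv.has_derivative_inverse[OF _ 2] hp by (simp add: s)
    then have "((\<lambda>q. inverse (sqrt ((A q)\<^sup>2 + (B q)\<^sup>2))) has_derivative
        (\<lambda>k. - (A p * DA k + B p * DB k) / h^3)) (at p)"
      by (simp add: power3_eq_cube divide_inverse algebra_simps)
    then show ?thesis by (simp add: hn inverse_eq_divide)
  qed
  define HG where "HG = (\<lambda>k. A p *\<^sub>R (- (k$2 / 2) *\<^sub>R axis 3 1) + DA k *\<^sub>R X_field p +
      (B p *\<^sub>R ((k$1 / 2) *\<^sub>R axis 3 1) + DB k *\<^sub>R Y_field p) :: real^3)"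
  have g: "horizontal_gradient u = (\<lambda>q. A q *\<^sub>R X_field q + B q *\<^sub>R Y_field q)"
    by (simp add: fun_eq_iff horizontal_gradient_def A_def B_def)
  have "(horizontal_gradient u has_derivative HG) (at p)"
    unfolding HG_def g
    by (intro has_derivative_add has_derivative_scaleR A B X_field_has_derivative Y_field_has_derivative)
  note fd_raw = has_derivative_scaleR[OF ih this]
  have fd: "frechet_derivative (\<lambda>q. (1 / horizontal_gradient_norm u q) *\<^sub>R horizontal_gradient u q) (at p) =
     (\<lambda>k. (1 / h) *\<^sub>R HG k + (- (A p * DA k + B p * DB k) / h^3) *\<^sub>R horizontal_gradient u p)"
    using frechet_derivative_at[OF fd_raw, symmetric] by (simp add: h_def)
  \<comment> \<open>These recombine the derivatives along the axes into derivatives along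
    \<open>X\<close> and \<open>Y\<close>. The variable coefficients of the frame sit in the third
    component and depend only on the first two coordinates, so differentiating them contributes
    nothing to the divergence.\<close>
  have DX: "DA (X_field p) = DA (axis 1 1) - (p$2 / 2) * DA (axis 3 1)"
    "DB (X_field p) = DB (axis 1 1) - (p$2 / 2) * DB (axis 3 1)"
    "DA (Y_field p) = DA (axis 2 1) + (p$1 / 2) * DA (axis 3 1)"
    "DB (Y_field p) = DB (axis 2 1) + (p$1 / 2) * DB (axis 3 1)"
    unfolding X_field_eq Y_field_eq
    by (simp_all add: linear_add[OF lA] linear_add[OF lB] linear_diff[OF lA] linear_diff[OF lB]
        linear_scale[OF lA] linear_scale[OF lB])
  have "divergence (\<lambda>q. (1 / horizontal_gradient_norm u q) *\<^sub>R horizontal_gradient u q) p =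
    (DA (X_field p) + DB (Y_field p)) / h - (A p * (A p * DA (X_field p) + B p * DB (X_field p)) +
       B p * (A p * DA (Y_field p) + B p * DB (Y_field p))) / h^3"
    unfolding divergence_def fd sum_3 DX
    by (simp add: HG_def g X_field_nth Y_field_nth axis_def add_divide_distrib diff_divide_distrib algebra_simps)
  also have "\<dots> = ((DA (X_field p) + DB (Y_field p)) * (h * h) - (A p * (A p * DA (X_field p) + B p * DB (X_field p)) +
       B p * (A p * DA (Y_field p) + B p * DB (Y_field p)))) / h^3"
    using hp by (simp add: field_simps power3_eq_cube)
  also have "\<dots> = (A p * (- B p * DB (X_field p) + A p * DB (Y_field p)) -
      B p * (- B p * DA (X_field p) + A p * DA (Y_field p))) / h^3"
    unfolding h2 by (simp add: algebra_simps)
  also have "\<dots> = curvature_numerator u p / h^3"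
    unfolding curvature_numerator_def
      lie_deriv_level_direction[OF smooth_on_lie_deriv_X p] lie_deriv_level_direction[OF smooth_on_lie_deriv_Y p]
    by (simp add: lie_deriv_def DA_def DB_def A_def B_def)
  finally show ?thesis by (simp add: h_def)
qed

text \<open>The direction \<open>J\<close> itself has coefficients \<open>Xu\<close> and
  \<open>Yu\<close>, so the numerator is a quadratic form in them whose coefficients are second
  derivatives. The factor h^2 gained here leaves a single h in the denominator of the
  curvature.\<close>

lemma abs_curvature_numerator_le:
  assumes p: "p \<in> U"
  shows "\<bar>curvature_numerator u p\<bar> \<le> (horizontal_gradient_norm u p)\<^sup>2 *
    (\<bar>lie_deriv X_field (lie_deriv X_field u) p\<bar> + \<bar>lie_deriv Y_field (lie_deriv X_field u) p\<bar> +
     \<bar>lie_deriv X_field (lie_deriv Y_field u) p\<bar> + \<bar>lie_deriv Y_field (lie_deriv Y_field u) p\<bar>)"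
proof -
  define a b where "a = lie_deriv X_field u p" and "b = lie_deriv Y_field u p"
  define xx yx xy yy where "xx = lie_deriv X_field (lie_deriv X_field u) p"
    and "yx = lie_deriv Y_field (lie_deriv X_field u) p"
    and "xy = lie_deriv X_field (lie_deriv Y_field u) p"
    and "yy = lie_deriv Y_field (lie_deriv Y_field u) p"
  have ab: "\<bar>a * b\<bar> \<le> a\<^sup>2 + b\<^sup>2"
    using sum_squares_bound[of a b] sum_squares_bound[of a "- b"] sum_power2_ge_zero[of a b]
    by (simp add: abs_le_iff)
  have "curvature_numerator u p = - (a * b) * xy + a\<^sup>2 * yy + b\<^sup>2 * xx + - (a * b) * yx"
    unfolding curvature_numerator_def
      lie_deriv_level_direction[OF smooth_on_lie_deriv_X p] lie_deriv_level_direction[OF smooth_on_lie_deriv_Y p]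
    by (simp add: a_def b_def xx_def yx_def xy_def yy_def power2_eq_square algebra_simps)
  also have "\<bar>\<dots>\<bar> \<le> \<bar>a * b\<bar> * \<bar>xy\<bar> + a\<^sup>2 * \<bar>yy\<bar> + b\<^sup>2 * \<bar>xx\<bar> + \<bar>a * b\<bar> * \<bar>yx\<bar>"
  proof -
    have "\<bar>- (a * b) * xy\<bar> = \<bar>a * b\<bar> * \<bar>xy\<bar>" "\<bar>a\<^sup>2 * yy\<bar> = a\<^sup>2 * \<bar>yy\<bar>"
      "\<bar>b\<^sup>2 * xx\<bar> = b\<^sup>2 * \<bar>xx\<bar>" "\<bar>- (a * b) * yx\<bar> = \<bar>a * b\<bar> * \<bar>yx\<bar>"
      by (simp_all add: abs_mult)
    moreover have "\<bar>w + x + y + z\<bar> \<le> \<bar>w\<bar> + \<bar>x\<bar> + \<bar>y\<bar> + \<bar>z\<bar>" for w x y z :: real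
      by linarith
    ultimately show ?thesis by metis
  qed
  also have "\<dots> \<le> (a\<^sup>2 + b\<^sup>2) * \<bar>xy\<bar> + (a\<^sup>2 + b\<^sup>2) * \<bar>yy\<bar> + (a\<^sup>2 + b\<^sup>2) * \<bar>xx\<bar> + (a\<^sup>2 + b\<^sup>2) * \<bar>yx\<bar>"
    by (intro add_mono mult_right_mono ab) auto
  finally show ?thesis
    unfolding horizontal_gradient_norm_def a_def b_def xx_def yx_def xy_def yy_def
    by (simp add: algebra_simps)
qed

end

text \<open>The function \<open>A' B - B' A\<close> vanishes on \<open>S\<close>, and
  \<open>J\<close> is tangent to \<open>S\<close>. Differentiating along \<open>J\<close> trades
  derivatives of \<open>A'\<close> and \<open>B'\<close> for those of \<open>A\<close> and
  \<open>B\<close>, so that no derivative of the factor \<open>c\<close> appears. The numerator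
  scales by c^3, and the cube of the norm by |c|^3.\<close>

lemma curvature_defining_function_independent:
  assumes u: "local_defining_function S p U u" and v: "local_defining_function S p U' v" and p: "p \<in> S"
  shows "\<bar>curvature_numerator u p\<bar> / horizontal_gradient_norm u p ^ 3 =
    \<bar>curvature_numerator v p\<bar> / horizontal_gradient_norm v p ^ 3"
proof -
  have U: "open U" "p \<in> U" "smooth_on u U" and U': "open U'" "p \<in> U'" "smooth_on v U'"
    using u v unfolding local_defining_function_def by auto
  define A B where "A = lie_deriv X_field u" and "B = lie_deriv Y_field u"
  define A' B' where "A' = lie_deriv X_field v" and "B' = lie_deriv Y_field v"
  note ab_defs = A_def B_def A'_def B'_def
  define J where "J = level_direction u p"
  obtain c where c: "c \<noteq> 0" "\<And>h. frechet_derivative v (at p) h = c * frechet_derivative u (at p) h"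
    using local_defining_function_proportional[OF u v p] by blast
  have cAB: "A' p = c * A p" "B' p = c * B p" by (simp_all add: ab_defs lie_deriv_def c)
  have J': "level_direction v p = c *\<^sub>R J"
    using cAB by (simp add: J_def level_direction_def ab_defs algebra_simps)
  have norm: "horizontal_gradient_norm v p = \<bar>c\<bar> * horizontal_gradient_norm u p"
    using cAB by (simp add: horizontal_gradient_norm_def ab_defs power_mult_distrib real_sqrt_mult flip: distrib_left)
  have smooth: "smooth_on A U" "smooth_on B U" "smooth_on A' U'" "smooth_on B' U'"
    unfolding ab_defs using smooth_on_lie_deriv_X smooth_on_lie_deriv_Y U U' by blast+
  note D = smooth_on_has_derivative[OF smooth(1) U(2)] smooth_on_has_derivative[OF smooth(2) U(2)]
    smooth_on_has_derivative[OF smooth(3) U'(2)] smooth_on_has_derivative[OF smooth(4) U'(2)]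
  have "frechet_derivative u (at p) J = 0"
    using local_defining_function_linear[OF u U(2)]
    by (simp add: J_def level_direction_def lie_deriv_def linear_diff linear_add linear_neg linear_scale)
  note J0 = this
  have E: "((\<lambda>q. A' q * B q - B' q * A q) has_derivative (\<lambda>J.
      A' p * frechet_derivative B (at p) J + frechet_derivative A' (at p) J * B p -
      (B' p * frechet_derivative A (at p) J + frechet_derivative B' (at p) J * A p))) (at p)"
    by (intro has_derivative_diff has_derivative_mult D)
  \<comment> \<open>The factor obtained here belongs to the point \<open>q\<close>; it cancels in
    this combination.\<close>
  have zero: "A' q * B q - B' q * A q = 0" if "q \<in> S \<inter> (U \<inter> U')" for q
  proof -
    have q: "q \<in> U" "q \<in> U'" "q \<in> S" using that by auto
    obtain c where "\<And>h. frechet_derivative v (at q) h = c * frechet_derivative u (at q) h"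
      using local_defining_function_proportional[OF local_defining_function_move[OF u q(1)]
        local_defining_function_move[OF v q(2)] q(3)] by blast
    then show ?thesis by (simp add: ab_defs lie_deriv_def)
  qed
  have "A' p * frechet_derivative B (at p) J + frechet_derivative A' (at p) J * B p -
      (B' p * frechet_derivative A (at p) J + frechet_derivative B' (at p) J * A p) = 0"
    using derivative_zero_on_tangent_plane[OF u p E _ _ zero J0] U U' by auto
  then have eq: "frechet_derivative B' (at p) J * A p - frechet_derivative A' (at p) J * B p =
      c * (A p * frechet_derivative B (at p) J - B p * frechet_derivative A (at p) J)"
    by (simp add: cAB algebra_simps)
  have "curvature_numerator v p =
    c * (A p * (c * frechet_derivative B' (at p) J) - B p * (c * frechet_derivative A' (at p) J))"
    unfolding curvature_numerator_def ab_defs[symmetric]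
    by (simp add: cAB lie_deriv_def J' linear_scale has_derivative_linear[OF D(3)]
        has_derivative_linear[OF D(4)] algebra_simps)
  also have "\<dots> = c * c *
      (frechet_derivative B' (at p) J * A p - frechet_derivative A' (at p) J * B p)"
    by (simp add: algebra_simps)
  also have "\<dots> = c ^ 3 * curvature_numerator u p"
    unfolding eq curvature_numerator_def ab_defs[symmetric]
    by (simp add: lie_deriv_def power3_eq_cube flip: J_def)
  finally show ?thesis
    using c(1) by (simp add: norm power_mult_distrib abs_mult power_abs)
qed

text \<open>The assumption on \<open>H\<close> supplies a defining function that may change with the
  point. By independence one fixed \<open>u\<close> describes \<open>|H|\<close> at all
  non-characteristic points near by.\<close>

lemma mean_curvature_eq:
  assumes H: "is_horizontal_mean_curvature S H" and u: "local_defining_function S p U u"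
    and p: "p \<in> S - characteristic_set S"
  shows "\<bar>H p\<bar> = \<bar>curvature_numerator u p\<bar> / horizontal_gradient_norm u p ^ 3"
proof -
  obtain U' v where v: "local_defining_function S p U' v"
    and Hp: "H p = - divergence (\<lambda>q. (1 / horizontal_gradient_norm v q) *\<^sub>R horizontal_gradient v q) p"
    using H p unfolding is_horizontal_mean_curvature_def by blast
  have U': "open U'" "p \<in> U'" "smooth_on v U'" using v unfolding local_defining_function_def by auto
  have "horizontal_gradient_norm v p \<noteq> 0"
    using p characteristic_set_iff[OF v] by (auto simp: horizontal_gradient_norm_def sum_power2_eq_zero_iff)
  then have "\<bar>H p\<bar> = \<bar>curvature_numerator v p / horizontal_gradient_norm v p ^ 3\<bar>"
    by (simp add: Hp divergence_unit_gradient[OF U'(1,3,2)])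
  also have "\<dots> = \<bar>curvature_numerator v p\<bar> / horizontal_gradient_norm v p ^ 3"
    by (simp add: abs_divide horizontal_gradient_norm_def)
  finally show ?thesis
    using curvature_defining_function_independent[OF u v] p by simp
qed

section \<open>The induced measure in a parametrization\<close>

text \<open>Smoothness of the metric is given for fixed vectors only; the finite expansion turns it
  into joint continuity in the point and the vectors.\<close>

lemma riemannian_metric_expand:
  assumes "riemannian_metric G"
  shows "G q v w = (\<Sum>b\<in>Basis. \<Sum>b'\<in>Basis. (v \<bullet> b) * (w \<bullet> b') * G q b b')"
proof -
  have l: "linear (\<lambda>v. G q v w)" "linear (G q v)" for v w
    using assms by (auto simp: riemannian_metric_def bilinear_def)
  have "G q v w = (\<Sum>b\<in>Basis. (v \<bullet> b) * G q b w)"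
    using linear_eq_sum_Basis[OF l(1)[of w], of v] by simp
  also have "\<dots> = (\<Sum>b\<in>Basis. \<Sum>b'\<in>Basis. (v \<bullet> b) * (w \<bullet> b') * G q b b')"
    by (subst linear_eq_sum_Basis[OF l(2), of _ w]) (simp add: sum_distrib_left mult.assoc)
  finally show ?thesis .
qed

text \<open>On the compact product of \<open>K\<close> with the unit sphere the metric has a
  positive minimum, and homogeneity does the rest. The purpose is to bound the Euclidean length of a
  unit normal.\<close>

lemma riemannian_metric_lower_bound:
  assumes G: "riemannian_metric G" and K: "compact K"
  obtains c where "c > 0" "\<And>q v. q \<in> K \<Longrightarrow> c * (norm v)\<^sup>2 \<le> G q v v"
proof (cases "K = {}")
  case False
  let ?D = "K \<times> sphere (0::real^3) 1"
  have "continuous_on ?D (\<lambda>x. G (fst x) b b')" for b b'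
    using G smooth_on_continuous_on[of "\<lambda>p. G p b b'" UNIV]
    by (intro continuous_on_compose2[of UNIV "\<lambda>p. G p b b'" ?D fst] continuous_intros)
      (auto simp: riemannian_metric_def)
  then have cont: "continuous_on ?D (\<lambda>x. G (fst x) (snd x) (snd x))"
  proof -
    have "(\<lambda>x. G (fst x) (snd x) (snd x)) =
        (\<lambda>x. \<Sum>b\<in>Basis. \<Sum>b'\<in>Basis. (snd x \<bullet> b) * (snd x \<bullet> b') * G (fst x) b b')"
      by (rule ext) (rule riemannian_metric_expand[OF G])
    then show ?thesis
      using \<open>\<And>b b'. continuous_on ?D (\<lambda>x. G (fst x) b b')\<close> by (simp only:) (intro continuous_intros)
  qed
  have "compact ?D" using K by (intro compact_Times compact_sphere)
  moreover have "axis 1 1 \<in> sphere (0::real^3) 1" by simp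
  then have "?D \<noteq> {}" using False by blast
  ultimately obtain x where x: "x \<in> ?D" "\<And>y. y \<in> ?D \<Longrightarrow> G (fst x) (snd x) (snd x) \<le> G (fst y) (snd y) (snd y)"
    using continuous_attains_inf[OF _ _ cont] by blast
  define c where "c = G (fst x) (snd x) (snd x)"
  have "snd x \<noteq> 0" using x(1) by auto
  then have "c > 0" using G unfolding c_def riemannian_metric_def by blast
  moreover have "c * (norm v)\<^sup>2 \<le> G q v v" if "q \<in> K" for q v
  proof (cases "v = 0")
    case False
    define s where "s = v /\<^sub>R norm v"
    have v: "v = norm v *\<^sub>R s" using False by (simp add: s_def)
    have "(q, s) \<in> ?D" using that False by (simp add: s_def)
    then have "c \<le> G q s s" using x(2)[of "(q, s)"] by (simp add: c_def)
    then have "(norm v)\<^sup>2 * c \<le> (norm v)\<^sup>2 * G q s s" by (intro mult_left_mono) auto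
    also have "\<dots> = G q v v"
    proof -
      have l: "linear (\<lambda>v. G q v w)" "linear (G q v)" for v w
        using G by (auto simp: riemannian_metric_def bilinear_def)
      have "G q (norm v *\<^sub>R s) (norm v *\<^sub>R s) = (norm v)\<^sup>2 * G q s s"
        by (simp add: linear_scale[OF l(1)] linear_scale[OF l(2)] power2_eq_square)
      then show ?thesis by (simp flip: v)
    qed
    finally show ?thesis by (simp add: mult.commute)
  next
    case True
    then show ?thesis using riemannian_metric_expand[OF G, of q v v] by simp
  qed
  ultimately show ?thesis using that by blast
qed (use that[of 1] in auto)

lemma abs_det_3_le:
  fixes a b c :: "real^3"
  shows "\<bar>det (vector [a, b, c] :: real^3^3)\<bar> \<le> 6 * (norm a * (norm b * norm c))"
proof -
  have t: "\<bar>a$i * b$j * c$k\<bar> \<le> norm a * (norm b * norm c)" for i j k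
    using component_le_norm_cart[of a i] component_le_norm_cart[of b j] component_le_norm_cart[of c k]
    by (simp add: abs_mult mult.assoc mult_mono)
  have "det (vector [a, b, c] :: real^3^3) =
    a$1 * b$2 * c$3 + a$2 * b$3 * c$1 + a$3 * b$1 * c$2 - a$1 * b$3 * c$2 - a$2 * b$1 * c$3 - a$3 * b$2 * c$1"
    by (simp add: det_3 vector_3)
  then show ?thesis
    using t[of 1 2 3] t[of 2 3 1] t[of 3 1 2] t[of 1 3 2] t[of 2 1 3] t[of 3 2 1] by linarith
qed

lemma local_parametrization_open_image:
  assumes \<phi>: "local_parametrization S V \<phi>" and Q: "open Q" "Q \<subseteq> V"
  shows "openin (top_of_set S) (\<phi> ` Q)"
proof -
  obtain \<psi> where hom: "homeomorphism V (\<phi> ` V) \<phi> \<psi>"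
    using \<phi> unfolding local_parametrization_def by blast
  have V: "open V" "openin (top_of_set S) (\<phi> ` V)"
    using \<phi> unfolding local_parametrization_def by auto
  have "openin (top_of_set (\<phi> ` V)) (\<phi> ` Q)"
    using homeomorphism_imp_open_map[OF hom] Q V(1) by (simp add: openin_open_eq)
  then show ?thesis using V(2) openin_trans by blast
qed

text \<open>On \<open>C\<close> the chart derivatives are bounded by continuity and the normal by
  the metric, hence so is the density. As the normal is chosen pointwise, its measurability is
  unknown; the estimate rests on monotonicity of the nonnegative integral, which holds for arbitrary
  functions.\<close>

lemma induced_measure_le:
  assumes M: "is_induced_measure G S M" and G: "riemannian_metric G"
    and \<phi>: "local_parametrization S V \<phi>" and C: "compact C" "C \<subseteq> V"
  obtains K where "K \<ge> 0"
    "\<And>A. A \<in> sets borel \<Longrightarrow> A \<subseteq> C \<Longrightarrow> emeasure M (\<phi> ` A) \<le> ennreal K * emeasure lborel A"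
proof -
  obtain n where n: "unit_normal G S n"
    and eq: "\<forall>V \<phi>. local_parametrization S V \<phi> \<longrightarrow>
         (\<forall>A \<in> sets borel. A \<subseteq> V \<longrightarrow>
           emeasure M (\<phi> ` A) =
             (\<integral>\<^sup>+ v \<in> A. ennreal \<bar>det (vector [n (\<phi> v),
                 frechet_derivative \<phi> (at v) (axis 1 1),
                 frechet_derivative \<phi> (at v) (axis 2 1)] :: real^3^3)\<bar> \<partial>lborel))"
    using M unfolding is_induced_measure_def by (elim conjE exE) (rule that)
  have V: "open V" "smooth_on \<phi> V" "\<phi> ` V \<subseteq> S"
    using \<phi> by (auto simp: local_parametrization_def dest: openin_imp_subset)
  let ?D = "\<lambda>i v. frechet_derivative \<phi> (at v) (axis i 1)"
  have "continuous_on C (?D i)" for i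
    using continuous_on_subset[OF smooth_on_continuous_on[OF smooth_on_frechet_derivative[OF V(2)]] C(2)] .
  then have "bounded (?D i ` C)" for i
    using C(1) compact_continuous_image compact_imp_bounded by blast
  then have "\<exists>m. \<forall>v\<in>C. norm (?D i v) \<le> m" for i
    by (simp add: bounded_iff)
  then obtain m where m: "\<And>i v. v \<in> C \<Longrightarrow> norm (?D i v) \<le> m i" by metis
  have "compact (\<phi> ` C)"
    using compact_continuous_image[OF continuous_on_subset[OF smooth_on_continuous_on[OF V(2)] C(2)] C(1)] .
  then obtain c where c: "c > 0" "\<And>q v. q \<in> \<phi> ` C \<Longrightarrow> c * (norm v)\<^sup>2 \<le> G q v v"
    using riemannian_metric_lower_bound[OF G] by blast
  have nn: "norm (n (\<phi> v)) \<le> sqrt (1 / c)" if "v \<in> C" for v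
  proof -
    have "\<phi> v \<in> S" using that C(2) V(3) by blast
    then have "c * (norm (n (\<phi> v)))\<^sup>2 \<le> 1"
      using n c(2)[of "\<phi> v" "n (\<phi> v)"] that unfolding unit_normal_def by auto
    then show ?thesis using c(1) by (intro real_le_rsqrt) (simp add: field_simps)
  qed
  \<comment> \<open>The absolute value makes \<open>K\<close> nonnegative even when \<open>C\<close>
    is empty and the bounds \<open>m i\<close> are arbitrary.\<close>
  define K where "K = \<bar>6 * (sqrt (1 / c) * (m 1 * m 2))\<bar>"
  have K: "\<bar>det (vector [n (\<phi> v), ?D 1 v, ?D 2 v] :: real^3^3)\<bar> \<le> K" if "v \<in> C" for v
  proof -
    have "norm (n (\<phi> v)) * (norm (?D 1 v) * norm (?D 2 v)) \<le> sqrt (1 / c) * (m 1 * m 2)"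
      using nn[OF that] m[OF that] c(1) order_trans[OF norm_ge_zero m[OF that]]
      by (intro mult_mono) auto
    then show ?thesis
      using abs_det_3_le[of "n (\<phi> v)" "?D 1 v" "?D 2 v"] unfolding K_def by linarith
  qed
  show ?thesis
  proof
    show "K \<ge> 0" by (simp add: K_def)
    fix A :: "(real^2) set" assume A: "A \<in> sets borel" "A \<subseteq> C"
    have "emeasure M (\<phi> ` A) \<le> (\<integral>\<^sup>+ v. ennreal K * indicator A v \<partial>lborel)"
      unfolding eq[rule_format, OF \<phi> A(1) order_trans[OF A(2) C(2)]]
      by (intro nn_integral_mono) (use K A(2) in \<open>auto intro!: ennreal_leI split: split_indicator\<close>)
    also have "\<dots> = ennreal K * emeasure lborel A"
      using A by (intro nn_integral_cmult_indicator) simp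
    finally show "emeasure M (\<phi> ` A) \<le> ennreal K * emeasure lborel A" .
  qed
qed

text \<open>Restricted to the patch, \<open>M\<close> is dominated, as a measure, by
  \<open>K\<close> times the push-forward of Lebesgue measure under \<phi>; the claim compares the
  integrals of \<open>f\<close> against the two.\<close>

lemma nn_integral_induced_measure_le:
  assumes M: "is_induced_measure G S M"
    and \<phi>: "local_parametrization S V \<phi>" and V1: "open V1" "V1 \<subseteq> V"
    and K: "\<And>A. A \<in> sets borel \<Longrightarrow> A \<subseteq> V1 \<Longrightarrow> emeasure M (\<phi> ` A) \<le> ennreal K * emeasure lborel A"
    and f: "f \<in> borel_measurable M"
  shows "(\<integral>\<^sup>+ q \<in> \<phi> ` V1. f q \<partial>M) \<le> (\<integral>\<^sup>+ v \<in> V1. ennreal K * f (\<phi> v) \<partial>lborel)"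
proof -
  have M': "space M = S" "sets M = sets (restrict_space borel S)"
    using M by (simp_all add: is_induced_measure_def)
  have V: "open V" "smooth_on \<phi> V" "\<phi> ` V \<subseteq> S" "openin (top_of_set S) (\<phi> ` V)"
    using \<phi> by (auto simp: local_parametrization_def dest: openin_imp_subset)
  have cont: "continuous_on V1 \<phi>"
    using continuous_on_subset[OF smooth_on_continuous_on[OF V(2)] V1(2)] .
  define W where "W = \<phi> ` V1"
  have "openin (top_of_set S) W"
    unfolding W_def by (rule local_parametrization_open_image[OF \<phi> V1])
  then obtain O1 where O1: "open O1" "W = S \<inter> O1" by (auto simp: openin_open)
  then have W: "W \<in> sets M" unfolding M' by (auto simp: sets_restrict_space)
  \<comment> \<open>Continuity of \<phi> is available on \<open>V1\<close> only, so Lebesgue measure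
    is restricted before it is pushed forward.\<close>
  define \<nu> where "\<nu> = restrict_space lborel V1"
  have sp: "space \<nu> = V1" by (simp add: \<nu>_def space_restrict_space)
  have "\<phi> \<in> \<nu> \<rightarrow>\<^sub>M restrict_space borel S"
  proof (rule measurable_restrict_space2)
    show "\<phi> \<in> space \<nu> \<rightarrow> S" using V1 V(3) sp by auto
    show "\<phi> \<in> \<nu> \<rightarrow>\<^sub>M borel"
      using borel_measurable_continuous_on_restrict[OF cont] unfolding \<nu>_def
      by (simp add: measurable_def sets_restrict_space space_restrict_space)
  qed
  then have \<phi>m [measurable]: "\<phi> \<in> \<nu> \<rightarrow>\<^sub>M M"
    using measurable_cong_sets[OF refl M'(2)] by blast
  define N where "N = density (distr \<nu> M \<phi>) (\<lambda>_. ennreal K)"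
  have "density M (indicator W) \<le> N"
  proof (rule le_measure[THEN iffD2])
    show sets: "sets (density M (indicator W)) = sets N" by (simp add: N_def)
    show "\<forall>B\<in>sets (density M (indicator W)). emeasure (density M (indicator W)) B \<le> emeasure N B"
    proof
      fix B assume "B \<in> sets (density M (indicator W))"
      then have B: "B \<in> sets M" by simp
      define A where "A = \<phi> -` B \<inter> V1"
      have A: "A \<in> sets \<nu>" using measurable_sets[OF \<phi>m B] sp by (simp add: A_def)
      then have A': "A \<in> sets borel" "A \<subseteq> V1"
        unfolding \<nu>_def using V1(1) by (auto simp: sets_restrict_space_iff A_def)
      have "emeasure (density M (indicator W)) B = emeasure M (W \<inter> B)"
        using W B by (simp add: emeasure_restricted)
      also have "W \<inter> B = \<phi> ` A" by (auto simp: W_def A_def)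
      also have "emeasure M (\<phi> ` A) \<le> ennreal K * emeasure lborel A"
        using K A' by blast
      also have "emeasure lborel A = emeasure \<nu> A"
        unfolding \<nu>_def using V1(1) A' by (simp add: emeasure_restrict_space)
      also have "\<dots> = emeasure (distr \<nu> M \<phi>) B"
        by (subst emeasure_distr[OF \<phi>m B]) (simp add: A_def sp)
      also have "ennreal K * \<dots> = emeasure N B"
        using B by (simp add: N_def emeasure_density_const)
      finally show "emeasure (density M (indicator W)) B \<le> emeasure N B" .
    qed
  qed
  then have "nn_integral (density M (indicator W)) f \<le> nn_integral N f"
    by (intro nn_integral_mono_measure) (simp_all add: N_def)
  also have "nn_integral (density M (indicator W)) f = (\<integral>\<^sup>+ q \<in> W. f q \<partial>M)"
    using W f by (subst nn_integral_density) (auto simp: mult.commute)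
  also have "nn_integral N f = (\<integral>\<^sup>+ v. ennreal K * f (\<phi> v) \<partial>\<nu>)"
    unfolding N_def using f by (simp add: nn_integral_density nn_integral_distr)
  also have "\<dots> = (\<integral>\<^sup>+ v \<in> V1. ennreal K * f (\<phi> v) \<partial>lborel)"
    unfolding \<nu>_def using V1(1) by (simp add: nn_integral_restrict_space)
  finally show ?thesis by (simp add: W_def)
qed

section \<open>An integrable singularity in the plane\<close>

text \<open>Lebesgue measure is determined by its values on boxes. The product form makes iterated
  integration available on \<open>real^2\<close>.\<close>

lemma lborel_vec2_eq:
  "(lborel :: (real^2) measure) =
    distr (lborel \<Otimes>\<^sub>M lborel) borel (\<lambda>(s, t). s *\<^sub>R axis 1 1 + t *\<^sub>R axis 2 1)"
proof (rule lborel_eqI)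
  let ?m = "\<lambda>(s::real, t::real). s *\<^sub>R axis 1 1 + t *\<^sub>R axis 2 1 :: real^2"
  have m [measurable]: "?m \<in> lborel \<Otimes>\<^sub>M lborel \<rightarrow>\<^sub>M borel" by measurable
  fix l u :: "real^2" assume le: "\<And>b. b \<in> Basis \<Longrightarrow> l \<bullet> b \<le> u \<bullet> b"
  have le': "l $ i \<le> u $ i" for i using le[of "axis i 1"] by (simp add: inner_axis)
  have "?m -` box l u \<inter> space (lborel \<Otimes>\<^sub>M lborel) = {l$1<..<u$1} \<times> {l$2<..<u$2}"
    by (auto simp: space_pair_measure mem_box_cart forall_2 axis_def)
  then have "emeasure (distr (lborel \<Otimes>\<^sub>M lborel) borel ?m) (box l u) =
      emeasure (lborel \<Otimes>\<^sub>M lborel) ({l$1<..<u$1} \<times> {l$2<..<u$2})"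
    by (subst emeasure_distr[OF m]) auto
  also have "\<dots> = emeasure lborel {l$1<..<u$1} * emeasure lborel {l$2<..<u$2}"
    by (rule lborel.emeasure_pair_measure_Times) auto
  also have "\<dots> = ennreal ((u - l) $ 1 * (u - l) $ 2)"
    using le' by (simp add: ennreal_mult)
  also have "(u - l) $ 1 * (u - l) $ 2 = (\<Prod>b\<in>Basis. (u - l) \<bullet> b)"
  proof -
    have B: "(Basis :: (real^2) set) = {axis 1 1, axis 2 1}"
      by (auto simp: Basis_vec_def UNIV_2)
    show ?thesis unfolding B by (subst prod.insert) (auto simp: axis_eq_axis inner_axis)
  qed
  finally show "emeasure (distr (lborel \<Otimes>\<^sub>M lborel) borel ?m) (box l u) = (\<Prod>b\<in>Basis. (u - l) \<bullet> b)" .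
qed simp

lemma nn_integral_vec2:
  fixes f :: "real^2 \<Rightarrow> ennreal"
  assumes [measurable]: "f \<in> borel_measurable borel"
  shows "(\<integral>\<^sup>+ v. f v \<partial>lborel) = (\<integral>\<^sup>+ s. (\<integral>\<^sup>+ t. f (s *\<^sub>R axis 1 1 + t *\<^sub>R axis 2 1) \<partial>lborel) \<partial>lborel)"
proof -
  have "(\<integral>\<^sup>+ v. f v \<partial>lborel) =
      (\<integral>\<^sup>+ (s, t). f (s *\<^sub>R axis 1 1 + t *\<^sub>R axis 2 1) \<partial>(lborel \<Otimes>\<^sub>M lborel))"
    by (subst lborel_vec2_eq, subst nn_integral_distr) (auto simp: case_prod_unfold)
  then show ?thesis by (simp add: lborel.nn_integral_fst[symmetric])
qed

lemma nn_integral_abs_powr_finite: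
  fixes a r :: real
  assumes "a > -1"
  shows "(\<integral>\<^sup>+ x. ennreal (\<bar>x\<bar> powr a) * indicator {-r..r} x \<partial>lborel) < \<infinity>"
proof (cases "r \<ge> 0")
  case True
  let ?f = "\<lambda>x. x powr a * indicator {0..r} x"
  have nn: "(\<integral>\<^sup>+ x. ennreal (?f x) \<partial>lborel) < \<infinity>"
  proof -
    have "(\<integral>\<^sup>+ x. ennreal (?f x) \<partial>lborel) = ennreal (r powr (a + 1) / (a + 1))"
    proof (rule nn_integral_has_integral_lborel)
      show "(?f has_integral r powr (a + 1) / (a + 1)) UNIV"
      proof -
        have "?f = (\<lambda>x. if x \<in> {0..r} then x powr a else 0)"
          by (auto simp: fun_eq_iff indicator_def)
        then show ?thesis
          using has_integral_powr_from_0[OF assms True] by (simp only: has_integral_restrict_UNIV)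
      qed
    qed auto
    then show ?thesis by simp
  qed
  have "(\<integral>\<^sup>+ x. ennreal (?f (- x)) \<partial>lborel) = (\<integral>\<^sup>+ x. ennreal (?f x) \<partial>lborel)"
    using nn_integral_real_affine[of "\<lambda>x. ennreal (?f x)" "-1" 0] by simp
  then have fin: "(\<integral>\<^sup>+ x. ennreal (?f x) + ennreal (?f (- x)) \<partial>lborel) < \<infinity>"
    using nn by (subst nn_integral_add) auto
  have "(\<integral>\<^sup>+ x. ennreal (\<bar>x\<bar> powr a) * indicator {-r..r} x \<partial>lborel) \<le>
      (\<integral>\<^sup>+ x. ennreal (?f x) + ennreal (?f (- x)) \<partial>lborel)"
    by (intro nn_integral_mono) (auto split: split_indicator simp: abs_real_def)
  then show ?thesis using fin by (rule order.strict_trans1)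
qed simp

text \<open>With \<open>x = |t - g(s)|\<close>, \<open>y = |s|\<^sup>k\<close> and \<open>\<theta> = 1 / (2k)\<close>, the weighted inequality
  \<open>x\<^sup>1\<^sup>-\<^sup>\<theta> y\<^sup>\<theta> \<le> x + y\<close> splits the singularity into two integrable powers. No regularity of \<open>g\<close>
  enters, since the inner integral is bounded uniformly in \<open>g\<close>.\<close>

lemma nn_integral_box_inverse_finite:
  fixes F :: "real^2 \<Rightarrow> real" and \<delta> r :: real
  defines "Q \<equiv> {v. \<bar>v$1\<bar> < \<delta> \<and> \<bar>v$2\<bar> < r}"
  assumes meas: "(\<lambda>v. ennreal (1 / F v) * indicator Q v) \<in> borel_measurable borel"
    and c: "c > 0" and k: "k > 0"
    and F: "\<And>s. s \<noteq> 0 \<Longrightarrow> \<bar>s\<bar> < \<delta> \<Longrightarrow> \<exists>g. \<bar>g\<bar> \<le> r \<and>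
      (\<forall>v. v$1 = s \<longrightarrow> \<bar>v$2\<bar> < r \<longrightarrow> c * (\<bar>v$2 - g\<bar> + \<bar>s\<bar> ^ k) \<le> F v)"
  shows "(\<integral>\<^sup>+ v \<in> Q. ennreal (1 / F v) \<partial>lborel) < \<infinity>"
proof -
  \<comment> \<open>With this exponent \<open>(\<bar>s\<bar> ^ k) powr \<theta>\<close> is
    \<open>\<bar>s\<bar> powr (1 / 2)\<close> for every \<open>k\<close>. The powers left in the two
    variables are \<open>- 1 / 2\<close> for \<open>s\<close> and \<open>\<theta> - 1\<close> for
    \<open>t\<close>, both greater than -1.\<close>
  define \<theta> where "\<theta> = 1 / (2 * real k)"
  have \<theta>: "0 < \<theta>" "\<theta> < 1" using k by (auto simp: \<theta>_def field_simps)
  define m :: "real \<Rightarrow> real \<Rightarrow> real^2" where "m s t = s *\<^sub>R axis 1 1 + t *\<^sub>R axis 2 1" for s t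
  have m_nth: "m s t $ 1 = s" "m s t $ 2 = t" for s t
    unfolding m_def by (simp_all add: axis_def)
  \<comment> \<open>From \<open>\<bar>t\<bar> < r\<close> and \<open>\<bar>g\<bar> \<le> r\<close>
    the difference \<open>t - g\<close> lies within \<open>2 * r\<close>, so after a translation
    \<open>I\<close> serves for all \<open>g\<close> at once.\<close>
  define I where "I = (\<integral>\<^sup>+ x. ennreal (\<bar>x\<bar> powr (\<theta> - 1)) * indicator {-(2*r)..2*r} x \<partial>lborel)"
  have I: "I < \<infinity>" unfolding I_def using \<theta> by (intro nn_integral_abs_powr_finite) auto
  have inner: "(\<integral>\<^sup>+ t. ennreal (1 / F (m s t)) * indicator Q (m s t) \<partial>lborel) \<le>
      ennreal (1 / c) * I * (ennreal (\<bar>s\<bar> powr (- 1 / 2)) * indicator {-\<delta>..\<delta>} s)" if s: "s \<noteq> 0" for s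
  proof (cases "\<bar>s\<bar> < \<delta>")
    case True
    obtain g where g: "\<bar>g\<bar> \<le> r" "\<And>v. v$1 = s \<Longrightarrow> \<bar>v$2\<bar> < r \<Longrightarrow> c * (\<bar>v$2 - g\<bar> + \<bar>s\<bar> ^ k) \<le> F v"
      using F[OF s True] by blast
    have bound: "1 / F (m s t) \<le> (1 / c) * \<bar>s\<bar> powr (- 1 / 2) * \<bar>t - g\<bar> powr (\<theta> - 1)"
      if t: "\<bar>t\<bar> < r" "t \<noteq> g" for t
    proof -
      let ?x = "\<bar>t - g\<bar>" and ?y = "\<bar>s\<bar> ^ k"
      have xy: "?x > 0" "?y > 0" using t s by auto
      \<comment> \<open>Each factor is at most the same power of \<open>?x + ?y\<close>, and the two
        exponents add up to 1.\<close>
      have "?x powr (1 - \<theta>) * ?y powr \<theta> \<le> (?x + ?y) powr (1 - \<theta>) * (?x + ?y) powr \<theta>"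
        using xy \<theta> by (intro mult_mono powr_mono2) auto
      also have "\<dots> = ?x + ?y" using xy by (simp flip: powr_add)
      finally have "c * (?x powr (1 - \<theta>) * ?y powr \<theta>) \<le> F (m s t)"
        using g(2)[of "m s t"] t c unfolding m_nth
        by (meson less_imp_le mult_left_mono order_trans)
      then have "1 / F (m s t) \<le> 1 / (c * (?x powr (1 - \<theta>) * ?y powr \<theta>))"
        using xy c by (intro divide_left_mono mult_pos_pos) (auto intro: less_le_trans[rotated])
      also have "?y powr \<theta> = \<bar>s\<bar> powr (1 / 2)"
        using s k by (simp add: \<theta>_def powr_powr flip: powr_realpow)
      also have "1 / (c * (?x powr (1 - \<theta>) * \<bar>s\<bar> powr (1 / 2))) = 
          (1 / c) * \<bar>s\<bar> powr (- 1 / 2) * ?x powr (\<theta> - 1)"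
        using powr_minus_divide[of "?x" "1 - \<theta>"] powr_minus_divide[of "\<bar>s\<bar>" "1 / 2"] by simp
      finally show ?thesis .
    qed
    \<comment> \<open>At \<open>t = g\<close> the pointwise bound can fail, since
      \<open>0 powr (\<theta> - 1)\<close> is 0 by convention.\<close>
    have "AE t in lborel. t \<noteq> g" by (rule AE_lborel_singleton)
    then have "(\<integral>\<^sup>+ t. ennreal (1 / F (m s t)) * indicator Q (m s t) \<partial>lborel) \<le>
      (\<integral>\<^sup>+ t. ennreal ((1 / c) * \<bar>s\<bar> powr (- 1 / 2)) *
        (ennreal (\<bar>t - g\<bar> powr (\<theta> - 1)) * indicator {-(2*r)..2*r} (t - g)) \<partial>lborel)"
    proof (intro nn_integral_mono_AE, eventually_elim)
      case (elim t)
      show ?case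
      proof (cases "\<bar>t\<bar> < r")
        case True
        then have "t - g \<in> {-(2*r)..2*r}" using g(1) by auto
        then show ?thesis
          using bound[OF True \<open>t \<noteq> g\<close>] c
          by (auto split: split_indicator simp flip: ennreal_mult intro!: ennreal_leI)
      qed (simp add: Q_def m_nth)
    qed
    also have "\<dots> = ennreal ((1 / c) * \<bar>s\<bar> powr (- 1 / 2)) *
        (\<integral>\<^sup>+ t. ennreal (\<bar>t - g\<bar> powr (\<theta> - 1)) * indicator {-(2*r)..2*r} (t - g) \<partial>lborel)"
      by (rule nn_integral_cmult) measurable
    also have "(\<integral>\<^sup>+ t. ennreal (\<bar>t - g\<bar> powr (\<theta> - 1)) * indicator {-(2*r)..2*r} (t - g) \<partial>lborel) = I"
      unfolding I_def
      using nn_integral_real_affine[of "\<lambda>x. ennreal (\<bar>x\<bar> powr (\<theta> - 1)) * indicator {-(2*r)..2*r} x" 1 "- g"]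
      by simp
    also have "ennreal ((1 / c) * \<bar>s\<bar> powr (- 1 / 2)) * I =
        ennreal (1 / c) * I * (ennreal (\<bar>s\<bar> powr (- 1 / 2)) * indicator {-\<delta>..\<delta>} s)"
      using True c by (subst ennreal_mult) (auto simp: mult_ac indicator_def)
    finally show ?thesis .
  qed (simp add: Q_def m_nth)
  have "(\<integral>\<^sup>+ v \<in> Q. ennreal (1 / F v) \<partial>lborel) =
      (\<integral>\<^sup>+ s. (\<integral>\<^sup>+ t. ennreal (1 / F (m s t)) * indicator Q (m s t) \<partial>lborel) \<partial>lborel)"
    unfolding m_def by (rule nn_integral_vec2[OF meas])
  also have "\<dots> \<le> (\<integral>\<^sup>+ s. ennreal (1 / c) * I * (ennreal (\<bar>s\<bar> powr (- 1 / 2)) * indicator {-\<delta>..\<delta>} s) \<partial>lborel)"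
    using AE_lborel_singleton[of "0::real"] by (intro nn_integral_mono_AE) (elim eventually_mono, rule inner)
  also have "\<dots> = ennreal (1 / c) * I * (\<integral>\<^sup>+ s. ennreal (\<bar>s\<bar> powr (- 1 / 2)) * indicator {-\<delta>..\<delta>} s \<partial>lborel)"
    by (rule nn_integral_cmult) measurable
  also have "\<dots> < \<infinity>"
    using I nn_integral_abs_powr_finite[of "- 1 / 2" \<delta>] by (auto simp: ennreal_mult_less_top)
  finally show ?thesis .
qed

section \<open>Mildly degenerate points\<close>

lemma smooth_on_DERIV:
  fixes f :: "real \<Rightarrow> real"
  assumes "smooth_on f S" "x \<in> S"
  shows "DERIV f x :> frechet_derivative f (at x) 1" "DERIV f x :> deriv f x"
proof -
  show "DERIV f x :> frechet_derivative f (at x) 1"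
    using has_real_derivative_along_line[of f _ 0 x 1 0 0] smooth_on_has_derivative[OF assms] by simp
  then show "DERIV f x :> deriv f x" using DERIV_imp_deriv by metis
qed

lemma smooth_on_deriv:
  fixes f :: "real \<Rightarrow> real"
  assumes "open S" "smooth_on f S"
  shows "smooth_on (deriv f) S"
proof (rule smooth_on_cong[OF assms(1) _ smooth_on_frechet_derivative[OF assms(2)]])
  show "frechet_derivative f (at x) 1 = deriv f x" if "x \<in> S" for x
    using smooth_on_DERIV[OF assms(2) that] DERIV_unique by blast
qed

text \<open>At the least order \<open>n\<close> with a non-zero derivative, the Maclaurin formula
  reduces to its remainder, and by continuity the derivative in the remainder keeps at least half of
  its size near 0.\<close>

lemma finite_order_lower_bound:
  fixes f :: "real \<Rightarrow> real"
  assumes "\<epsilon> > 0" "smooth_on f {-\<epsilon><..<\<epsilon>}" "(deriv ^^ k) f 0 \<noteq> 0"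
  obtains m c \<delta> where "m > 0" "c > 0" "0 < \<delta>" "\<delta> \<le> \<epsilon>" "\<And>s. \<bar>s\<bar> < \<delta> \<Longrightarrow> c * \<bar>s\<bar> ^ m \<le> \<bar>f s\<bar>"
proof -
  let ?I = "{-\<epsilon><..<\<epsilon>}"
  have sm: "smooth_on ((deriv ^^ j) f) ?I" for j
    by (induction j) (use assms(2) smooth_on_deriv in auto)
  have D: "DERIV ((deriv ^^ j) f) x :> (deriv ^^ Suc j) f x" if "x \<in> ?I" for j x
    using smooth_on_DERIV(2)[OF sm that, of j] by simp
  define n where "n = (LEAST j. (deriv ^^ j) f 0 \<noteq> 0)"
  have n: "(deriv ^^ n) f 0 \<noteq> 0" "\<And>j. j < n \<Longrightarrow> (deriv ^^ j) f 0 = 0"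
    unfolding n_def using LeastI[of "\<lambda>j. (deriv ^^ j) f 0 \<noteq> 0", OF assms(3)] not_less_Least by auto
  define d where "d = \<bar>(deriv ^^ n) f 0\<bar>"
  have d: "d > 0" using n by (simp add: d_def)
  have "isCont ((deriv ^^ n) f) 0"
    using D[of 0 n] assms(1) DERIV_isCont by simp
  then obtain \<eta> where \<eta>: "\<eta> > 0" "\<And>s. dist s 0 < \<eta> \<Longrightarrow> dist ((deriv ^^ n) f s) ((deriv ^^ n) f 0) < d / 2"
    unfolding continuous_at_eps_delta using d by (meson half_gt_zero)
  define \<delta> where "\<delta> = min 1 (min \<epsilon> \<eta>)"
  show ?thesis
  proof
    \<comment> \<open>The order \<open>n\<close> may be 0, whereas the integral estimate wants a
      positive exponent. Passing to \<open>Suc n\<close> only weakens the bound, as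
      \<open>\<bar>s\<bar> < 1\<close>.\<close>
    show "0 < Suc n" "d / 2 / fact n > 0" "0 < \<delta>" "\<delta> \<le> \<epsilon>"
      using d assms(1) \<eta>(1) by (auto simp: \<delta>_def)
    fix s :: real assume s: "\<bar>s\<bar> < \<delta>"
    obtain t where t: "\<bar>t\<bar> \<le> \<bar>s\<bar>"
      and f: "f s = (\<Sum>m<n. (deriv ^^ m) f 0 / fact m * s ^ m) + (deriv ^^ n) f t / fact n * s ^ n"
      using Maclaurin_bi_le[of "\<lambda>m. (deriv ^^ m) f" f n s] D s by (auto simp: \<delta>_def abs_le_iff)
    have "f s = (deriv ^^ n) f t / fact n * s ^ n" using f n(2) by simp
    then have fs: "\<bar>f s\<bar> = \<bar>(deriv ^^ n) f t\<bar> / fact n * \<bar>s\<bar> ^ n" by (simp add: abs_mult power_abs)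
    have "d / 2 \<le> \<bar>(deriv ^^ n) f t\<bar>"
    proof -
      have "dist ((deriv ^^ n) f t) ((deriv ^^ n) f 0) < d / 2"
        using t s by (intro \<eta>(2)) (simp add: \<delta>_def)
      then show ?thesis unfolding d_def dist_real_def by linarith
    qed
    then have "d / 2 / fact n * \<bar>s\<bar> ^ n \<le> \<bar>f s\<bar>"
      unfolding fs by (intro mult_right_mono divide_right_mono) auto
    moreover have "\<bar>s\<bar> ^ Suc n \<le> \<bar>s\<bar> ^ n"
      using s by (intro power_decreasing) (auto simp: \<delta>_def)
    then have "d / 2 / fact n * \<bar>s\<bar> ^ Suc n \<le> d / 2 / fact n * \<bar>s\<bar> ^ n"
      using d by (intro mult_left_mono) auto
    ultimately show "d / 2 / fact n * \<bar>s\<bar> ^ Suc n \<le> \<bar>f s\<bar>" by linarith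
  qed
qed

text \<open>In the application \<sigma> is the coordinate of the critical curve in the direction
  \<open>N\<close>. It differs from \<open>x * t\<close> by at most half of
  \<open>\<bar>x * t\<bar>\<close>, so its values at the ends of \<open>{-d..d}\<close> have
  opposite signs and size at least \<open>\<bar>x\<bar> * d / 2\<close>, and the intermediate value
  theorem reaches everything between. The last inequality converts powers of the curve parameter
  into powers of \<open>s\<close>.\<close>

lemma local_preimage:
  fixes \<sigma> :: "real \<Rightarrow> real"
  assumes cont: "continuous_on {-\<tau>..\<tau>} \<sigma>" and "\<sigma> 0 = 0" and D: "(\<sigma> has_real_derivative x) (at 0)"
    and x: "x \<noteq> 0" and \<tau>: "\<tau> > 0"
  obtains \<delta> where "\<delta> > 0" "\<And>s. \<bar>s\<bar> < \<delta> \<Longrightarrow> \<exists>t. \<bar>t\<bar> \<le> \<tau> \<and> \<sigma> t = s \<and> \<bar>s\<bar> \<le> 2 * \<bar>x\<bar> * \<bar>t\<bar>"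
proof -
  have "\<forall>e>0. \<exists>d>0. \<forall>t. norm (t - 0) < d \<longrightarrow> norm (\<sigma> t - \<sigma> 0 - x * (t - 0)) \<le> e * norm (t - 0)"
    using D unfolding has_field_derivative_def has_derivative_at_alt by simp
  moreover have "\<bar>x\<bar> / 2 > 0" using x by simp
  ultimately obtain d0 where d0: "d0 > 0" "\<And>t. \<bar>t\<bar> < d0 \<Longrightarrow> \<bar>\<sigma> t - x * t\<bar> \<le> \<bar>x\<bar> / 2 * \<bar>t\<bar>"
    using assms(2) by (metis diff_zero real_norm_def)
  define d where "d = min \<tau> (d0 / 2)"
  have d: "d > 0" "d \<le> \<tau>" "d < d0" using \<tau> d0(1) by (auto simp: d_def)
  have near: "\<bar>\<sigma> t - x * t\<bar> \<le> \<bar>x\<bar> / 2 * \<bar>t\<bar>" if "\<bar>t\<bar> \<le> d" for t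
    using d0(2)[of t] that d(3) by linarith
  have conn: "connected (\<sigma> ` {-d..d})"
    using d by (intro connected_continuous_image continuous_on_subset[OF cont]) auto
  have "\<exists>y1 \<in> \<sigma> ` {-d..d}. y1 \<le> - (\<bar>x\<bar> * d / 2)" "\<exists>y2 \<in> \<sigma> ` {-d..d}. \<bar>x\<bar> * d / 2 \<le> y2"
  proof -
    have "\<bar>\<sigma> d - x * d\<bar> \<le> \<bar>x * d\<bar> / 2" "\<bar>\<sigma> (- d) + x * d\<bar> \<le> \<bar>x * d\<bar> / 2"
      using near[of d] near[of "- d"] d(1) by (auto simp: abs_mult)
    then have "\<bar>x * d\<bar> / 2 \<le> \<sigma> d \<and> \<sigma> (- d) \<le> - (\<bar>x * d\<bar> / 2) \<or>
        \<sigma> d \<le> - (\<bar>x * d\<bar> / 2) \<and> \<bar>x * d\<bar> / 2 \<le> \<sigma> (- d)"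
      by linarith
    then have *: "\<bar>x\<bar> * d / 2 \<le> \<sigma> d \<and> \<sigma> (- d) \<le> - (\<bar>x\<bar> * d / 2) \<or>
        \<sigma> d \<le> - (\<bar>x\<bar> * d / 2) \<and> \<bar>x\<bar> * d / 2 \<le> \<sigma> (- d)"
      using d(1) by (simp add: abs_mult)
    show "\<exists>y1 \<in> \<sigma> ` {-d..d}. y1 \<le> - (\<bar>x\<bar> * d / 2)" "\<exists>y2 \<in> \<sigma> ` {-d..d}. \<bar>x\<bar> * d / 2 \<le> y2"
      using * d(1) by auto
  qed
  then obtain y1 y2 where y: "y1 \<in> \<sigma> ` {-d..d}" "y1 \<le> - (\<bar>x\<bar> * d / 2)"
    "y2 \<in> \<sigma> ` {-d..d}" "\<bar>x\<bar> * d / 2 \<le> y2" by blast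
  show ?thesis
  proof
    show "\<bar>x\<bar> * d / 2 > 0" using x d by simp
    fix s assume s: "\<bar>s\<bar> < \<bar>x\<bar> * d / 2"
    then have "s \<in> \<sigma> ` {-d..d}"
      using connectedD_interval[OF conn y(1,3)] y(2,4) by auto
    then obtain t where t: "t \<in> {-d..d}" "\<sigma> t = s" by blast
    then have "\<bar>s - x * t\<bar> \<le> \<bar>x\<bar> / 2 * \<bar>t\<bar>" using near[of t] by auto
    then have "\<bar>s\<bar> \<le> \<bar>x * t\<bar> + \<bar>x\<bar> / 2 * \<bar>t\<bar>" by linarith
    also have "\<dots> \<le> 2 * \<bar>x\<bar> * \<bar>t\<bar>" by (simp add: abs_mult)
    finally show "\<exists>t. \<bar>t\<bar> \<le> \<tau> \<and> \<sigma> t = s \<and> \<bar>s\<bar> \<le> 2 * \<bar>x\<bar> * \<bar>t\<bar>"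
      using t d(2) by (intro exI[of _ t]) auto
  qed
qed

lemma convex_mean_value:
  fixes E :: "'a::euclidean_space \<Rightarrow> real"
  assumes "smooth_on E V" "convex Q" "Q \<subseteq> V" "v \<in> Q" "w \<in> Q"
  obtains \<xi> where "\<xi> \<in> Q" "E v - E w = frechet_derivative E (at \<xi>) (v - w)"
proof -
  let ?l = "\<lambda>t. w + t *\<^sub>R (v - w)"
  have Q: "?l t \<in> Q" if "0 \<le> t" "t \<le> 1" for t
  proof -
    have "?l t = (1 - t) *\<^sub>R w + t *\<^sub>R v" by (simp add: algebra_simps)
    then show ?thesis using convexD_alt[OF assms(2,5,4) that] by simp
  qed
  have "DERIV (\<lambda>t. E (?l t)) t :> frechet_derivative E (at (?l t)) (v - w)" if "0 \<le> t" "t \<le> 1" for t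
    using has_real_derivative_along_line[of E _ w t "v - w" 0 0]
      smooth_on_has_derivative[OF assms(1), of "?l t"] Q[OF that] assms(3) by auto
  from MVT2[of 0 1, OF _ this] obtain t where "0 < t" "t < 1"
    "E (?l 1) - E (?l 0) = (1 - 0) * frechet_derivative E (at (?l t)) (v - w)" by auto
  then show ?thesis using that Q[of t] by simp
qed

section \<open>Second-order structure at a degenerate point\<close>

lemma lie_deriv_commutator:
  assumes U: "open U" and w: "smooth_on w U" and p: "p \<in> U"
  shows "lie_deriv X_field (lie_deriv Y_field w) p - lie_deriv Y_field (lie_deriv X_field w) p =
    frechet_derivative w (at p) (axis 3 1)"
proof -
  define W where "W i q = frechet_derivative w (at q) (axis i 1)" for i :: 3 and q
  define H where "H i = frechet_derivative (W i) (at p)" for i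
  have W: "(W i has_derivative H i) (at p)" for i
    unfolding H_def W_def
    using smooth_on_has_derivative[OF smooth_on_frechet_derivative[OF w] p] .
  have sym: "H i (axis j 1) = H j (axis i 1)" for i j
    unfolding H_def W_def by (rule second_derivative_symmetric[OF w U p])
  have lw: "linear (frechet_derivative w (at q))" if "q \<in> U" for q
    using has_derivative_linear[OF smooth_on_has_derivative[OF w that]] .
  have lX: "W 1 q - q$2 / 2 * W 3 q = lie_deriv X_field w q"
    and lY: "W 2 q + q$1 / 2 * W 3 q = lie_deriv Y_field w q" if "q \<in> U" for q
    unfolding lie_deriv_def X_field_eq Y_field_eq W_def
    by (simp_all add: linear_add[OF lw[OF that]] linear_diff[OF lw[OF that]] linear_scale[OF lw[OF that]])
  have "((\<lambda>q. W 1 q - q$2 / 2 * W 3 q) has_derivative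
      (\<lambda>k. H 1 k - (p$2 / 2 * H 3 k + k$2 / 2 * W 3 p))) (at p)"
    by (intro has_derivative_diff has_derivative_mult W | 
        rule bounded_linear_imp_has_derivative bounded_linear_divide[THEN bounded_linear_compose] bounded_linear_vec_nth)+
  from frechet_derivative_at[OF has_derivative_transform_within_open[OF this U p lX]]
  have DX: "frechet_derivative (lie_deriv X_field w) (at p) = (\<lambda>k. H 1 k - (p$2 / 2 * H 3 k + k$2 / 2 * W 3 p))"
    by simp
  have "((\<lambda>q. W 2 q + q$1 / 2 * W 3 q) has_derivative
      (\<lambda>k. H 2 k + (p$1 / 2 * H 3 k + k$1 / 2 * W 3 p))) (at p)"
    by (intro has_derivative_add has_derivative_mult W | 
        rule bounded_linear_imp_has_derivative bounded_linear_divide[THEN bounded_linear_compose] bounded_linear_vec_nth)+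
  from frechet_derivative_at[OF has_derivative_transform_within_open[OF this U p lY]]
  have DY: "frechet_derivative (lie_deriv Y_field w) (at p) = (\<lambda>k. H 2 k + (p$1 / 2 * H 3 k + k$1 / 2 * W 3 p))"
    by simp
  have l: "linear (H i)" for i using has_derivative_linear[OF W] .
  have HX: "H i (X_field p) = H i (axis 1 1) - p$2 / 2 * H i (axis 3 1)"
    and HY: "H i (Y_field p) = H i (axis 2 1) + p$1 / 2 * H i (axis 3 1)" for i
    unfolding X_field_eq Y_field_eq
    by (simp_all add: linear_add[OF l] linear_diff[OF l] linear_scale[OF l])
  \<comment> \<open>Symmetry of second derivatives cancels all second-order terms. The coefficients
    \<open>- y / 2\<close> and \<open>x / 2\<close> of the frame contribute half of the vertical
    derivative each.\<close>
  show ?thesis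
    unfolding lie_deriv_def[of X_field "lie_deriv Y_field w"] lie_deriv_def[of Y_field "lie_deriv X_field w"]
      DX DY HX HY X_field_nth Y_field_nth
    using sym[of 2 1] sym[of 3 1] sym[of 3 2] by (simp add: W_def algebra_simps)
qed

lemma smooth_on_N_field: "open U \<Longrightarrow> smooth_on (N_field a b) U"
  and smooth_on_T_field: "open U \<Longrightarrow> smooth_on (T_field a b) U"
  unfolding N_field_def[abs_def] T_field_def[abs_def]
  by (intro smooth_on_add smooth_on_scaleR smooth_on_const smooth_on_X_field smooth_on_Y_field; assumption)+

lemma lie_deriv_N_T_field:
  assumes "smooth_on f U" "q \<in> U"
  shows "lie_deriv (N_field a b) f q = a * lie_deriv X_field f q + b * lie_deriv Y_field f q"
    and "lie_deriv (T_field a b) f q = - b * lie_deriv X_field f q + a * lie_deriv Y_field f q"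
proof -
  have l: "linear (frechet_derivative f (at q))"
    using has_derivative_linear[OF smooth_on_has_derivative[OF assms]] .
  show "lie_deriv (N_field a b) f q = a * lie_deriv X_field f q + b * lie_deriv Y_field f q"
    "lie_deriv (T_field a b) f q = - b * lie_deriv X_field f q + a * lie_deriv Y_field f q"
    unfolding lie_deriv_def N_field_def T_field_def
    by (simp_all only: linear_add[OF l] linear_scale[OF l] real_scaleR_def)
qed

text \<open>\<open>N\<close> and \<open>T\<close> arise from \<open>X\<close> and \<open>Y\<close>
  by a rotation, so the squares of \<open>Nf\<close> and \<open>Tf\<close> add up to the square of
  the gradient norm.\<close>

lemma abs_N_T_le_gradient_norm:
  assumes "smooth_on f U" "q \<in> U" "a\<^sup>2 + b\<^sup>2 = 1"
  shows "\<bar>lie_deriv (N_field a b) f q\<bar> \<le> horizontal_gradient_norm f q"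
    and "\<bar>lie_deriv (T_field a b) f q\<bar> \<le> horizontal_gradient_norm f q"
proof -
  let ?x = "lie_deriv X_field f q" and ?y = "lie_deriv Y_field f q"
  have "(lie_deriv (N_field a b) f q)\<^sup>2 + (lie_deriv (T_field a b) f q)\<^sup>2 = (a\<^sup>2 + b\<^sup>2) * (?x\<^sup>2 + ?y\<^sup>2)"
    unfolding lie_deriv_N_T_field[OF assms(1,2)] by (simp add: power2_eq_square algebra_simps)
  then have "(horizontal_gradient_norm f q)\<^sup>2 =
      (lie_deriv (N_field a b) f q)\<^sup>2 + (lie_deriv (T_field a b) f q)\<^sup>2"
    by (simp add: horizontal_gradient_norm_def assms(3))
  moreover have "horizontal_gradient_norm f q \<ge> 0" by (simp add: horizontal_gradient_norm_def)
  ultimately show "\<bar>lie_deriv (N_field a b) f q\<bar> \<le> horizontal_gradient_norm f q"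
    "\<bar>lie_deriv (T_field a b) f q\<bar> \<le> horizontal_gradient_norm f q"
    by (metis abs_le_square_iff abs_of_nonneg le_add_same_cancel1 le_add_same_cancel2 zero_le_power2)+
qed

lemma X_Y_field_in_distribution: "X_field p \<in> distribution p" "Y_field p \<in> distribution p"
  by (simp_all add: distribution_def X_field_nth Y_field_nth)

text \<open>The first argument of the Hessian is the outer derivative, so testing the kernel
  condition on the frame gives \<open>NXw = 0\<close> and \<open>NYw = 0\<close> at
  \<open>p\<close>.\<close>

lemma hessian_kernel_derivatives:
  assumes "\<forall>V \<in> distribution p. horizontal_hessian w p (N_field a b p) V = 0"
  shows "a * lie_deriv X_field (lie_deriv X_field w) p + b * lie_deriv Y_field (lie_deriv X_field w) p = 0"
    and "a * lie_deriv X_field (lie_deriv Y_field w) p + b * lie_deriv Y_field (lie_deriv Y_field w) p = 0"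
  using assms[rule_format, OF X_Y_field_in_distribution(1)] assms[rule_format, OF X_Y_field_in_distribution(2)]
  by (simp_all add: horizontal_hessian_def sum_2 frame_component_def N_field_def X_field_nth Y_field_nth
      hessian_matrix_def frame_def)

text \<open>The critical curve \<open>{Nw = 0}\<close> therefore crosses the direction \<open>T\<close> transversally; the source of
  the non-zero term is \<open>[X, Y] = \<partial>\<^sub>z\<close>.\<close>

lemma degenerate_second_derivatives:
  assumes w: "open U" "smooth_on w U" "p \<in> U" and ab: "a\<^sup>2 + b\<^sup>2 = 1"
    and ker: "\<forall>V \<in> distribution p. horizontal_hessian w p (N_field a b p) V = 0"
  shows "frechet_derivative (lie_deriv (N_field a b) w) (at p) (N_field a b p) = 0"
    and "frechet_derivative (lie_deriv (N_field a b) w) (at p) (T_field a b p) =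
      - frechet_derivative w (at p) (axis 3 1)"
proof -
  let ?A = "lie_deriv X_field w" and ?B = "lie_deriv Y_field w"
  have sA: "smooth_on ?A U" and sB: "smooth_on ?B U"
    using smooth_on_lie_deriv_X smooth_on_lie_deriv_Y w by blast+
  note dA = smooth_on_has_derivative[OF sA w(3)] and dB = smooth_on_has_derivative[OF sB w(3)]
  have "((\<lambda>q. a * ?A q + b * ?B q) has_derivative
      (\<lambda>k. a * frechet_derivative ?A (at p) k + b * frechet_derivative ?B (at p) k)) (at p)"
    by (auto intro!: derivative_eq_intros dA dB)
  then have "(lie_deriv (N_field a b) w has_derivative
      (\<lambda>k. a * frechet_derivative ?A (at p) k + b * frechet_derivative ?B (at p) k)) (at p)"
    by (rule has_derivative_transform_within_open[OF _ w(1,3)])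
      (simp add: lie_deriv_N_T_field[OF w(2)])
  from frechet_derivative_at[OF this, symmetric]
  have fd: "frechet_derivative (lie_deriv (N_field a b) w) (at p) =
      (\<lambda>k. a * frechet_derivative ?A (at p) k + b * frechet_derivative ?B (at p) k)" .
  define xx yx xy yy where "xx = lie_deriv X_field ?A p" and "yx = lie_deriv Y_field ?A p"
    and "xy = lie_deriv X_field ?B p" and "yy = lie_deriv Y_field ?B p"
  have N: "frechet_derivative ?A (at p) (N_field a b p) = a * xx + b * yx"
    "frechet_derivative ?B (at p) (N_field a b p) = a * xy + b * yy"
    and T: "frechet_derivative ?A (at p) (T_field a b p) = - b * xx + a * yx"
    "frechet_derivative ?B (at p) (T_field a b p) = - b * xy + a * yy"
    unfolding xx_def yx_def xy_def yy_def
    using lie_deriv_N_T_field[OF sA w(3), of a b] lie_deriv_N_T_field[OF sB w(3), of a b]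
    by (simp_all only: lie_deriv_def)
  have k: "a * xx + b * yx = 0" "a * xy + b * yy = 0"
    unfolding xx_def yx_def xy_def yy_def using hessian_kernel_derivatives[OF ker] by auto
  have comm: "xy - yx = frechet_derivative w (at p) (axis 3 1)"
    unfolding xy_def yx_def using lie_deriv_commutator[OF w] by simp
  show "frechet_derivative (lie_deriv (N_field a b) w) (at p) (N_field a b p) = 0"
    by (simp add: fd N k)
  have "frechet_derivative (lie_deriv (N_field a b) w) (at p) (T_field a b p) =
      a * (- b * xx + a * yx) + b * (- b * xy + a * yy)"
    by (simp only: fd T)
  \<comment> \<open>The relations \<open>k\<close>, with weights \<open>- b\<close> and
    \<open>a\<close>, give \<open>NTw = 0\<close>. What remains of \<open>TNw\<close> is minus the
    bracket, which for the rotated frame is \<open>a\<^sup>2 + b\<^sup>2\<close> times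
    \<open>[X, Y]\<close>.\<close>
  also have "\<dots> = - (a\<^sup>2 + b\<^sup>2) * (xy - yx)"
    using k by algebra
  finally show "frechet_derivative (lie_deriv (N_field a b) w) (at p) (T_field a b p) =
      - frechet_derivative w (at p) (axis 3 1)"
    by (simp add: ab comm)
qed

text \<open>The first two coefficients are read off from the projection to the xy-plane; the
  coefficient of the vertical axis is the contact form at \<open>p\<close> applied to
  \<open>h\<close>.\<close>

lemma N_T_decomposition:
  assumes "a\<^sup>2 + b\<^sup>2 = 1"
  shows "h = (h \<bullet> vector [a, b, 0]) *\<^sub>R N_field a b p + (h \<bullet> vector [- b, a, 0]) *\<^sub>R T_field a b p +
    (h$3 - (p$1 * h$2 - p$2 * h$1) / 2) *\<^sub>R axis 3 1"
proof -
  have ab: "a * a + b * b = 1" using assms by (simp add: power2_eq_square)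
  have 1: "(h$1 * a + h$2 * b) * a - (h$2 * a - h$1 * b) * b = h$1"
    "(h$1 * a + h$2 * b) * b + (h$2 * a - h$1 * b) * a = h$2"
    using ab by algebra+
  have 3: "(h$1 * a + h$2 * b) * (b * p$1 - a * p$2) + (h$2 * a - h$1 * b) * (b * p$2 + a * p$1) =
    p$1 * h$2 - p$2 * h$1"
    using ab by algebra
  show ?thesis
    using 1 3
    by (simp add: vec_eq_iff forall_3 N_field_def T_field_def X_field_nth Y_field_nth axis_def
        inner_vec_def sum_3 vector_3 field_simps)
qed

text \<open>At a characteristic point the differential kills the horizontal plane, which together
  with the vertical axis spans the space; being non-zero, it must detect that axis. The surface is
  thus a graph over the rotated horizontal coordinates.\<close>

lemma characteristic_vertical_derivative:
  assumes w: "local_defining_function S p U w" and p: "p \<in> characteristic_set S"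
  shows "frechet_derivative w (at p) (axis 3 1) \<noteq> 0"
    and "frechet_derivative w (at p) (N_field a b p) = 0"
    and "frechet_derivative w (at p) (T_field a b p) = 0"
proof -
  let ?D = "frechet_derivative w (at p)"
  have pS: "p \<in> S" using p by (simp add: characteristic_set_def)
  have U: "p \<in> U" "smooth_on w U" and D: "?D \<noteq> (\<lambda>_. 0)"
    using w pS unfolding local_defining_function_def by auto
  note l = local_defining_function_linear[OF w U(1)]
  have z: "lie_deriv X_field w p = 0" "lie_deriv Y_field w p = 0"
    using characteristic_set_iff[OF w pS] p by auto
  show NT: "?D (N_field a b p) = 0" "?D (T_field a b p) = 0" for a b
    using lie_deriv_N_T_field[OF U(2,1), of a b] z by (simp_all add: lie_deriv_def)
  show "?D (axis 3 1) \<noteq> 0"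
  proof
    assume "?D (axis 3 1) = 0"
    then have "?D h = 0" for h
      by (subst N_T_decomposition[of 1 0 h p])
        (simp_all add: linear_add[OF l] linear_scale[OF l] NT)
    then show False using D by auto
  qed
qed

section \<open>The gradient norm near a mildly degenerate point\<close>

lemma open_contains_square:
  fixes A :: "(real^2) set"
  assumes "open A" "0 \<in> A"
  obtains r where "r > 0" "{v. \<bar>v$1\<bar> \<le> r \<and> \<bar>v$2\<bar> \<le> r} \<subseteq> A"
proof -
  obtain d where d: "d > 0" "ball 0 d \<subseteq> A" using assms open_contains_ball by blast
  have "{v. \<bar>v$1\<bar> \<le> d / 3 \<and> \<bar>v$2\<bar> \<le> d / 3} \<subseteq> ball (0::real^2) d"
  proof
    fix v :: "real^2" assume "v \<in> {v. \<bar>v$1\<bar> \<le> d / 3 \<and> \<bar>v$2\<bar> \<le> d / 3}"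
    then show "v \<in> ball 0 d" using norm_le_l1_cart[of v] d(1) by (simp add: sum_2)
  qed
  then show ?thesis using that[of "d / 3"] d by auto
qed

lemma derivative_zero_along_curve:
  fixes E :: "'a::real_normed_vector \<Rightarrow> real" and \<gamma> :: "real \<Rightarrow> 'a"
  assumes E: "(E has_derivative E') (at (\<gamma> 0))" and \<gamma>: "(\<gamma> has_derivative \<Gamma>) (at 0)"
    and I: "open I" "0 \<in> I" "\<And>t. t \<in> I \<Longrightarrow> E (\<gamma> t) = 0"
  shows "E' (\<Gamma> h) = 0"
proof -
  have "((\<lambda>_. 0) has_derivative E' \<circ> \<Gamma>) (at 0)"
    by (rule has_derivative_transform_within_open[OF diff_chain_at[OF \<gamma> E] I(1,2)]) (simp add: I(3))
  then have "E' \<circ> \<Gamma> = (\<lambda>_. 0)" by (rule has_derivative_unique[OF _ has_derivative_const])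
  then show ?thesis by (metis comp_apply)
qed

lemma open_derivative_condition:
  fixes f :: "'a::euclidean_space \<Rightarrow> 'b::euclidean_space"
  assumes "open U" "smooth_on f U" "open T"
  shows "open {q \<in> U. frechet_derivative f (at q) h \<in> T}"
  using continuous_open_preimage[OF smooth_on_continuous_on[OF smooth_on_frechet_derivative[OF assms(2)]] assms(1,3)]
  by (simp add: vimage_def Int_def)

text \<open>The velocity of the curve at \<open>p\<close> is a non-zero multiple of
  \<open>N\<close>, so the \<open>N\<close>-coordinate is a parameter to first order. The finite
  order is given for \<open>u\<close>, the kernel condition for \<open>w\<close>; a bound on the
  ratio of their differentials carries the lower bound over from \<open>Tu\<close> to
  \<open>Tw\<close>.\<close>

lemma critical_curve_lower_bound:
  assumes w: "local_defining_function S p U w" and p: "p \<in> characteristic_set S"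
    and ab: "a\<^sup>2 + b\<^sup>2 = 1"
    and ker: "\<forall>V \<in> distribution p. horizontal_hessian w p (N_field a b p) V = 0"
    and \<gamma>: "regular_parametrization_near (critical_curve S a b) p \<epsilon> \<gamma>"
    and u: "local_defining_function S p U' u"
    and ord: "(deriv ^^ k) (\<lambda>s. lie_deriv (T_field a b) u (\<gamma> s)) 0 \<noteq> 0"
    and O1: "open O1" "p \<in> O1"
  obtains m c \<tau> x where "m > 0" "c > 0" "\<tau> > 0" "x \<noteq> 0" "continuous_on {-\<tau>..\<tau>} \<gamma>"
    "((\<lambda>t. (\<gamma> t - p) \<bullet> vector [a, b, 0]) has_real_derivative x) (at 0)"
    "\<And>t. \<bar>t\<bar> \<le> \<tau> \<Longrightarrow> \<gamma> t \<in> S \<inter> U \<inter> O1"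
    "\<And>t. \<bar>t\<bar> \<le> \<tau> \<Longrightarrow> lie_deriv (N_field a b) w (\<gamma> t) = 0"
    "\<And>t. \<bar>t\<bar> \<le> \<tau> \<Longrightarrow> c * \<bar>t\<bar> ^ m \<le> \<bar>lie_deriv (T_field a b) w (\<gamma> t)\<bar>"
proof -
  let ?I = "{-\<epsilon><..<\<epsilon>}" and ?e = "axis 3 1 :: real^3"
  have pS: "p \<in> S" using p by (simp add: characteristic_set_def)
  have U: "open U" "p \<in> U" "smooth_on w U" and U': "open U'" "p \<in> U'" "smooth_on u U'"
    using w u unfolding local_defining_function_def by auto
  obtain W where \<epsilon>: "\<epsilon> > 0" and \<gamma>0: "\<gamma> 0 = p" and sm\<gamma>: "smooth_on \<gamma> ?I"
    and reg: "vector_derivative \<gamma> (at 0) \<noteq> 0" and W: "\<gamma> ` ?I = critical_curve S a b \<inter> W"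
    using \<gamma> unfolding regular_parametrization_near_def by auto
  define D where "D = frechet_derivative w (at p)"
  have De: "D ?e \<noteq> 0" and DN: "D (N_field a b p) = 0" "D (T_field a b p) = 0"
    using characteristic_vertical_derivative[OF w p] by (auto simp: D_def)
  \<comment> \<open>On \<open>O2\<close> the vertical derivative of \<open>w\<close> exceeds
    \<open>m0\<close> and that of \<open>u\<close> stays below \<open>M0\<close> in absolute value.
    Their ratio on the curve is \<kappa>, whence
    \<open>\<bar>\<kappa>\<bar> \<le> M0 / m0\<close>.\<close>
  define m0 M0 where "m0 = \<bar>D ?e\<bar> / 2" and "M0 = \<bar>frechet_derivative u (at p) ?e\<bar> + 1"
  have m0: "m0 > 0" and M0: "M0 > 0" using De by (auto simp: m0_def M0_def)
  define O2 where "O2 = O1 \<inter> {q \<in> U. frechet_derivative w (at q) ?e \<in> - {-m0..m0}} \<inter>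
    {q \<in> U'. frechet_derivative u (at q) ?e \<in> {-M0<..<M0}}"
  have "open O2"
    unfolding O2_def by (intro open_Int open_derivative_condition O1 U U') auto
  moreover have "D ?e \<in> - {-m0..m0}" "frechet_derivative u (at p) ?e \<in> {-M0<..<M0}"
    using De by (auto simp: m0_def M0_def abs_real_def split: if_splits)
  then have "p \<in> O2" unfolding O2_def using O1 U U' by (simp add: D_def)
  ultimately have O2: "open O2" "p \<in> O2" by simp_all
  have "open (?I \<inter> \<gamma> -` O2)" "0 \<in> ?I \<inter> \<gamma> -` O2"
    using continuous_open_preimage[OF smooth_on_continuous_on[OF sm\<gamma>] _ O2(1)] \<epsilon> \<gamma>0 O2(2) by auto
  then obtain \<epsilon>1 where \<epsilon>1: "\<epsilon>1 > 0" "ball 0 \<epsilon>1 \<subseteq> ?I \<inter> \<gamma> -` O2"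
    using open_contains_ball by blast
  have ball: "ball 0 \<epsilon>1 = {-\<epsilon>1<..<\<epsilon>1}" by (simp add: ball_eq_greaterThanLessThan)
  define fu where "fu = (\<lambda>s. lie_deriv (T_field a b) u (\<gamma> s))"
  have "smooth_on fu {-\<epsilon>1<..<\<epsilon>1}"
    unfolding fu_def
  proof (rule smooth_on_compose[OF _ U'(1)])
    show "\<gamma> ` {-\<epsilon>1<..<\<epsilon>1} \<subseteq> U'" using \<epsilon>1(2) by (auto simp: ball O2_def)
    show "smooth_on \<gamma> {-\<epsilon>1<..<\<epsilon>1}"
      by (rule smooth_on_subset[OF sm\<gamma>]) (use \<epsilon>1(2) ball in blast)
  qed (auto intro: smooth_on_lie_deriv smooth_on_T_field U')
  then obtain m c \<delta>1 where m: "m > 0" "c > 0" "0 < \<delta>1" "\<delta>1 \<le> \<epsilon>1"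
    and lower: "\<And>s. \<bar>s\<bar> < \<delta>1 \<Longrightarrow> c * \<bar>s\<bar> ^ m \<le> \<bar>fu s\<bar>"
    using finite_order_lower_bound[OF \<epsilon>1(1), of fu k] ord unfolding fu_def by metis
  have in_O2: "\<gamma> t \<in> O2" "t \<in> ?I" if "\<bar>t\<bar> < \<epsilon>1" for t
    using \<epsilon>1(2) that by (auto simp: subset_iff dist_real_def)
  have in_S: "\<gamma> t \<in> S" "N_field a b (\<gamma> t) \<in> tangent_plane S (\<gamma> t)" if "\<bar>t\<bar> < \<epsilon>1" for t
    using W in_O2(2)[OF that] unfolding critical_curve_def by blast+
  have in_U: "\<gamma> t \<in> U" "\<gamma> t \<in> U'" "\<gamma> t \<in> O1" if "\<bar>t\<bar> < \<epsilon>1" for t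
    using in_O2(1)[OF that] by (auto simp: O2_def)
  have N0: "lie_deriv (N_field a b) w (\<gamma> t) = 0" if "\<bar>t\<bar> < \<epsilon>1" for t
    using in_S[OF that] tangent_plane_eq[OF local_defining_function_move[OF w in_U(1)[OF that]] in_S(1)[OF that]]
    by (simp add: lie_deriv_def)
  have w0: "w (\<gamma> t) = 0" if "\<bar>t\<bar> < \<epsilon>1" for t
    using in_S(1)[OF that] in_U(1)[OF that] w unfolding local_defining_function_def by blast
  have T: "m0 / M0 * c * \<bar>t\<bar> ^ m \<le> \<bar>lie_deriv (T_field a b) w (\<gamma> t)\<bar>" if t: "\<bar>t\<bar> < \<delta>1" for t
  proof -
    have t1: "\<bar>t\<bar> < \<epsilon>1" using t m(4) by linarith
    let ?q = "\<gamma> t"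
    obtain \<kappa> where \<kappa>: "\<And>h. frechet_derivative u (at ?q) h = \<kappa> * frechet_derivative w (at ?q) h"
      using local_defining_function_proportional[OF local_defining_function_move[OF w in_U(1)[OF t1]]
        local_defining_function_move[OF u in_U(2)[OF t1]] in_S(1)[OF t1]] by blast
    have *: "m0 < \<bar>frechet_derivative w (at ?q) ?e\<bar>" "\<bar>\<kappa> * frechet_derivative w (at ?q) ?e\<bar> < M0"
      using in_O2(1)[OF t1] by (auto simp: O2_def simp flip: \<kappa>)
    have "\<bar>\<kappa>\<bar> * m0 \<le> \<bar>\<kappa>\<bar> * \<bar>frechet_derivative w (at ?q) ?e\<bar>"
      using *(1) by (intro mult_left_mono) auto
    then have "\<bar>\<kappa>\<bar> * m0 \<le> M0" using *(2) by (simp add: abs_mult)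
    then have "\<bar>\<kappa>\<bar> \<le> M0 / m0" using m0 by (simp add: field_simps)
    have "c * \<bar>t\<bar> ^ m \<le> \<bar>\<kappa>\<bar> * \<bar>lie_deriv (T_field a b) w ?q\<bar>"
      using lower[OF t] by (simp add: fu_def lie_deriv_def \<kappa> abs_mult)
    also have "\<dots> \<le> M0 / m0 * \<bar>lie_deriv (T_field a b) w ?q\<bar>"
      using \<open>\<bar>\<kappa>\<bar> \<le> M0 / m0\<close> by (intro mult_right_mono) auto
    finally show ?thesis using m0 M0 by (simp add: field_simps)
  qed
  define \<Gamma> where "\<Gamma> = frechet_derivative \<gamma> (at 0)"
  have \<Gamma>: "(\<gamma> has_derivative \<Gamma>) (at 0)"
    unfolding \<Gamma>_def using smooth_on_has_derivative[OF sm\<gamma>] \<epsilon> by simp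
  have \<Gamma>1: "\<Gamma> h = h *\<^sub>R \<Gamma> 1" for h
    using linear_scale[OF has_derivative_linear[OF \<Gamma>], of h 1] by simp
  have "(\<lambda>h. h *\<^sub>R \<Gamma> 1) = \<Gamma>" by (rule ext) (rule \<Gamma>1[symmetric])
  then have "(\<gamma> has_vector_derivative \<Gamma> 1) (at 0)"
    using \<Gamma> unfolding has_vector_derivative_def by (simp only:)
  then have g0: "\<Gamma> 1 \<noteq> 0" using reg vector_derivative_at by metis
  define x y where "x = \<Gamma> 1 \<bullet> vector [a, b, 0]" and "y = \<Gamma> 1 \<bullet> vector [- b, a, 0]"
  obtain z where z: "\<Gamma> 1 = x *\<^sub>R N_field a b p + y *\<^sub>R T_field a b p + z *\<^sub>R ?e"
    using N_T_decomposition[OF ab, of "\<Gamma> 1" p] unfolding x_def y_def by blast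
  define D\<alpha> where "D\<alpha> = frechet_derivative (lie_deriv (N_field a b) w) (at p)"
  have sm\<alpha>: "smooth_on (lie_deriv (N_field a b) w) U"
    by (intro smooth_on_lie_deriv smooth_on_N_field U)
  have Dw: "(w has_derivative D) (at (\<gamma> 0))" and D\<alpha>: "(lie_deriv (N_field a b) w has_derivative D\<alpha>) (at (\<gamma> 0))"
    unfolding D_def D\<alpha>_def \<gamma>0 using smooth_on_has_derivative[OF _ U(2)] U(3) sm\<alpha> by blast+
  \<comment> \<open>Both \<open>w\<close> and \<open>Nw\<close> vanish along the curve. The first
    removes the vertical component \<open>z\<close> of the velocity; the second removes its
    component \<open>y\<close> along \<open>T\<close>, since \<open>NNw = 0\<close> and
    \<open>TNw \<noteq> 0\<close> at \<open>p\<close>.\<close>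
  have z1: "D (\<Gamma> 1) = 0" and z2: "D\<alpha> (\<Gamma> 1) = 0"
    using derivative_zero_along_curve[OF Dw \<Gamma>, of "ball 0 \<epsilon>1"] derivative_zero_along_curve[OF D\<alpha> \<Gamma>, of "ball 0 \<epsilon>1"]
      w0 N0 \<epsilon>1(1) by (auto simp: dist_real_def)
  note lD = has_derivative_linear[OF Dw] and l\<alpha> = has_derivative_linear[OF D\<alpha>]
  have "z = 0" using z1 De DN by (simp add: z linear_add[OF lD] linear_scale[OF lD])
  moreover have "y = 0"
    using z2 \<open>z = 0\<close> degenerate_second_derivatives[OF U(1,3,2) ab ker] De
    by (simp add: z linear_add[OF l\<alpha>] linear_scale[OF l\<alpha>] flip: D\<alpha>_def D_def)
  ultimately have x: "x \<noteq> 0" using z g0 by auto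
  have "((\<lambda>t. (\<gamma> t - p) \<bullet> vector [a, b, 0]) has_derivative (\<lambda>h. \<Gamma> h \<bullet> vector [a, b, 0])) (at 0)"
    by (auto intro!: derivative_eq_intros \<Gamma>)
  moreover have "(\<lambda>h. \<Gamma> h \<bullet> vector [a, b, 0]) = (\<lambda>h. x * h)"
    by (rule ext, subst \<Gamma>1) (simp add: x_def)
  ultimately have "((\<lambda>t. (\<gamma> t - p) \<bullet> vector [a, b, 0]) has_derivative (\<lambda>h. x * h)) (at 0)"
    by (simp only:)
  then have "((\<lambda>t. (\<gamma> t - p) \<bullet> vector [a, b, 0]) has_real_derivative x) (at 0)"
    unfolding has_field_derivative_def .
  moreover have "continuous_on {-(\<delta>1/2)..\<delta>1/2} \<gamma>"
  proof (rule continuous_on_subset[OF smooth_on_continuous_on[OF sm\<gamma>]])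
    show "{-(\<delta>1/2)..\<delta>1/2} \<subseteq> ?I" using in_O2(2) m(3,4) by fastforce
  qed
  moreover have "\<bar>t\<bar> < \<delta>1" "\<bar>t\<bar> < \<epsilon>1" if "\<bar>t\<bar> \<le> \<delta>1 / 2" for t
    using that m(3,4) by linarith+
  ultimately show ?thesis
    using that[of m "m0 / M0 * c" "\<delta>1 / 2" x] m m0 M0 x T in_S(1) in_U N0 by auto
qed

text \<open>On each line of constant \<open>s\<close> the comparison starts from a point
  \<open>v0\<close> of the critical curve. There \<open>Nw\<close> vanishes, and it grows at a rate
  of at least \<open>c1\<close>; there \<open>Tw\<close> has size at least
  \<open>c3 * \<bar>s\<bar> ^ m\<close>, and it changes at a rate of at most \<open>C2\<close>.
  Where \<open>Tw\<close> has become small, the distance travelled already forces \<open>Nw\<close>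
  to be large.\<close>

lemma mildly_degenerate_lower_bound:
  assumes p: "p \<in> characteristic_set S" and mild: "mildly_degenerate S p"
  obtains U w V \<phi> \<delta> r m c where "local_defining_function S p U w" "local_parametrization S V \<phi>"
    "0 \<in> V" "\<phi> 0 = p" "\<phi> ` V \<subseteq> S \<inter> U" "0 < \<delta>" "\<delta> \<le> r" "{v. \<bar>v$1\<bar> \<le> r \<and> \<bar>v$2\<bar> \<le> r} \<subseteq> V"
    "m > 0" "c > 0"
    "\<And>s. s \<noteq> 0 \<Longrightarrow> \<bar>s\<bar> < \<delta> \<Longrightarrow> \<exists>g. \<bar>g\<bar> \<le> r \<and>
      (\<forall>v. v$1 = s \<longrightarrow> \<bar>v$2\<bar> < r \<longrightarrow> c * (\<bar>v$2 - g\<bar> + \<bar>s\<bar> ^ m) \<le> horizontal_gradient_norm w (\<phi> v))"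
proof -
  have pS: "p \<in> S" using p by (simp add: characteristic_set_def)
  obtain a b \<epsilon> \<gamma> U' u k where dir: "hessian_kernel_direction S p a b"
    and \<gamma>: "regular_parametrization_near (critical_curve S a b) p \<epsilon> \<gamma>"
    and u: "local_defining_function S p U' u"
    and ord: "(deriv ^^ k) (\<lambda>s. lie_deriv (T_field a b) u (\<gamma> s)) 0 \<noteq> 0"
    using mild unfolding mildly_degenerate_def by blast
  obtain U w where ab: "a\<^sup>2 + b\<^sup>2 = 1" and w: "local_defining_function S p U w"
    and ker: "\<forall>V \<in> distribution p. horizontal_hessian w p (N_field a b p) V = 0"
    using dir unfolding hessian_kernel_direction_def by blast
  have U: "open U" "p \<in> U" "smooth_on w U" using w unfolding local_defining_function_def by auto
  let ?w1 = "vector [a, b, 0] :: real^3" and ?w2 = "vector [- b, a, 0] :: real^3" and ?e = "axis 3 1 :: real^3"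
  note tri = orthonormal_triple_rotated[OF ab] and vert = characteristic_vertical_derivative[OF w p]
  obtain V \<phi> where \<phi>: "local_parametrization S V \<phi>" "0 \<in> V" "\<phi> 0 = p" "\<phi> ` V \<subseteq> S \<inter> U"
    and coord: "\<And>v. v \<in> V \<Longrightarrow> (\<phi> v - p) \<bullet> ?w1 = v$1" "\<And>v. v \<in> V \<Longrightarrow> (\<phi> v - p) \<bullet> ?w2 = v$2"
    and D\<phi>: "\<And>v h. v \<in> V \<Longrightarrow> frechet_derivative \<phi> (at v) h \<bullet> ?w1 = h$1"
    "\<And>v h. v \<in> V \<Longrightarrow> frechet_derivative \<phi> (at v) h \<bullet> ?w2 = h$2"
    "\<And>v h. v \<in> V \<Longrightarrow> frechet_derivative w (at (\<phi> v)) (frechet_derivative \<phi> (at v) h) = 0"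
    using local_graph[OF tri w pS vert(1)] by metis
  have V: "open V" "smooth_on \<phi> V" using \<phi>(1) unfolding local_parametrization_def by auto
  define \<alpha> \<beta> where "\<alpha> = lie_deriv (N_field a b) w" and "\<beta> = lie_deriv (T_field a b) w"
  have sm: "smooth_on \<alpha> U" "smooth_on \<beta> U"
    unfolding \<alpha>_def \<beta>_def by (intro smooth_on_lie_deriv smooth_on_N_field smooth_on_T_field U)+
  have \<phi>U: "\<phi> ` V \<subseteq> U" using \<phi>(4) by blast
  define A B where "A v = \<alpha> (\<phi> v)" and "B v = \<beta> (\<phi> v)" for v
  have smAB: "smooth_on A V" "smooth_on B V"
    unfolding A_def B_def by (rule smooth_on_compose[OF V(1) U(1) \<phi>U _ V(2)], rule sm)+
  let ?t = "axis 2 1 :: real^2"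
  \<comment> \<open>Both vectors are tangent to the surface and have the same horizontal
    coordinates. Consequently the derivative of \<open>A\<close> at 0 in the second parameter is
    \<open>TNw\<close>, which is non-zero.\<close>
  have "frechet_derivative \<phi> (at 0) ?t = T_field a b p"
  proof (rule kernel_eq_graph_derivative[OF tri local_defining_function_linear[OF w U(2)] vert(1)])
    show "frechet_derivative w (at p) (frechet_derivative \<phi> (at 0) ?t) = 0"
      using D\<phi>(3)[OF \<phi>(2)] by (simp add: \<phi>(3))
    show "frechet_derivative \<phi> (at 0) ?t \<bullet> ?w1 = T_field a b p \<bullet> ?w1"
      "frechet_derivative \<phi> (at 0) ?t \<bullet> ?w2 = T_field a b p \<bullet> ?w2"
      unfolding D\<phi>(1,2)[OF \<phi>(2)] using ab
      by (simp_all add: T_field_def inner_vec_def sum_3 vector_3 X_field_nth Y_field_nth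
          axis_def power2_eq_square)
  qed (rule vert)
  moreover have "((\<lambda>v. \<alpha> (\<phi> v)) has_derivative
      (\<lambda>h. frechet_derivative \<alpha> (at p) (frechet_derivative \<phi> (at 0) h))) (at 0)"
    using diff_chain_at[OF smooth_on_has_derivative[OF V(2) \<phi>(2)], of \<alpha>] smooth_on_has_derivative[OF sm(1) U(2)]
    by (simp add: \<phi>(3) o_def)
  from frechet_derivative_at[OF this, symmetric]
  have "frechet_derivative A (at 0) = (\<lambda>h. frechet_derivative \<alpha> (at p) (frechet_derivative \<phi> (at 0) h))"
    by (simp add: A_def[abs_def])
  ultimately have A0: "frechet_derivative A (at 0) ?t = - frechet_derivative w (at p) ?e"
    using degenerate_second_derivatives(2)[OF U(1,3,2) ab ker] by (simp add: \<alpha>_def)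
  \<comment> \<open>\<open>c1\<close> is half the size of the derivative of \<open>A\<close> at 0,
    and \<open>C2\<close> exceeds that of \<open>B\<close>, so both bounds persist on the
    neighborhood \<open>V'\<close>.\<close>
  define c1 C2 where "c1 = \<bar>frechet_derivative w (at p) ?e\<bar> / 2" and "C2 = \<bar>frechet_derivative B (at 0) ?t\<bar> + 1"
  have c1: "c1 > 0" and C2: "C2 > 0" using vert(1) by (auto simp: c1_def C2_def)
  define V' where "V' = {v \<in> V. frechet_derivative A (at v) ?t \<in> - {-c1..c1}} \<inter>
    {v \<in> V. frechet_derivative B (at v) ?t \<in> {-C2<..<C2}}"
  have "open V'"
    unfolding V'_def by (intro open_Int open_derivative_condition V smAB) auto
  moreover have "frechet_derivative A (at 0) ?t \<in> - {-c1..c1}" "frechet_derivative B (at 0) ?t \<in> {-C2<..<C2}"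
    unfolding A0 using vert(1) by (auto simp: c1_def C2_def abs_real_def split: if_splits)
  then have "0 \<in> V'" using \<phi>(2) by (simp add: V'_def)
  ultimately obtain r where r: "r > 0" "{v. \<bar>v$1\<bar> \<le> r \<and> \<bar>v$2\<bar> \<le> r} \<subseteq> V'"
    using open_contains_square by blast
  define Q where "Q = {v :: real^2. \<bar>v$1\<bar> < r \<and> \<bar>v$2\<bar> < r}"
  have Q_eq: "Q = box (vector [-r, -r]) (vector [r, r])"
    by (auto simp: Q_def mem_box_cart forall_2 vector_2)
  have V'V: "V' \<subseteq> V" unfolding V'_def by blast
  have "Q \<subseteq> {v. \<bar>v$1\<bar> \<le> r \<and> \<bar>v$2\<bar> \<le> r}" by (auto simp: Q_def)
  then have QV': "Q \<subseteq> V'" "Q \<subseteq> V" using r(2) V'V by simp_all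
  have Q: "open Q" "convex Q" unfolding Q_eq by (auto intro: open_box convex_box)
  \<comment> \<open>The critical curve is given in space, not in the chart. Writing the image of
    \<open>Q\<close> as \<open>S \<inter> O1\<close> and keeping the curve inside \<open>O1\<close>
    provides each of its points with a parameter in \<open>Q\<close>.\<close>
  have "openin (top_of_set S) (\<phi> ` Q)"
    by (rule local_parametrization_open_image[OF \<phi>(1) Q(1) QV'(2)])
  then obtain O1 where O1: "open O1" "\<phi> ` Q = S \<inter> O1" by (auto simp: openin_open)
  have "p \<in> \<phi> ` Q" using r(1) \<phi>(3) by (auto simp: Q_def intro!: image_eqI[of _ _ 0])
  then have "p \<in> O1" using O1 by blast
  obtain m c \<tau> x where m: "m > 0" "c > 0" "\<tau> > 0" "x \<noteq> 0" and cont: "continuous_on {-\<tau>..\<tau>} \<gamma>"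
    and \<sigma>: "((\<lambda>t. (\<gamma> t - p) \<bullet> ?w1) has_real_derivative x) (at 0)"
    and in_S: "\<And>t. \<bar>t\<bar> \<le> \<tau> \<Longrightarrow> \<gamma> t \<in> S \<inter> U \<inter> O1"
    and N0: "\<And>t. \<bar>t\<bar> \<le> \<tau> \<Longrightarrow> \<alpha> (\<gamma> t) = 0"
    and lower: "\<And>t. \<bar>t\<bar> \<le> \<tau> \<Longrightarrow> c * \<bar>t\<bar> ^ m \<le> \<bar>\<beta> (\<gamma> t)\<bar>"
    unfolding \<alpha>_def \<beta>_def
    by (rule critical_curve_lower_bound[OF w p ab ker \<gamma> u ord O1(1) \<open>p \<in> O1\<close>]) blast
  have "\<gamma> 0 = p" using \<gamma> unfolding regular_parametrization_near_def by blast
  moreover have "continuous_on {-\<tau>..\<tau>} (\<lambda>t. (\<gamma> t - p) \<bullet> ?w1)"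
    using cont by (intro continuous_intros)
  ultimately obtain \<delta>1 where \<delta>1: "\<delta>1 > 0"
    "\<And>s. \<bar>s\<bar> < \<delta>1 \<Longrightarrow> \<exists>t. \<bar>t\<bar> \<le> \<tau> \<and> (\<gamma> t - p) \<bullet> ?w1 = s \<and> \<bar>s\<bar> \<le> 2 * \<bar>x\<bar> * \<bar>t\<bar>"
    using local_preimage[OF _ _ \<sigma> m(4,3)] by auto
  \<comment> \<open>Since \<open>\<bar>s\<bar> \<le> 2 * \<bar>x\<bar> * \<bar>t\<bar>\<close>, the
    bound \<open>c * \<bar>t\<bar> ^ m\<close> along the curve becomes
    \<open>c3 * \<bar>s\<bar> ^ m\<close>.\<close>
  define c3 where "c3 = c / (2 * \<bar>x\<bar>) ^ m"
  have c3: "c3 > 0" using m by (simp add: c3_def)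
  \<comment> \<open>With \<open>h\<close> the gradient norm, the summands come from
    \<open>\<bar>t - g\<bar> \<le> h / c1\<close> and
    \<open>\<bar>s\<bar> ^ m \<le> h * (1 + C2 / c1) / c3\<close>.\<close>
  define K where "K = 1 / c1 + (1 + C2 / c1) / c3"
  have K: "K > 0" using c1 C2 c3 by (simp add: K_def add_pos_pos)
  show ?thesis
  proof (rule that[OF w \<phi> _ _ _ m(1)])
    show "0 < min \<delta>1 r" "min \<delta>1 r \<le> r" "1 / K > 0" using \<delta>1(1) r(1) K by auto
    show "{v. \<bar>v$1\<bar> \<le> r \<and> \<bar>v$2\<bar> \<le> r} \<subseteq> V" using r(2) V'V by simp
    fix s assume "s \<noteq> 0" and s: "\<bar>s\<bar> < min \<delta>1 r"
    then obtain t where t: "\<bar>t\<bar> \<le> \<tau>" "(\<gamma> t - p) \<bullet> ?w1 = s" "\<bar>s\<bar> \<le> 2 * \<bar>x\<bar> * \<bar>t\<bar>"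
      using \<delta>1(2)[of s] by auto
    have "\<gamma> t \<in> \<phi> ` Q" using in_S[OF t(1)] O1(2) by blast
    then obtain v0 where v0: "v0 \<in> Q" "\<gamma> t = \<phi> v0" by blast
    have v01: "v0 $ 1 = s" using coord(1)[of v0] v0 t(2) QV'(2) by auto
    have A0: "A v0 = 0" using N0[OF t(1)] v0 by (simp add: A_def)
    have "\<bar>s\<bar> ^ m \<le> (2 * \<bar>x\<bar> * \<bar>t\<bar>) ^ m" using t(3) by (intro power_mono) auto
    then have "c3 * \<bar>s\<bar> ^ m \<le> c3 * ((2 * \<bar>x\<bar>) ^ m * \<bar>t\<bar> ^ m)"
      using c3 by (intro mult_left_mono) (auto simp: power_mult_distrib)
    also have "\<dots> = c * \<bar>t\<bar> ^ m" using m by (simp add: c3_def)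
    finally have B0: "c3 * \<bar>s\<bar> ^ m \<le> \<bar>B v0\<bar>" using lower[OF t(1)] v0 by (simp add: B_def)
    show "\<exists>g. \<bar>g\<bar> \<le> r \<and> (\<forall>v. v$1 = s \<longrightarrow> \<bar>v$2\<bar> < r \<longrightarrow>
      1 / K * (\<bar>v$2 - g\<bar> + \<bar>s\<bar> ^ m) \<le> horizontal_gradient_norm w (\<phi> v))"
    proof (intro exI[of _ "v0 $ 2"] conjI allI impI)
      show "\<bar>v0 $ 2\<bar> \<le> r" using v0(1) by (simp add: Q_def)
      fix v :: "real^2" assume v: "v $ 1 = s" "\<bar>v $ 2\<bar> < r"
      then have vQ: "v \<in> Q" using s by (simp add: Q_def)
      let ?d = "v $ 2 - v0 $ 2"
      have d: "v - v0 = ?d *\<^sub>R ?t" using v01 v(1) by (simp add: vec_eq_iff forall_2 axis_def)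
      have lin: "linear (frechet_derivative A (at \<xi>))" "linear (frechet_derivative B (at \<xi>))" if "\<xi> \<in> Q" for \<xi>
        using smooth_on_has_derivative[OF smAB(1), of \<xi>] smooth_on_has_derivative[OF smAB(2), of \<xi>]
          has_derivative_linear QV'(2) that by blast+
      obtain \<xi> where \<xi>: "\<xi> \<in> Q" "A v - A v0 = frechet_derivative A (at \<xi>) (v - v0)"
        using convex_mean_value[OF smAB(1) Q(2) QV'(2) vQ v0(1)] by blast
      have "\<bar>A v\<bar> = \<bar>?d\<bar> * \<bar>frechet_derivative A (at \<xi>) ?t\<bar>"
        using \<xi>(2) A0 linear_scale[OF lin(1)[OF \<xi>(1)]] unfolding d by (simp add: abs_mult)
      moreover have "c1 \<le> \<bar>frechet_derivative A (at \<xi>) ?t\<bar>"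
        using \<xi>(1) QV'(1) by (auto simp: V'_def)
      ultimately have Av: "\<bar>?d\<bar> * c1 \<le> \<bar>A v\<bar>" by (simp add: mult_left_mono)
      obtain \<zeta> where \<zeta>: "\<zeta> \<in> Q" "B v - B v0 = frechet_derivative B (at \<zeta>) (v - v0)"
        using convex_mean_value[OF smAB(2) Q(2) QV'(2) vQ v0(1)] by blast
      have "\<bar>B v - B v0\<bar> = \<bar>?d\<bar> * \<bar>frechet_derivative B (at \<zeta>) ?t\<bar>"
        using \<zeta>(2) linear_scale[OF lin(2)[OF \<zeta>(1)]] unfolding d by (simp add: abs_mult)
      moreover have "\<bar>frechet_derivative B (at \<zeta>) ?t\<bar> \<le> C2"
        using \<zeta>(1) QV'(1) by (auto simp: V'_def)
      ultimately have "\<bar>B v - B v0\<bar> \<le> \<bar>?d\<bar> * C2" by (simp add: mult_left_mono)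
      then have Bv: "c3 * \<bar>s\<bar> ^ m \<le> \<bar>B v\<bar> + \<bar>?d\<bar> * C2" using B0 by linarith
      let ?h = "horizontal_gradient_norm w (\<phi> v)"
      have "\<phi> v \<in> U" using vQ QV'(2) \<phi>U by blast
      from abs_N_T_le_gradient_norm[OF U(3) this ab]
      have h: "\<bar>A v\<bar> \<le> ?h" "\<bar>B v\<bar> \<le> ?h" by (auto simp: A_def B_def \<alpha>_def \<beta>_def)
      have d1: "\<bar>?d\<bar> \<le> ?h / c1" using Av h(1) c1 by (simp add: field_simps)
      then have "\<bar>?d\<bar> * C2 \<le> ?h / c1 * C2" using C2 by (intro mult_right_mono) auto
      then have "c3 * \<bar>s\<bar> ^ m \<le> ?h * (1 + C2 / c1)" using Bv h(2) by (simp add: algebra_simps)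
      then have "\<bar>s\<bar> ^ m \<le> ?h * (1 + C2 / c1) / c3" using c3 by (simp add: pos_le_divide_eq mult.commute)
      then have "\<bar>?d\<bar> + \<bar>s\<bar> ^ m \<le> ?h * K" using d1 by (simp add: K_def algebra_simps)
      then show "1 / K * (\<bar>?d\<bar> + \<bar>s\<bar> ^ m) \<le> ?h" using K by (simp add: field_simps)
    qed
  qed
qed

section \<open>Local integrability\<close>

lemma continuous_on_gradient_norm:
  assumes "open U" "smooth_on u U"
  shows "continuous_on U (horizontal_gradient_norm u)"
  unfolding horizontal_gradient_norm_def[abs_def]
  by (intro continuous_intros smooth_on_continuous_on[OF smooth_on_lie_deriv_X[OF assms]]
      smooth_on_continuous_on[OF smooth_on_lie_deriv_Y[OF assms]])

lemma gradient_norm_eq_0_iff: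
  assumes "local_defining_function S p U u" "q \<in> S \<inter> U"
  shows "horizontal_gradient_norm u q = 0 \<longleftrightarrow> q \<in> characteristic_set S"
  using characteristic_set_iff[OF local_defining_function_move[OF assms(1)]] assms(2)
  by (auto simp: horizontal_gradient_norm_def sum_power2_eq_zero_iff)

lemma square_eq_cbox: "{v :: real^2. \<bar>v$1\<bar> \<le> r \<and> \<bar>v$2\<bar> \<le> r} = cbox (vector [-r, -r]) (vector [r, r])"
  and rectangle_eq_box: "{v :: real^2. \<bar>v$1\<bar> < d \<and> \<bar>v$2\<bar> < r} = box (vector [-d, -r]) (vector [d, r])"
  by (auto simp: mem_box_cart forall_2 vector_2)

lemma measurable_inverse_indicator:
  fixes F :: "'a::euclidean_space \<Rightarrow> real"
  assumes "open Q" "continuous_on Q F"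
  shows "(\<lambda>v. ennreal (1 / F v) * indicator Q v) \<in> borel_measurable borel"
proof -
  have [measurable]: "(\<lambda>v. indicator Q v *\<^sub>R F v) \<in> borel_measurable borel" "Q \<in> sets borel"
    using borel_measurable_continuous_on_indicator[of Q F] assms by auto
  have "(\<lambda>v. ennreal (1 / F v) * indicator Q v) = (\<lambda>v. ennreal (1 / (indicator Q v *\<^sub>R F v)) * indicator Q v)"
    by (auto simp: fun_eq_iff split: split_indicator)
  also have "\<dots> \<in> borel_measurable borel" by measurable
  finally show ?thesis .
qed

text \<open>At a non-characteristic point the gradient norm is bounded below on a small square; at a
  characteristic point the planar estimate applies. The compact set \<open>C\<close> between
  \<open>V1\<close> and \<open>V\<close> is kept for the uniform bounds on the curvature and on the
  density.\<close>

lemma inverse_gradient_norm_integrable: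
  assumes S: "smooth_embedded_surface S" and p: "p \<in> S"
    and char: "p \<in> characteristic_set S \<Longrightarrow> p isolated_in characteristic_set S \<and> mildly_degenerate S p"
  obtains U w V \<phi> V1 C where "local_defining_function S p U w" "local_parametrization S V \<phi>"
    "\<phi> ` V \<subseteq> S \<inter> U" "open V1" "V1 \<subseteq> C" "compact C" "C \<subseteq> V" "0 \<in> V1" "\<phi> 0 = p"
    "\<And>v. v \<in> V1 \<Longrightarrow> \<phi> v \<in> characteristic_set S \<Longrightarrow> v = 0"
    "(\<integral>\<^sup>+ v \<in> V1. ennreal (1 / horizontal_gradient_norm w (\<phi> v)) \<partial>lborel) < \<infinity>"
proof (cases "p \<in> characteristic_set S")
  case True
  obtain T where T: "open T" "T \<inter> characteristic_set S = {p}"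
    using char[OF True] unfolding isolated_in_def by blast
  obtain U w V \<phi> \<delta> r m c where w: "local_defining_function S p U w" and \<phi>: "local_parametrization S V \<phi>"
    "0 \<in> V" "\<phi> 0 = p" "\<phi> ` V \<subseteq> S \<inter> U" and \<delta>: "0 < \<delta>" "\<delta> \<le> r"
    and sub: "{v. \<bar>v$1\<bar> \<le> r \<and> \<bar>v$2\<bar> \<le> r} \<subseteq> V" and mc: "m > 0" "c > 0"
    and lower: "\<And>s. s \<noteq> 0 \<Longrightarrow> \<bar>s\<bar> < \<delta> \<Longrightarrow> \<exists>g. \<bar>g\<bar> \<le> r \<and>
      (\<forall>v. v$1 = s \<longrightarrow> \<bar>v$2\<bar> < r \<longrightarrow> c * (\<bar>v$2 - g\<bar> + \<bar>s\<bar> ^ m) \<le> horizontal_gradient_norm w (\<phi> v))"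
    by (rule mildly_degenerate_lower_bound[OF True conjunct2[OF char[OF True]]]) blast
  have U: "open U" "smooth_on w U" using w unfolding local_defining_function_def by auto
  have V: "open V" "smooth_on \<phi> V" using \<phi>(1) unfolding local_parametrization_def by auto
  obtain \<psi> where \<psi>: "homeomorphism V (\<phi> ` V) \<phi> \<psi>" using \<phi>(1) unfolding local_parametrization_def by blast
  let ?C = "{v :: real^2. \<bar>v$1\<bar> \<le> r \<and> \<bar>v$2\<bar> \<le> r}" and ?Q = "{v :: real^2. \<bar>v$1\<bar> < \<delta> \<and> \<bar>v$2\<bar> < r}"
  have QV: "?Q \<subseteq> ?C" "?Q \<subseteq> V" using sub \<delta> by (auto intro!: subsetD[OF sub])
  have oQ: "open ?Q" unfolding rectangle_eq_box by (rule open_box)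
  have cont: "continuous_on ?Q (\<lambda>v. horizontal_gradient_norm w (\<phi> v))"
    using \<phi>(4) QV(2) by (intro continuous_on_compose2[OF continuous_on_gradient_norm[OF U]
          continuous_on_subset[OF smooth_on_continuous_on[OF V(2)]]]) auto
  have fin: "(\<integral>\<^sup>+ v \<in> ?Q. ennreal (1 / horizontal_gradient_norm w (\<phi> v)) \<partial>lborel) < \<infinity>"
    by (rule nn_integral_box_inverse_finite[OF measurable_inverse_indicator[OF oQ cont] mc(2,1) lower])
  \<comment> \<open>Isolation enters here: the part of the patch inside \<open>T\<close> contains no
    characteristic point except \<open>p\<close>.\<close>
  define V1 where "V1 = ?Q \<inter> \<phi> -` T"
  show ?thesis
  proof (rule that[OF w \<phi>(1,4)])
    show "open V1"
      unfolding V1_def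
      by (rule continuous_open_preimage[OF continuous_on_subset[OF smooth_on_continuous_on[OF V(2)] QV(2)] oQ T(1)])
    show "V1 \<subseteq> ?C" "compact ?C" "?C \<subseteq> V"
      using QV(1) sub unfolding V1_def by (auto simp: square_eq_cbox)
    show "0 \<in> V1" using \<delta> T \<phi>(3) by (auto simp: V1_def)
    show "v = 0" if v: "v \<in> V1" "\<phi> v \<in> characteristic_set S" for v
    proof -
      have "\<phi> v = \<phi> 0" using v T(2) \<phi>(3) by (auto simp: V1_def)
      moreover have "v \<in> V" using v QV(2) by (auto simp: V1_def)
      ultimately show ?thesis using \<psi> \<phi>(2) unfolding homeomorphism_def by metis
    qed
    have "(\<integral>\<^sup>+ v \<in> V1. ennreal (1 / horizontal_gradient_norm w (\<phi> v)) \<partial>lborel) \<le>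
        (\<integral>\<^sup>+ v \<in> ?Q. ennreal (1 / horizontal_gradient_norm w (\<phi> v)) \<partial>lborel)"
      by (intro nn_integral_mono) (auto simp: V1_def split: split_indicator)
    then show "(\<integral>\<^sup>+ v \<in> V1. ennreal (1 / horizontal_gradient_norm w (\<phi> v)) \<partial>lborel) < \<infinity>"
      using fin by (rule order.strict_trans1)
  qed (rule \<phi>(3))
next
  case False
  obtain U w where w: "local_defining_function S p U w"
    using S p unfolding smooth_embedded_surface_def by blast
  obtain w1 w2 e where tri: "orthonormal_triple w1 w2 e" and e: "frechet_derivative w (at p) e \<noteq> 0"
    by (rule transversal_triple_exists[OF w p])
  obtain V \<phi> where \<phi>: "local_parametrization S V \<phi>" "0 \<in> V" "\<phi> 0 = p" "\<phi> ` V \<subseteq> S \<inter> U"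
    by (rule local_graph[OF tri w p e]) blast
  have U: "open U" "p \<in> U" "smooth_on w U" using w unfolding local_defining_function_def by auto
  have V: "open V" "smooth_on \<phi> V" using \<phi>(1) unfolding local_parametrization_def by auto
  let ?h = "\<lambda>v. horizontal_gradient_norm w (\<phi> v)"
  define d where "d = ?h 0 / 2"
  have "?h 0 \<noteq> 0" using gradient_norm_eq_0_iff[OF w, of p] False p U(2) \<phi>(3) by simp
  moreover have "?h 0 \<ge> 0" by (simp add: horizontal_gradient_norm_def)
  ultimately have d: "d > 0" "d < ?h 0" by (auto simp: d_def)
  have cont: "continuous_on V ?h"
    using \<phi>(4) by (intro continuous_on_compose2[OF continuous_on_gradient_norm[OF U(1,3)] smooth_on_continuous_on[OF V(2)]]) auto
  have "open (V \<inter> ?h -` {d<..})" "0 \<in> V \<inter> ?h -` {d<..}"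
    using continuous_open_preimage[OF cont V(1), of "{d<..}"] \<phi>(2) d by auto
  then obtain r where r: "r > 0" "{v. \<bar>v$1\<bar> \<le> r \<and> \<bar>v$2\<bar> \<le> r} \<subseteq> V \<inter> ?h -` {d<..}"
    using open_contains_square by blast
  let ?C = "{v :: real^2. \<bar>v$1\<bar> \<le> r \<and> \<bar>v$2\<bar> \<le> r}" and ?Q = "{v :: real^2. \<bar>v$1\<bar> < r \<and> \<bar>v$2\<bar> < r}"
  have QC: "?Q \<subseteq> ?C" by auto
  then have h: "?h v > d" "v \<in> V" if "v \<in> ?Q" for v using r(2) that by blast+
  show ?thesis
  proof (rule that[OF w \<phi>(1,4)])
    show "open ?Q" unfolding rectangle_eq_box by (rule open_box)
    show "?Q \<subseteq> ?C" by (rule QC)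
    show "compact ?C" "?C \<subseteq> V" using r(2) by (auto simp: square_eq_cbox)
    show "0 \<in> ?Q" using r(1) by simp
    show "v = 0" if v: "v \<in> ?Q" "\<phi> v \<in> characteristic_set S" for v
      using gradient_norm_eq_0_iff[OF w, of "\<phi> v"] h[OF v(1)] v(2) d \<phi>(4) by auto
    have "(\<integral>\<^sup>+ v \<in> ?Q. ennreal (1 / ?h v) \<partial>lborel) \<le> (\<integral>\<^sup>+ v. ennreal (1 / d) * indicator ?Q v \<partial>lborel)"
    proof (intro nn_integral_mono)
      fix v :: "real^2"
      show "ennreal (1 / ?h v) * indicator ?Q v \<le> ennreal (1 / d) * indicator ?Q v"
        using h(1)[of v] d(1) by (auto split: split_indicator intro!: ennreal_leI divide_left_mono mult_pos_pos)
    qed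
    also have "\<dots> = ennreal (1 / d) * emeasure lborel ?Q"
      unfolding rectangle_eq_box by (rule nn_integral_cmult_indicator) simp
    also have "\<dots> < \<infinity>"
      unfolding rectangle_eq_box
      using emeasure_lborel_box_finite[of "vector [-r, -r] :: real^2" "vector [r, r]"]
      by (simp add: ennreal_mult_less_top)
    finally show "(\<integral>\<^sup>+ v \<in> ?Q. ennreal (1 / ?h v) \<partial>lborel) < \<infinity>" .
  qed (rule \<phi>(3))
qed

section \<open>Bound and measurability of the mean curvature\<close>

lemma mean_curvature_le:
  assumes H: "is_horizontal_mean_curvature S H" and w: "local_defining_function S p U w"
    and K: "compact K" "K \<subseteq> U"
  obtains L where "L \<ge> 0"
    "\<And>q. q \<in> K \<Longrightarrow> q \<in> S - characteristic_set S \<Longrightarrow> \<bar>H q\<bar> \<le> L * (1 / horizontal_gradient_norm w q)"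
proof -
  have U: "open U" "smooth_on w U" using w unfolding local_defining_function_def by auto
  define P where "P q = \<bar>lie_deriv X_field (lie_deriv X_field w) q\<bar> + \<bar>lie_deriv Y_field (lie_deriv X_field w) q\<bar> +
     \<bar>lie_deriv X_field (lie_deriv Y_field w) q\<bar> + \<bar>lie_deriv Y_field (lie_deriv Y_field w) q\<bar>" for q
  have sm: "smooth_on (lie_deriv V (lie_deriv V' w)) U"
    if "V \<in> {X_field, Y_field}" "V' \<in> {X_field, Y_field}" for V V'
    using that by (auto intro!: smooth_on_lie_deriv U smooth_on_X_field smooth_on_Y_field)
  have "continuous_on K P"
    unfolding P_def by (intro continuous_intros continuous_on_subset[OF smooth_on_continuous_on[OF sm] K(2)]) auto
  then have "bounded (P ` K)" using K(1) compact_continuous_image compact_imp_bounded by blast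
  then obtain L0 where L0: "\<And>q. q \<in> K \<Longrightarrow> \<bar>P q\<bar> \<le> L0" by (auto simp: bounded_iff)
  show ?thesis
  proof
    show "\<bar>L0\<bar> \<ge> 0" by simp
    fix q assume q: "q \<in> K" "q \<in> S - characteristic_set S"
    have qU: "q \<in> U" using q K(2) by blast
    let ?h = "horizontal_gradient_norm w q"
    have "?h \<noteq> 0" using gradient_norm_eq_0_iff[OF w, of q] q qU by auto
    moreover have "?h \<ge> 0" by (simp add: horizontal_gradient_norm_def)
    ultimately have h: "?h > 0" by simp
    have "\<bar>curvature_numerator w q\<bar> \<le> ?h\<^sup>2 * P q"
      using abs_curvature_numerator_le[OF U qU] by (simp add: P_def)
    also have "\<dots> \<le> ?h\<^sup>2 * \<bar>L0\<bar>" using L0[OF q(1)] by (intro mult_left_mono) auto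
    finally have "\<bar>curvature_numerator w q\<bar> / ?h ^ 3 \<le> ?h\<^sup>2 * \<bar>L0\<bar> / ?h ^ 3"
      using h by (intro divide_right_mono) auto
    also have "\<dots> = \<bar>L0\<bar> * (1 / ?h)" using h by (simp add: power2_eq_square power3_eq_cube)
    finally show "\<bar>H q\<bar> \<le> \<bar>L0\<bar> * (1 / ?h)"
      using mean_curvature_eq[OF H local_defining_function_move[OF w qU] q(2)] by simp
  qed
qed

text \<open>The sign of \<open>H\<close> may vary arbitrarily and its values at characteristic
  points are free. On \<open>W\<close> without \<open>p\<close>, however, \<open>|H|\<close> is
  given by a formula in continuous functions, and the remaining point is a measurable set.\<close>

lemma mean_curvature_measurable:
  assumes H: "is_horizontal_mean_curvature S H" and w: "local_defining_function S p U w"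
    and M: "space M = S" "sets M = sets (restrict_space borel S)"
    and W: "W \<in> sets M" "W \<subseteq> U" "W \<inter> characteristic_set S \<subseteq> {p}" and p: "p \<in> S"
  shows "(\<lambda>q. indicator W q *\<^sub>R \<bar>H q\<bar>) \<in> borel_measurable M"
proof -
  have U: "open U" "smooth_on w U" using w unfolding local_defining_function_def by auto
  have borel: "f \<in> borel_measurable M" if "f \<in> borel_measurable borel" for f :: "real^3 \<Rightarrow> real"
    using measurable_restrict_space1[OF that, of S] measurable_cong_sets[OF M(2) refl] by blast
  have [measurable]: "(\<lambda>q. indicator U q *\<^sub>R curvature_numerator w q) \<in> borel_measurable M"
    "(\<lambda>q. indicator U q *\<^sub>R horizontal_gradient_norm w q) \<in> borel_measurable M"
    by (rule borel[OF borel_measurable_continuous_on_indicator[OF borel_open[OF U(1)]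
            continuous_on_curvature_numerator[OF U]]],
        rule borel[OF borel_measurable_continuous_on_indicator[OF borel_open[OF U(1)]
            continuous_on_gradient_norm[OF U]]])
  have [measurable]: "W \<in> sets M" "{p} \<in> sets M"
    using W(1) p unfolding M(2) by (auto simp: sets_restrict_space intro!: image_eqI[of _ _ "{p}"])
  \<comment> \<open>The value \<open>\<bar>H p\<bar>\<close> enters as a constant on
    \<open>{p}\<close>. The indicator of \<open>U\<close> extends the continuous ingredients to
    measurable functions on the whole space.\<close>
  let ?g = "\<lambda>q. indicator {p} q * (indicator W p * \<bar>H p\<bar>) + (1 - indicator {p} q) * (indicator W q *
      (\<bar>indicator U q *\<^sub>R curvature_numerator w q\<bar> / (indicator U q *\<^sub>R horizontal_gradient_norm w q) ^ 3))"
  have "?g \<in> borel_measurable M" by measurable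
  moreover have "indicator W q *\<^sub>R \<bar>H q\<bar> = ?g q" if "q \<in> space M" for q
  proof (cases "q \<in> W \<and> q \<noteq> p")
    case True
    then have "q \<in> S - characteristic_set S" "q \<in> U" using W that M(1) by auto
    then show ?thesis
      using True mean_curvature_eq[OF H local_defining_function_move[OF w]] by simp
  qed (auto split: split_indicator)
  ultimately show ?thesis by (simp cong: measurable_cong)
qed

theorem theorem1p2:
  fixes S :: "(real^3) set"
    and G :: "real^3 \<Rightarrow> real^3 \<Rightarrow> real^3 \<Rightarrow> real"
    and \<sigma>\<^sub>R :: "(real^3) measure"
    and H :: "real^3 \<Rightarrow> real"
  assumes "smooth_embedded_surface S"
    and "\<forall>p \<in> characteristic_set S. p isolated_in characteristic_set S \<and> mildly_degenerate S p"
    and "riemannian_metric G" and "extends_heisenberg_metric G"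
    and "is_induced_measure G S \<sigma>\<^sub>R"
    and "is_horizontal_mean_curvature S H"
  shows "locally_L1 S \<sigma>\<^sub>R H"
  unfolding locally_L1_def
proof
  fix p assume p: "p \<in> S"
  have M: "space \<sigma>\<^sub>R = S" "sets \<sigma>\<^sub>R = sets (restrict_space borel S)"
    using assms(5) by (simp_all add: is_induced_measure_def)
  obtain U w V \<phi> V1 C where w: "local_defining_function S p U w" and \<phi>: "local_parametrization S V \<phi>"
    "\<phi> ` V \<subseteq> S \<inter> U" and V1: "open V1" "V1 \<subseteq> C" "compact C" "C \<subseteq> V" "0 \<in> V1" "\<phi> 0 = p"
    and char: "\<And>v. v \<in> V1 \<Longrightarrow> \<phi> v \<in> characteristic_set S \<Longrightarrow> v = 0"
    and fin: "(\<integral>\<^sup>+ v \<in> V1. ennreal (1 / horizontal_gradient_norm w (\<phi> v)) \<partial>lborel) < \<infinity>"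
    by (rule inverse_gradient_norm_integrable[OF assms(1) p bspec[OF assms(2)]]) blast+
  have V: "open V" "smooth_on \<phi> V" using \<phi>(1) unfolding local_parametrization_def by auto
  have U: "open U" "smooth_on w U" using w unfolding local_defining_function_def by auto
  have V1V: "V1 \<subseteq> V" using V1 by simp
  define W where "W = \<phi> ` V1"
  have W: "openin (top_of_set S) W"
    unfolding W_def by (rule local_parametrization_open_image[OF \<phi>(1) V1(1) V1V])
  then obtain O1 where "open O1" "W = S \<inter> O1" by (auto simp: openin_open)
  then have WM: "W \<in> sets \<sigma>\<^sub>R" unfolding M by (auto simp: sets_restrict_space)
  have WU: "W \<subseteq> S \<inter> U" using \<phi>(2) V1V by (auto simp: W_def)
  have "compact (\<phi> ` C)"
    using compact_continuous_image[OF continuous_on_subset[OF smooth_on_continuous_on[OF V(2)] V1(4)] V1(3)] .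
  moreover have "\<phi> ` C \<subseteq> U" using \<phi>(2) V1(4) by blast
  ultimately obtain L where L: "L \<ge> 0" "\<And>q. q \<in> \<phi> ` C \<Longrightarrow> q \<in> S - characteristic_set S \<Longrightarrow>
      \<bar>H q\<bar> \<le> L * (1 / horizontal_gradient_norm w q)"
    using mean_curvature_le[OF assms(6) w] by metis
  obtain K where K: "K \<ge> 0"
    "\<And>A. A \<in> sets borel \<Longrightarrow> A \<subseteq> C \<Longrightarrow> emeasure \<sigma>\<^sub>R (\<phi> ` A) \<le> ennreal K * emeasure lborel A"
    using induced_measure_le[OF assms(5,3) \<phi>(1) V1(3,4)] by blast
  define g where "g q = indicator W q *\<^sub>R \<bar>H q\<bar>" for q
  have g: "g \<in> borel_measurable \<sigma>\<^sub>R"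
    unfolding g_def
  proof (rule mean_curvature_measurable[OF assms(6) w M WM _ _ p])
    show "W \<inter> characteristic_set S \<subseteq> {p}" using char V1(6) by (auto simp: W_def)
  qed (use WU in auto)
  have "(\<integral>\<^sup>+ q. ennreal (norm (g q)) \<partial>\<sigma>\<^sub>R) = (\<integral>\<^sup>+ q \<in> \<phi> ` V1. ennreal (norm (g q)) \<partial>\<sigma>\<^sub>R)"
    by (intro nn_integral_cong) (simp add: g_def W_def split: split_indicator)
  also have "\<dots> \<le> (\<integral>\<^sup>+ v \<in> V1. ennreal K * ennreal (norm (g (\<phi> v))) \<partial>lborel)"
    using K(2) V1(2) g by (intro nn_integral_induced_measure_le[OF assms(5) \<phi>(1) V1(1) V1V]) auto
  also have "\<dots> \<le> (\<integral>\<^sup>+ v. ennreal (K * L) * (ennreal (1 / horizontal_gradient_norm w (\<phi> v)) * indicator V1 v) \<partial>lborel)"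
  proof (rule nn_integral_mono_AE, rule eventually_mono[OF AE_lborel_singleton[of "0::real^2"]])
    \<comment> \<open>The parameter 0 is discarded as a null set: its image \<open>p\<close> may be
      characteristic, where the gradient norm vanishes and \<open>H\<close> is
      unconstrained.\<close>
    fix v :: "real^2" assume v0: "v \<noteq> 0"
    show "ennreal K * ennreal (norm (g (\<phi> v))) * indicator V1 v \<le>
      ennreal (K * L) * (ennreal (1 / horizontal_gradient_norm w (\<phi> v)) * indicator V1 v)"
    proof (cases "v \<in> V1")
      case True
      then have "\<phi> v \<in> \<phi> ` C" "\<phi> v \<in> S - characteristic_set S"
        using V1(2) char[OF True] v0 \<phi>(2) V1V by auto
      then have "norm (g (\<phi> v)) \<le> L * (1 / horizontal_gradient_norm w (\<phi> v))"
        using L(2) True by (simp add: g_def W_def)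
      from mult_left_mono[OF this K(1)]
      have "K * norm (g (\<phi> v)) \<le> K * L * (1 / horizontal_gradient_norm w (\<phi> v))"
        by (simp only: mult.assoc)
      then show ?thesis
        using True K(1) L(1) by (simp add: ennreal_leI horizontal_gradient_norm_def flip: ennreal_mult)
    qed simp
  qed
  also have "\<dots> = ennreal (K * L) * (\<integral>\<^sup>+ v \<in> V1. ennreal (1 / horizontal_gradient_norm w (\<phi> v)) \<partial>lborel)"
  proof (rule nn_integral_cmult)
    have "continuous_on V1 (\<lambda>v. horizontal_gradient_norm w (\<phi> v))"
      using \<phi>(2) V1V by (intro continuous_on_compose2[OF continuous_on_gradient_norm[OF U]
            continuous_on_subset[OF smooth_on_continuous_on[OF V(2)]]]) auto
    from measurable_inverse_indicator[OF V1(1) this]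
    show "(\<lambda>v. ennreal (1 / horizontal_gradient_norm w (\<phi> v)) * indicator V1 v) \<in> borel_measurable lborel"
      by simp
  qed
  also have "\<dots> < \<infinity>" using fin by (simp add: ennreal_mult_less_top)
  finally have "integrable \<sigma>\<^sub>R g" using g by (intro integrableI_bounded) auto
  moreover have "p \<in> W" using V1(5,6) by (auto simp: W_def)
  ultimately show "\<exists>W. openin (top_of_set S) W \<and> p \<in> W \<and> set_integrable \<sigma>\<^sub>R W (\<lambda>q. \<bar>H q\<bar>)"
    using W unfolding set_integrable_def g_def by blast
qed

end
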